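(* Let $n,k,h\in\mathbb N$, and let $\|\cdot\|_{X(0,1)}$ be a rearrangement-invariant function norm. Let $\gamma_n$ be the Gauss measure on $\mathbb R^n$. Then $$\big(X_{k,G}\big)_{h,G}(\mathbb R^n,\gamma_n)=X_{k+h,G}(\mathbb R^n,\gamma_n),$$ up to equivalent norms.
   Context: The Gauss measure is $d\gamma_n(x)=(2\pi)^{-\frac n2}e^{-\frac{|x|^2}2}dx$ on $\mathbb R^n$. Rearrangement-invariant (r.i.) spaces. $\mathcal M_+(0,1)$ is the set of measurable functions $(0,1)\to[0,\infty]$. For a measurable $u:\mathbb R^n\to[-\infty,\infty]$, $u^*(s)=\sup\{t\in\mathbb R:\gamma_n(\{x:|u(x)|>t\})>s\}$ for $s\in(0,1)$ (similarly for functions on $(0,1)$ with Lebesgue measure). An r.i. function norm is a functional $\|\cdot\|_{X(0,1)}:\mathcal M_+(0,1)\to[0,\infty]$ such that for all $f,g,f_j\in\mathcal M_+(0,1)$ and $\lambda\ge0$: (P1) $\|f\|=0$ iff $f=0$ a.e., $\|\lambda f\|=\lambda\|f\|$, $\|f+g\|\le\|f\|+\|g\|$; (P2) $f\le g$ a.e. implies $\|f\|\le\|g\|$; (P3) $f_j\nearrow f$ a.e. implies $\|f_j\|\nearrow\|f\|$; (P4) $\|1\|<\infty$; (P5) $\int_0^1f\,dx\le C\|f\|$ with $C$ independent of $f$; (P6) $\|f\|=\|g\|$ whenever $f^*=g^*$. The associate norm is $\|g\|_{X'(0,1)}=\sup\{\int_0^1fg\,ds:f\ge0,\ \|f\|_{X(0,1)}\le1\}$,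 again an r.i. function norm, and $X''=X$. The space $X(\mathbb R^n,\gamma_n)$ consists of all measurable $u$ with $\|u\|_{X(\mathbb R^n,\gamma_n)}:=\|u^*\|_{X(0,1)}<\infty$. The norms $X_{m,G}$. For $m\in\mathbb N$ and an r.i. function norm $\|\cdot\|_{X(0,1)}$, let $\|\cdot\|_{\widetilde X_m(0,1)}$ be the r.i. function norm whose associate norm is $\|g\|_{\widetilde X_m'(0,1)}=\big\|\frac1s\int_0^s(\log\frac sr)^{m-1}g^*(r)\,dr\big\|_{X'(0,1)}$, $g\in\mathcal M_+(0,1)$, and let $\|f\|_{X_{m,G}(0,1)}=\big\|(\log\frac2s)^{\frac m2}f^*(s)\big\|_{\widetilde X_m(0,1)}$ for $f\in\mathcal M_+(0,1)$ (an r.i. function norm). The space $(X_{k,G})_{h,G}$ is obtained by applying this construction with $m=h$ to the norm $\|\cdot\|_{X_{k,G}(0,1)}$. *)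

theory Defs
  imports "HOL-Analysis.Analysis"
begin

definition gauss_measure :: "(real ^ 'n::finite) measure" where
  "gauss_measure =
     density lebesgue (\<lambda>x. ennreal ((2 * pi) powr (- (real CARD('n) / 2)) * exp (- (norm x)\<^sup>2 / 2)))"

abbreviation unit_interval_measure :: "real measure" where
  "unit_interval_measure \<equiv> lebesgue_on {0<..<1}"

text \<open>
  A function on \<open>(0,1)\<close> is represented by a function on the reals whose values outside
  \<open>(0,1)\<close> are ignored.
\<close>

definition Mplus :: "(real \<Rightarrow> ennreal) set" where
  "Mplus = borel_measurable unit_interval_measure"

text \<open>
  The decreasing rearrangement. For \<open>s < 1\<close> and a probability measure every negative \<open>t\<close> is
  admissible, so the supremum is nonnegative and \<open>e2ennreal\<close> loses nothing.
\<close>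

definition rearrangement :: "'a measure \<Rightarrow> ('a \<Rightarrow> ereal) \<Rightarrow> real \<Rightarrow> ennreal" where
  "rearrangement M u s =
     e2ennreal (Sup {ereal t | t. emeasure M {x \<in> space M. \<bar>u x\<bar> > ereal t} > ennreal s})"

definition rearr01 :: "(real \<Rightarrow> ennreal) \<Rightarrow> real \<Rightarrow> ennreal" where
  "rearr01 f = rearrangement unit_interval_measure (\<lambda>x. enn2ereal (f x))"

definition ri_function_norm :: "((real \<Rightarrow> ennreal) \<Rightarrow> ennreal) \<Rightarrow> bool" where
  "ri_function_norm X \<longleftrightarrow>
     (\<forall>f\<in>Mplus. X f = 0 \<longleftrightarrow> (AE x in unit_interval_measure. f x = 0)) \<and>
     (\<forall>f\<in>Mplus. \<forall>c::real. 0 \<le> c \<longrightarrow> X (\<lambda>x. ennreal c * f x) = ennreal c * X f) \<and>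
     (\<forall>f\<in>Mplus. \<forall>g\<in>Mplus. X (\<lambda>x. f x + g x) \<le> X f + X g) \<and>
     (\<forall>f\<in>Mplus. \<forall>g\<in>Mplus. (AE x in unit_interval_measure. f x \<le> g x) \<longrightarrow> X f \<le> X g) \<and>
     (\<forall>F f. (\<forall>j::nat. F j \<in> Mplus) \<and> f \<in> Mplus \<and>
        (AE x in unit_interval_measure. incseq (\<lambda>j. F j x) \<and> (\<lambda>j. F j x) \<longlonglongrightarrow> f x)
        \<longrightarrow> incseq (\<lambda>j. X (F j)) \<and> (\<lambda>j. X (F j)) \<longlonglongrightarrow> X f) \<and>
     X (\<lambda>_. 1) < \<infinity> \<and>
     (\<exists>C::real. \<forall>f\<in>Mplus. (\<integral>\<^sup>+x. f x \<partial>unit_interval_measure) \<le> ennreal C * X f) \<and>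
     (\<forall>f\<in>Mplus. \<forall>g\<in>Mplus. (\<forall>s\<in>{0<..<1}. rearr01 f s = rearr01 g s) \<longrightarrow> X f = X g)"

definition associate_norm ::
    "((real \<Rightarrow> ennreal) \<Rightarrow> ennreal) \<Rightarrow> (real \<Rightarrow> ennreal) \<Rightarrow> ennreal" where
  "associate_norm X g =
     (SUP f \<in> {f \<in> Mplus. X f \<le> 1}. \<integral>\<^sup>+s. f s * g s \<partial>unit_interval_measure)"

definition tilde_associate_norm ::
    "nat \<Rightarrow> ((real \<Rightarrow> ennreal) \<Rightarrow> ennreal) \<Rightarrow> (real \<Rightarrow> ennreal) \<Rightarrow> ennreal" where
  "tilde_associate_norm m X g =
     associate_norm X
       (\<lambda>s. ennreal (1 / s) *
          (\<integral>\<^sup>+r\<in>{0<..<s}. (ennreal ((ln (s / r)) ^ (m - 1)) * rearr01 g r) \<partial>lebesgue))"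

text \<open>
  An r.i. function norm is determined on \<open>Mplus\<close> by its associate norm (as \<open>X'' = X\<close>), so the
  choice below is the norm in question; only its irrelevant values off \<open>Mplus\<close> are arbitrary.
\<close>

definition tilde_norm ::
    "nat \<Rightarrow> ((real \<Rightarrow> ennreal) \<Rightarrow> ennreal) \<Rightarrow> (real \<Rightarrow> ennreal) \<Rightarrow> ennreal" where
  "tilde_norm m X =
     (SOME Y. ri_function_norm Y \<and>
        (\<forall>g\<in>Mplus. associate_norm Y g = tilde_associate_norm m X g))"

definition XG_norm ::
    "nat \<Rightarrow> ((real \<Rightarrow> ennreal) \<Rightarrow> ennreal) \<Rightarrow> (real \<Rightarrow> ennreal) \<Rightarrow> ennreal" where
  "XG_norm m X f =
     tilde_norm m X (\<lambda>s. ennreal ((ln (2 / s)) powr (real m / 2)) * rearr01 f s)"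

definition gauss_norm ::
    "((real \<Rightarrow> ennreal) \<Rightarrow> ennreal) \<Rightarrow> (real ^ 'n::finite \<Rightarrow> ereal) \<Rightarrow> ennreal" where
  "gauss_norm X u = X (rearrangement gauss_measure u)"

definition gauss_space ::
    "((real \<Rightarrow> ennreal) \<Rightarrow> ennreal) \<Rightarrow> (real ^ 'n::finite \<Rightarrow> ereal) set" where
  "gauss_space X = {u \<in> borel_measurable gauss_measure. gauss_norm X u < \<infinity>}"

end

theory Submission
  imports Defs
begin

text \<open>
  Write \<open>w s = ln (2 / s)\<close>, let \<open>T\<^sub>m\<close> be the Hardy operator with kernel \<open>ln (s / r) ^ (m - 1) / s\<close> on
  \<open>r < s\<close> and \<open>Z\<close> the norm \<open>X\<^sub>k\<^sub>,\<^sub>G\<close>. By duality, both inclusions are statements about associate norms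
  on decreasing functions: \<open>Z' (T\<^sub>h g)\<close> has to be compared with \<open>X' (T\<^sub>k\<^sub>+\<^sub>h (w powr (- k / 2) * g))\<close>.
  Since \<open>T\<^sub>k \<circ> T\<^sub>h\<close> is a multiple of \<open>T\<^sub>k\<^sub>+\<^sub>h\<close>, and since \<open>w r / w t \<le> ln (s / r) / ln (s / t)\<close> for
  \<open>r < t < s\<close> allows the weight to be moved through the operators, the comparison would be immediate if
  multiplication by \<open>w powr (- k / 2)\<close> preserved monotonicity. It does not. The product is replaced by a
  decreasing dyadic majorant, which costs only a constant: the averages of a decreasing \<open>f\<close> over the level
  sets of the majorant are again decreasing, have norm at most that of \<open>f\<close>, and the weighted function and
  its majorant have comparable integrals over every level set.
\<close>

section \<open>Decreasing rearrangements on the unit interval\<close>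

text \<open>The two inequalities are asymmetric. The weight with negative exponent increases, so it
  leaves \<open>hardy h\<close> at no cost in the direction that \<open>associate_XG_norm_ge\<close>
  needs; the difficulty there is that the test function, weight times adjoint operator, must again
  be decreasing, which a substitution by powers shows. In \<open>associate_XG_norm_le\<close> the
  weight has to cross both operators. Of the \<open>k\<close> factors
  \<open>sqrt (w r / w t)\<close> that arise, \<open>k - 1\<close> are enlarged to full ratios and
  absorbed by the kernel; the last one stays a square root, because its integral is of the order of
  \<open>ln (s / r)\<close>, whereas the full ratio would cost a further logarithm. A second
  obstacle is that \<open>tilde_norm\<close> is a choice: its existence and the identity
  \<open>X'' = X\<close> are proved here, the latter by separating a function from the unit ball
  with a nearest point in \<open>L2\<close>. The intermediate norm \<open>XG_norm k X\<close> enters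
  through the two properties in \<open>admissible\<close>, which suffice to repeat the
  construction.\<close>

abbreviation (input) U :: "real measure" where "U \<equiv> unit_interval_measure"

text \<open>The prover for measurability needs \<open>space U\<close> to stay folded.\<close>
declare space_lebesgue_on [simp del] space_restrict_space2 [simp del]

lemma space_U: "space U = {0<..<1}"
  by (simp add: space_restrict_space)

lemma emeasure_U: "emeasure U (space U) = 1"
  by (simp add: space_U emeasure_restrict_space)

lemma emeasure_U_Ioo: "0 \<le> a \<Longrightarrow> a \<le> 1 \<Longrightarrow> emeasure U {0<..<a} = ennreal a"
  by (subst emeasure_restrict_space) auto

interpretation U: finite_measure U
  by standard (metis emeasure_U ennreal_one_neq_top infinity_ennreal_def)

lemma nn_integral_U: "(\<integral>\<^sup>+x. f x \<partial>U) = (\<integral>\<^sup>+x. f x * indicator {0<..<1} x \<partial>lborel)"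
  by (subst nn_integral_restrict_space) (auto simp: nn_integral_completion)

lemma measurable_U_borel: "f \<in> borel_measurable borel \<Longrightarrow> f \<in> borel_measurable U"
  by (intro measurable_restrict_space1 measurable_completion) simp

lemma measurable_U_id [measurable]: "(\<lambda>x. x) \<in> borel_measurable U"
  by (rule measurable_U_borel) simp

lemma Mplus_iff: "f \<in> Mplus \<longleftrightarrow> f \<in> borel_measurable U"
  by (simp add: Mplus_def)

definition dec01 :: "(real \<Rightarrow> 'a::order) \<Rightarrow> bool" where
  "dec01 f \<longleftrightarrow> (\<forall>x y. 0 < x \<longrightarrow> x \<le> y \<longrightarrow> y < 1 \<longrightarrow> f y \<le> f x)"

lemma dec01D: "dec01 f \<Longrightarrow> 0 < x \<Longrightarrow> x \<le> y \<Longrightarrow> y < 1 \<Longrightarrow> f y \<le> f x"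
  by (auto simp: dec01_def)

text \<open>Superlevel sets of a decreasing function are intervals. The indicator removes the
  arbitrary values outside \<open>(0,1)\<close>, and the result is Borel, as composition with a
  measurable map and substitutions require.\<close>

lemma dec01_borel:
  fixes f :: "real \<Rightarrow> ennreal"
  assumes "dec01 f"
  shows "(\<lambda>x. f x * indicator {0<..<1} x) \<in> borel_measurable borel"
proof (rule borel_measurableI_greater)
  fix y :: ennreal
  have "is_interval {x \<in> {0<..<1}. y < f x}"
    unfolding is_interval_1 using assms by (auto simp: dec01_def intro: less_le_trans)
  then have "{x \<in> {0<..<1}. y < f x} \<in> sets borel"
    by (rule real_interval_borel_measurable)
  moreover have "{x \<in> space borel. y < f x * indicator {0<..<1} x} = {x \<in> {0<..<1}. y < f x}"
    by (auto simp: indicator_def)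
  ultimately show "{x \<in> space borel. y < f x * indicator {0<..<1} x} \<in> sets borel" by simp
qed

lemma dec01_measurable:
  fixes f :: "real \<Rightarrow> ennreal"
  assumes "dec01 f"
  shows "f \<in> borel_measurable U"
proof -
  have "(\<lambda>x. f x * indicator {0<..<1} x) \<in> borel_measurable U"
    by (rule measurable_U_borel[OF dec01_borel[OF assms]])
  then show ?thesis
    by (rule measurable_cong[THEN iffD1, rotated]) (simp add: space_U)
qed

lemma rearr01_gt_iff:
  assumes f: "f \<in> borel_measurable U" and s: "0 \<le> s"
  shows "t < rearr01 f s \<longleftrightarrow> ennreal s < emeasure U {x \<in> space U. t < f x}"
proof -
  let ?S = "{ereal t | t. emeasure U {x \<in> space U. \<bar>enn2ereal (f x)\<bar> > ereal t} > ennreal s}"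
  show ?thesis
  proof
    assume "t < rearr01 f s"
    then have "t < e2ennreal (Sup ?S)" by (simp add: rearr01_def rearrangement_def)
    then have "enn2ereal t < Sup ?S"
      using e2ennreal_mono[of "Sup ?S" "enn2ereal t"] by (force simp: not_le[symmetric] simp del: not_le)
    then obtain r where r: "enn2ereal t < ereal r"
      "ennreal s < emeasure U {x \<in> space U. \<bar>enn2ereal (f x)\<bar> > ereal r}"
      unfolding less_Sup_iff by blast
    note r(2)
    also have "emeasure U {x \<in> space U. \<bar>enn2ereal (f x)\<bar> > ereal r} \<le> emeasure U {x \<in> space U. t < f x}"
    proof (rule emeasure_mono)
      show "{x \<in> space U. \<bar>enn2ereal (f x)\<bar> > ereal r} \<subseteq> {x \<in> space U. t < f x}"
        using r(1) by (auto simp: less_ennreal.rep_eq)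
      show "{x \<in> space U. t < f x} \<in> sets U" using f by measurable
    qed
    finally show "ennreal s < emeasure U {x \<in> space U. t < f x}" .
  next
    assume *: "ennreal s < emeasure U {x \<in> space U. t < f x}"
    have fin: "t \<noteq> top"
      using * by (auto simp: top_unique)
    define A where "A n = {x \<in> space U. t + ennreal (1 / Suc n) < f x}" for n :: nat
    have un: "{x \<in> space U. t < f x} = (\<Union>n. A n)"
    proof safe
      fix x assume x: "x \<in> space U" "t < f x"
      obtain q where q: "t < ennreal q" "ennreal q < f x" using ennreal_rat_dense[OF x(2)] by auto
      obtain t0 where t0: "t = ennreal t0" "0 \<le> t0" using fin by (cases t) auto
      have "0 < q - t0" using q(1) t0 by (simp add: ennreal_less_iff)
      then obtain n :: nat where n: "1 / Suc n < q - t0" using nat_approx_posE by blast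
      have "t + ennreal (1 / Suc n) \<le> ennreal q"
        using n t0 by (auto simp flip: ennreal_plus intro!: ennreal_leI)
      then show "x \<in> (\<Union>n. A n)" using q(2) x unfolding A_def
        by (auto intro: le_less_trans)
    next
      fix x n assume "x \<in> A n"
      then show "x \<in> space U" "t < f x" unfolding A_def
        by (auto intro: le_less_trans[rotated] simp: add_increasing2)
    qed
    have inc: "incseq A"
    proof (rule incseq_SucI)
      fix n
      have "t + ennreal (1 / Suc (Suc n)) \<le> t + ennreal (1 / Suc n)"
        by (intro add_left_mono ennreal_leI) (simp add: frac_le)
      then show "A n \<subseteq> A (Suc n)" unfolding A_def by (blast intro: le_less_trans)
    qed
    have "A n \<in> sets U" for n unfolding A_def using f by measurable
    then have meas: "range A \<subseteq> sets U" by auto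
    have "emeasure U {x \<in> space U. t < f x} = (SUP n. emeasure U (A n))"
      unfolding un by (rule SUP_emeasure_incseq[symmetric, OF meas inc])
    then obtain n where n: "ennreal s < emeasure U (A n)"
      using * by (auto simp: less_SUP_iff)
    define r where "r = enn2real t + 1 / Suc n"
    have r: "ennreal r = t + ennreal (1 / Suc n)" "r > enn2real t"
      unfolding r_def using fin by (auto simp: ennreal_plus top.not_eq_extremum)
    have "0 \<le> r" by (simp add: r_def)
    then have "enn2ereal (ennreal r) = ereal r" by simp
    then have An: "A n = {x \<in> space U. \<bar>enn2ereal (f x)\<bar> > ereal r}"
      unfolding A_def r(1)[symmetric] by (simp add: less_ennreal.rep_eq)
    have "ereal r \<in> ?S"
      by (rule CollectI, rule exI[of _ r], rule conjI[OF refl]) (use n in \<open>unfold An\<close>)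
    then have "ereal r \<le> Sup ?S" by (rule Sup_upper)
    then have "ennreal r \<le> rearr01 f s"
      unfolding rearr01_def rearrangement_def
      by (rule e2ennreal_mono[of "ereal r", simplified])
    moreover have "t < ennreal r"
      using r(2) fin by (cases t) (auto simp: ennreal_less_iff)
    ultimately show "t < rearr01 f s" by simp
  qed
qed

lemma dec01_rearr01:
  assumes f: "f \<in> borel_measurable U"
  shows "dec01 (rearr01 f)"
  unfolding dec01_def
proof (intro allI impI)
  fix x y :: real assume "0 < x" "x \<le> y" "y < 1"
  then show "rearr01 f y \<le> rearr01 f x"
    using rearr01_gt_iff[OF f, of y "rearr01 f x"] rearr01_gt_iff[OF f, of x "rearr01 f x"]
      ennreal_leI[of x y] by (auto simp: not_less[symmetric] intro: le_less_trans)
qed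

lemma dec01_rearrangement: "dec01 (rearrangement M u)"
  unfolding dec01_def rearrangement_def
  by (auto intro!: e2ennreal_mono Sup_subset_mono intro: le_less_trans[OF ennreal_leI])

lemma rearr01_cong_emeasure:
  assumes f: "f \<in> borel_measurable U" and g: "g \<in> borel_measurable U"
    and "\<And>t. emeasure U {x \<in> space U. t < f x} = emeasure U {x \<in> space U. t < g x}" and "0 \<le> s"
  shows "rearr01 f s = rearr01 g s"
proof (rule ccontr)
  assume "rearr01 f s \<noteq> rearr01 g s"
  then consider "rearr01 f s < rearr01 g s" | "rearr01 g s < rearr01 f s" by fastforce
  then show False
    unfolding rearr01_gt_iff[OF f \<open>0 \<le> s\<close>] rearr01_gt_iff[OF g \<open>0 \<le> s\<close>] assms(3)
    by cases (metis assms(3) rearr01_gt_iff[OF f \<open>0 \<le> s\<close>] rearr01_gt_iff[OF g \<open>0 \<le> s\<close>] less_irrefl)+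
qed

text \<open>Rational levels separate the points of \<open>ennreal\<close>, so only countably many
  exceptional null sets have to be united.\<close>

lemma AE_ennreal_eqI:
  fixes f g :: "'a \<Rightarrow> ennreal"
  assumes "\<And>t. AE x in M. t < f x \<longleftrightarrow> t < g x"
  shows "AE x in M. f x = g x"
proof -
  have "AE x in M. \<forall>r::rat. ennreal (real_of_rat r) < f x \<longleftrightarrow> ennreal (real_of_rat r) < g x"
    using assms by (subst AE_all_countable) auto
  then show ?thesis
  proof eventually_elim
    case (elim x)
    show ?case
    proof (rule ccontr)
      assume "f x \<noteq> g x"
      then consider "f x < g x" | "g x < f x" by fastforce
      then show False
      proof cases
        case 1
        then show ?thesis using elim ennreal_rat_dense[OF 1] less_asym by blast
      next
        case 2
        then show ?thesis using elim ennreal_rat_dense[OF 2] less_asym by blast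
      qed
    qed
  qed
qed

lemma AE_iff_if_emeasure_eq:
  assumes "A \<in> sets U" "B \<in> sets U" "A \<subseteq> B" "emeasure U B \<le> emeasure U A"
  shows "AE x in U. x \<in> A \<longleftrightarrow> x \<in> B"
proof (rule AE_I[of _ _ "B - A"])
  have "emeasure U (B - A) = emeasure U B - emeasure U A"
    using assms by (intro emeasure_Diff) auto
  also have "\<dots> = 0"
    using assms by (simp add: diff_eq_0_iff_ennreal less_top[symmetric])
  finally show "emeasure U (B - A) = 0" .
qed (use assms in auto)

text \<open>Equimeasurability: by \<open>rearr01_gt_iff\<close> the superlevel set of the
  rearrangement is the interval from 0 to the measure \<open>d\<close> of the original one.\<close>

lemma emeasure_rearr01_gt:
  assumes f: "f \<in> borel_measurable U"
  shows "emeasure U {s \<in> space U. t < rearr01 f s} = emeasure U {s \<in> space U. t < f s}"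
proof -
  define d where "d = measure U {s \<in> space U. t < f s}"
  have d: "emeasure U {s \<in> space U. t < f s} = ennreal d"
    unfolding d_def by (rule U.emeasure_eq_measure)
  have d1: "0 \<le> d" "d \<le> 1"
    unfolding d_def using U.bounded_measure[of "{s \<in> space U. t < f s}"] emeasure_U
    by (auto simp: measure_def)
  have "{s \<in> space U. t < rearr01 f s} = {0<..<d}"
  proof (intro set_eqI iffI)
    fix x assume "x \<in> {s \<in> space U. t < rearr01 f s}"
    then show "x \<in> {0<..<d}"
      using d rearr01_gt_iff[OF f, of x t] by (simp add: space_U ennreal_less_iff)
  next
    fix x assume "x \<in> {0<..<d}"
    then show "x \<in> {s \<in> space U. t < rearr01 f s}"
      using d d1 rearr01_gt_iff[OF f, of x t] by (simp add: space_U ennreal_less_iff)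
  qed
  then show ?thesis
    using d d1 by (simp add: emeasure_U_Ioo)
qed

text \<open>Only almost everywhere: \<open>rearr01 f\<close> is right-continuous, while
  \<open>f\<close> may have other values at its jumps. At each level the two superlevel sets are
  nested and have the same measure.\<close>

lemma rearr01_dec01_AE:
  assumes "dec01 f"
  shows "AE x in U. rearr01 f x = f x"
proof (rule AE_ennreal_eqI)
  fix t
  have f: "f \<in> borel_measurable U" by (rule dec01_measurable[OF assms])
  have "AE x in U. x \<in> {s \<in> space U. t < rearr01 f s} \<longleftrightarrow> x \<in> {s \<in> space U. t < f s}"
  proof (rule AE_iff_if_emeasure_eq)
    show "{s \<in> space U. t < rearr01 f s} \<subseteq> {s \<in> space U. t < f s}"
    proof safe
      fix s assume s: "s \<in> space U" "t < rearr01 f s"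
      then have "ennreal s < emeasure U {x \<in> space U. t < f x}"
        by (subst (asm) rearr01_gt_iff[OF f]) (auto simp: space_U)
      moreover have "emeasure U {x \<in> space U. t < f x} \<le> emeasure U {0<..<s}" if n: "\<not> t < f s"
      proof (rule emeasure_mono)
        show "{x \<in> space U. t < f x} \<subseteq> {0<..<s}"
        proof safe
          fix x assume x: "x \<in> space U" "t < f x"
          have "\<not> s \<le> x"
            using dec01D[OF assms, of s x] n s x by (auto simp: space_U)
          then show "x \<in> {0<..<s}" using x by (simp add: space_U)
        qed
        show "{0<..<s} \<in> sets U"
          using s by (auto simp: sets_restrict_space_iff space_U)
      qed
      ultimately show "t < f s"
        using s emeasure_U_Ioo[of s] by (metis greaterThanLessThan_iff leD less_imp_le space_U)
    qed
    show "{s \<in> space U. t < rearr01 f s} \<in> sets U"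
      using dec01_measurable[OF dec01_rearr01[OF f]] by measurable
    show "{s \<in> space U. t < f s} \<in> sets U"
      using f by measurable
    show "emeasure U {s \<in> space U. t < f s} \<le> emeasure U {s \<in> space U. t < rearr01 f s}"
      by (simp only: emeasure_rearr01_gt[OF f] order_refl)
  qed
  then show "AE x in U. (t < rearr01 f x) = (t < f x)"
    by (rule AE_mp) (rule AE_I2, simp)
qed

section \<open>Measure-preserving maps of the unit interval\<close>

definition mpres :: "(real \<Rightarrow> real) \<Rightarrow> bool" where
  "mpres \<sigma> \<longleftrightarrow> \<sigma> \<in> borel_measurable U \<and> (\<forall>x\<in>space U. \<sigma> x \<in> {0<..<1}) \<and>
     distr U borel \<sigma> = distr U borel (\<lambda>x. x)"

text \<open>With \<open>l\<close> the value of the rearrangement at \<open>t\<close>, the set where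
  \<open>g\<close> exceeds \<open>l\<close> has measure at most \<open>t\<close>, and adding the
  whole tie set brings it to at least \<open>t\<close>. The tie set cut at \<open>c\<close> has a
  measure that is 1-Lipschitz in \<open>c\<close>, so the intermediate value theorem yields measure
  exactly \<open>t\<close>.\<close>

lemma initial_segment_exists:
  fixes g :: "real \<Rightarrow> ennreal"
  assumes g[measurable]: "g \<in> borel_measurable U" and t: "0 < t" "t < 1"
  obtains l c where "measure U {x \<in> space U. l < g x \<or> (g x = l \<and> x < c)} = t"
proof -
  define l where "l = rearr01 g t"
  define A where "A = {x \<in> space U. l < g x}"
  define B where "B c = {x \<in> space U. g x = l \<and> x < c}" for c :: real
  have A[measurable]: "A \<in> sets U" unfolding A_def by measurable
  have B[measurable]: "B c \<in> sets U" for c unfolding B_def by measurable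
  have At: "measure U A \<le> t"
  proof -
    have "\<not> ennreal t < emeasure U A"
      using rearr01_gt_iff[OF g, of t l] t by (simp add: A_def l_def)
    then show ?thesis using t by (simp add: U.emeasure_eq_measure not_less ennreal_le_iff)
  qed
  have AB: "A \<union> B 1 = {x \<in> space U. l \<le> g x}"
    by (auto simp: A_def B_def space_U)
  have ABt: "t \<le> measure U (A \<union> B 1)"
  proof (cases "l = 0")
    case True
    then have "A \<union> B 1 = space U" by (auto simp: AB)
    then show ?thesis using t emeasure_U by (simp add: measure_def)
  next
    case False
    \<comment> \<open>Continuity from above along levels \<open>u n\<close> increasing to
      \<open>l\<close>; for \<open>l = 0\<close> there is no level below, hence the separate
      case.\<close>
    have "{..<l} \<noteq> {}" using False not_gr_zero by blast
    then obtain u :: "nat \<Rightarrow> ennreal" where u: "incseq u" "range u \<subseteq> {..<l}" "Sup {..<l} = (SUP i. u i)"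
      using ennreal_Sup_countable_SUP by metis
    have ul: "(SUP i. u i) = l" using u(3) by (simp add: False Sup_lessThan)
    define D where "D n = {x \<in> space U. u n < g x}" for n
    have D[measurable]: "D n \<in> sets U" for n unfolding D_def by measurable
    have Dt: "t \<le> measure U (D n)" for n
    proof -
      have "ennreal t < emeasure U (D n)"
        using rearr01_gt_iff[OF g, of t "u n"] u(2) t by (auto simp: D_def l_def)
      then show ?thesis using t by (simp add: U.emeasure_eq_measure ennreal_less_iff)
    qed
    have "A \<union> B 1 = (\<Inter>n. D n)"
    proof (intro set_eqI iffI)
      fix x assume "x \<in> A \<union> B 1"
      then show "x \<in> (\<Inter>n. D n)" using u(2) unfolding AB D_def by (auto intro: less_le_trans)
    next
      fix x assume "x \<in> (\<Inter>n. D n)"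
      then have "x \<in> space U" "\<And>n. u n \<le> g x" by (auto simp: D_def intro: less_imp_le)
      then have "x \<in> space U" "l \<le> g x" using ul by (auto intro: SUP_least)
      then show "x \<in> A \<union> B 1" unfolding AB by auto
    qed
    moreover have "decseq D"
      using incseqD[OF u(1)] unfolding decseq_def D_def by (auto intro: le_less_trans)
    then have "(\<lambda>n. measure U (D n)) \<longlonglongrightarrow> measure U (\<Inter>n. D n)"
      by (intro U.finite_Lim_measure_decseq) auto
    ultimately show ?thesis
      using Dt by (metis LIMSEQ_le_const)
  qed
  have lip: "\<bar>measure U (B c) - measure U (B c')\<bar> \<le> \<bar>c - c'\<bar>" for c c'
  proof -
    have "measure U (B c') - measure U (B c) \<le> c' - c \<and> measure U (B c) \<le> measure U (B c')" if "c \<le> c'" for c c'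
    proof
      have "B c' \<subseteq> B c \<union> {x \<in> space U. c \<le> x \<and> x < c'}" by (auto simp: B_def)
      then have "measure U (B c') \<le> measure U (B c \<union> {x \<in> space U. c \<le> x \<and> x < c'})"
        by (intro U.finite_measure_mono) auto
      also have "\<dots> \<le> measure U (B c) + measure U {x \<in> space U. c \<le> x \<and> x < c'}"
        by (intro measure_Un_le) auto
      also have "measure U {x \<in> space U. c \<le> x \<and> x < c'} = measure lebesgue {x \<in> space U. c \<le> x \<and> x < c'}"
        by (subst measure_restrict_space) (auto simp: space_U)
      also have "\<dots> \<le> measure lebesgue {c..c'}"
        by (intro measure_mono_fmeasurable) (auto simp: space_U intro!: measurable_completion pred_intros_conj1')
      also have "\<dots> = c' - c" using that by simp
      finally show "measure U (B c') - measure U (B c) \<le> c' - c" by simp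
      show "measure U (B c) \<le> measure U (B c')"
        using that by (intro U.finite_measure_mono) (auto simp: B_def)
    qed
    from this[of c c'] this[of c' c] show ?thesis by linarith
  qed
  have cont: "continuous_on {0..1} (\<lambda>c. measure U A + measure U (B c))"
  proof -
    have "1-lipschitz_on {0..1} (\<lambda>c. measure U A + measure U (B c))"
      using lip by (auto intro!: lipschitz_onI simp: dist_real_def)
    then show ?thesis by (rule lipschitz_on_continuous_on)
  qed
  have disj: "measure U (A \<union> B c) = measure U A + measure U (B c)" for c
    by (intro U.finite_measure_Union) (auto simp: A_def B_def)
  have "B 0 = {}" by (auto simp: B_def space_U)
  then obtain c where "measure U A + measure U (B c) = t"
    using IVT'[OF _ _ _ cont, of t] At ABt disj[of 1] by auto
  moreover have "A \<union> B c = {x \<in> space U. l < g x \<or> (g x = l \<and> x < c)}"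
    by (auto simp: A_def B_def)
  ultimately show ?thesis using that[of l c] disj[of c] by simp
qed

text \<open>
  The rank of \<open>x\<close> in the total order that sorts points by decreasing value of \<open>g\<close>, ties being broken
  by position, is uniformly distributed, and \<open>g\<close> is its decreasing rearrangement composed with the rank.
\<close>
lemma mpres_rearr01_exists:
  fixes g :: "real \<Rightarrow> ennreal"
  assumes g[measurable]: "g \<in> borel_measurable U"
  obtains \<sigma> where "mpres \<sigma>" "AE x in U. g x = rearr01 g (\<sigma> x)"
proof -
  define S where "S x = {y \<in> space U. g x < g y \<or> (g y = g x \<and> y < x)}" for x
  have S[measurable]: "S x \<in> sets U" for x unfolding S_def by measurable
  define r where "r x = measure U (S x)" for x
  have r[measurable]: "r \<in> borel_measurable U"
  proof -
    have "r x = enn2real (\<integral>\<^sup>+y. (if g x < g y \<or> (g y = g x \<and> y < x) then 1 else 0) \<partial>U)" for x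
    proof -
      have "emeasure U (S x) = (\<integral>\<^sup>+y. indicator (S x) y \<partial>U)" by simp
      also have "\<dots> = (\<integral>\<^sup>+y. (if g x < g y \<or> (g y = g x \<and> y < x) then 1 else 0) \<partial>U)"
        by (intro nn_integral_cong) (auto simp: S_def)
      finally show ?thesis by (simp add: r_def measure_def)
    qed
    then have "r = (\<lambda>x. enn2real (\<integral>\<^sup>+y. (if g x < g y \<or> (g y = g x \<and> y < x) then 1 else 0) \<partial>U))"
      by auto
    then show ?thesis by simp
  qed
  \<comment> \<open>A set \<open>B\<close> that contains every predecessor of its points bounds the
    ranks: they are at most its measure inside and at least its measure outside.\<close>
  have seg_le: "r x \<le> measure U B" if "B \<in> sets U" "x \<in> B" "\<And>y. y \<in> B \<Longrightarrow> S y \<subseteq> B" for x B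
    unfolding r_def using that by (intro U.finite_measure_mono) auto
  have seg_ge: "measure U B \<le> r x" if "B \<in> sets U" "x \<notin> B" "x \<in> space U" "\<And>y. y \<in> B \<Longrightarrow> S y \<subseteq> B" for x B
    unfolding r_def
  proof (intro U.finite_measure_mono subsetI S)
    fix y assume y: "y \<in> B"
    then have yU: "y \<in> space U" using sets.sets_into_space[OF that(1)] by auto
    have "x \<notin> S y" "y \<noteq> x" using that(2,4) y by auto
    then show "y \<in> S x" using yU that(3) unfolding S_def by auto
  qed
  \<comment> \<open>The segment of measure \<open>t\<close> lies between the sets where the rank is
    \<open>< t\<close> and \<open>\<le> t\<close>. Letting \<open>t\<close> vary then makes both
    measures equal to \<open>t\<close>.\<close>
  have lt_le: "measure U {x \<in> space U. r x < t} \<le> t \<and> t \<le> measure U {x \<in> space U. r x \<le> t}"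
    if t: "0 < t" "t < 1" for t
  proof -
    obtain l c where lc: "measure U {x \<in> space U. l < g x \<or> (g x = l \<and> x < c)} = t"
      using initial_segment_exists[OF g t] .
    define B where "B = {x \<in> space U. l < g x \<or> (g x = l \<and> x < c)}"
    have B[measurable]: "B \<in> sets U" unfolding B_def by measurable
    have seg: "\<And>y. y \<in> B \<Longrightarrow> S y \<subseteq> B" unfolding B_def S_def by auto
    have "measure U {x \<in> space U. r x < t} \<le> measure U B"
      using seg_ge[OF B _ _ seg] lc by (intro U.finite_measure_mono B) (force simp: B_def)
    moreover have "measure U B \<le> measure U {x \<in> space U. r x \<le> t}"
    proof (rule U.finite_measure_mono)
      show "B \<subseteq> {x \<in> space U. r x \<le> t}"
        using seg_le[OF B _ seg] lc unfolding B_def by blast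
    qed measurable
    ultimately show ?thesis using lc by (simp add: B_def)
  qed
  have lt: "measure U {x \<in> space U. r x < t} = t" if t: "0 < t" "t < 1" for t
  proof (rule antisym)
    show "t \<le> measure U {x \<in> space U. r x < t}"
    proof (rule dense_le_bounded[OF t(1)])
      fix w assume w: "0 < w" "w < t"
      have "w \<le> measure U {x \<in> space U. r x \<le> w}" using lt_le[of w] w t by auto
      also have "\<dots> \<le> measure U {x \<in> space U. r x < t}"
        using w by (intro U.finite_measure_mono) auto
      finally show "w \<le> measure U {x \<in> space U. r x < t}" .
    qed
  qed (use lt_le[OF t] in simp)
  have le: "measure U {x \<in> space U. r x \<le> t} = t" if t: "0 < t" "t < 1" for t
  proof (rule antisym)
    show "measure U {x \<in> space U. r x \<le> t} \<le> t"
    proof (rule dense_ge_bounded[OF t(2)])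
      fix w assume w: "t < w" "w < 1"
      have "measure U {x \<in> space U. r x \<le> t} \<le> measure U {x \<in> space U. r x < w}"
        using w by (intro U.finite_measure_mono) auto
      also have "\<dots> = w" using lt[of w] w t by simp
      finally show "measure U {x \<in> space U. r x \<le> t} \<le> w" .
    qed
  qed (use lt_le[OF t] in simp)
  have U1: "measure U (space U) = 1" using emeasure_U by (simp add: measure_def)
  have r01: "0 \<le> r x" "r x \<le> 1" for x
    unfolding r_def using U.bounded_measure[of "S x"] U1 by auto
  \<comment> \<open>The rank has no atoms. This is used at 0 and 1, and at the measure of a
    superlevel set, where a point on the boundary of the segment could not be decided.\<close>
  have AE_ne: "AE x in U. r x \<noteq> t" for t
  proof -
    consider "t \<le> 0" | "0 < t" "t < 1" | "1 \<le> t" by linarith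
    then have "measure U {x \<in> space U. r x = t} = 0"
    proof cases
      case 1
      have "measure U {x \<in> space U. r x = t} \<le> 0"
      proof (rule dense_ge_bounded[of 0 1])
        fix w :: real assume w: "0 < w" "w < 1"
        have "measure U {x \<in> space U. r x = t} \<le> measure U {x \<in> space U. r x < w}"
          using w 1 by (intro U.finite_measure_mono) auto
        then show "measure U {x \<in> space U. r x = t} \<le> w" using lt[OF w] by simp
      qed simp
      then show ?thesis by (simp add: measure_le_0_iff)
    next
      case 2
      have "measure U {x \<in> space U. r x \<le> t} = measure U ({x \<in> space U. r x < t} \<union> {x \<in> space U. r x = t})"
        by (intro arg_cong[where f="measure U"]) auto
      also have "\<dots> = measure U {x \<in> space U. r x < t} + measure U {x \<in> space U. r x = t}"
        by (intro U.finite_measure_Union) auto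
      finally show ?thesis using lt[OF 2] le[OF 2] by simp
    next
      case 3
      have "measure U {x \<in> space U. r x = t} \<le> 0"
      proof (rule dense_ge_bounded[of 0 1])
        fix w :: real assume w: "0 < w" "w < 1"
        have "measure U {x \<in> space U. r x = t} + measure U {x \<in> space U. r x < 1 - w}
          = measure U ({x \<in> space U. r x = t} \<union> {x \<in> space U. r x < 1 - w})"
          using w 3 by (intro U.finite_measure_Union[symmetric]) auto
        also have "\<dots> \<le> 1" using U.bounded_measure U1 by simp
        finally show "measure U {x \<in> space U. r x = t} \<le> w" using lt[of "1 - w"] w by simp
      qed simp
      then show ?thesis by (simp add: measure_le_0_iff)
    qed
    then show ?thesis
      by (subst AE_iff_measurable[OF _ refl]) (auto simp: U.emeasure_eq_measure)
  qed
  \<comment> \<open>Ranks 0 and 1 occur only on a null set; the value \<open>1/2\<close> there keeps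
    \<open>\<sigma>\<close> inside the open interval at every point.\<close>
  define \<sigma> where "\<sigma> x = (if 0 < r x \<and> r x < 1 then r x else 1/2)" for x
  have \<sigma>[measurable]: "\<sigma> \<in> borel_measurable U" unfolding \<sigma>_def by measurable
  have AE_\<sigma>: "AE x in U. \<sigma> x = r x"
    using AE_ne[of 0] AE_ne[of 1] by eventually_elim (use r01 in \<open>auto simp: \<sigma>_def less_le\<close>)
  have "mpres \<sigma>"
    unfolding mpres_def
  proof (intro conjI \<sigma> ballI)
    show "distr U borel \<sigma> = distr U borel (\<lambda>x. x)"
    proof (rule measure_eqI_lessThan)
      fix t :: real
      show "emeasure (distr U borel \<sigma>) {t<..} < \<infinity>"
        by (subst emeasure_distr) (auto simp: U.emeasure_eq_measure)
      have "emeasure (distr U borel \<sigma>) {t<..} = emeasure U {x \<in> space U. t < \<sigma> x}"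
        by (subst emeasure_distr) (auto simp: vimage_def Int_def conj_commute)
      also have "\<dots> = emeasure U {x \<in> space U. t < x}"
      proof -
        consider "t \<le> 0" | "0 < t" "t < 1" | "1 \<le> t" by linarith
        then show ?thesis
        proof cases
          case 1
          then have "{x \<in> space U. t < \<sigma> x} = {x \<in> space U. t < x}"
            by (auto simp: \<sigma>_def space_U)
          then show ?thesis by simp
        next
          case 2
          have "emeasure U {x \<in> space U. t < \<sigma> x} = emeasure U (space U - {x \<in> space U. r x \<le> t})"
            using AE_\<sigma> by (intro emeasure_eq_AE) (auto elim!: eventually_mono)
          also have "\<dots> = ennreal (1 - t)"
            using le[OF 2] U1 by (simp add: U.emeasure_eq_measure U.finite_measure_Diff)
          also have "\<dots> = emeasure U (space U - {x \<in> space U. x \<le> t})"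
          proof -
            have "emeasure U {x \<in> space U. x \<le> t} = emeasure lebesgue {0<..t}"
            proof -
              have "{x \<in> space U. x \<le> t} = {0<..t}" using 2 by (auto simp: space_U)
              then show ?thesis using 2 by (subst emeasure_restrict_space) auto
            qed
            then have "measure U {x \<in> space U. x \<le> t} = t"
              using 2 by (simp add: measure_def)
            then show ?thesis
              using U1 by (simp add: U.emeasure_eq_measure U.finite_measure_Diff)
          qed
          also have "space U - {x \<in> space U. x \<le> t} = {x \<in> space U. t < x}" by auto
          finally show ?thesis .
        next
          case 3
          have "{x \<in> space U. t < \<sigma> x} = {x \<in> space U. t < x}"
            using 3 by (auto simp: \<sigma>_def space_U)
          then show ?thesis by simp
        qed
      qed
      also have "\<dots> = emeasure (distr U borel (\<lambda>x. x)) {t<..}"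
        by (subst emeasure_distr) (auto simp: vimage_def Int_def conj_commute)
      finally show "emeasure (distr U borel \<sigma>) {t<..} = emeasure (distr U borel (\<lambda>x. x)) {t<..}" .
    qed auto
  qed (auto simp: \<sigma>_def)
  moreover have "AE x in U. g x = rearr01 g (\<sigma> x)"
  proof (rule AE_ennreal_eqI)
    fix l
    define B where "B = {x \<in> space U. l < g x}"
    have B[measurable]: "B \<in> sets U" unfolding B_def by measurable
    have seg: "\<And>y. y \<in> B \<Longrightarrow> S y \<subseteq> B" unfolding B_def S_def by auto
    show "AE x in U. (l < g x) = (l < rearr01 g (\<sigma> x))"
      using AE_\<sigma> AE_ne[of "measure U B"] AE_space
    proof eventually_elim
      case (elim x)
      have "l < rearr01 g (\<sigma> x) \<longleftrightarrow> ennreal (r x) < emeasure U B"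
        using elim by (subst rearr01_gt_iff[OF g]) (auto simp: r01 B_def)
      also have "\<dots> \<longleftrightarrow> r x < measure U B"
        using r01 by (simp add: U.emeasure_eq_measure ennreal_less_iff)
      also have "\<dots> \<longleftrightarrow> x \<in> B"
        using seg_le[OF B _ seg, of x] seg_ge[OF B _ _ seg, of x] elim by (cases "x \<in> B") (simp_all add: less_le)
      finally show ?case using elim by (simp add: B_def)
    qed
  qed
  ultimately show ?thesis using that by blast
qed

lemma mpres_measurable: "mpres \<sigma> \<Longrightarrow> \<sigma> \<in> borel_measurable U"
  by (simp add: mpres_def)

lemma mpres_space: "mpres \<sigma> \<Longrightarrow> x \<in> space U \<Longrightarrow> \<sigma> x \<in> {0<..<1}"
  by (simp add: mpres_def)

lemma dec01_comp_measurable: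
  fixes f :: "real \<Rightarrow> ennreal"
  assumes "mpres \<sigma>" "dec01 f"
  shows "(\<lambda>x. f (\<sigma> x)) \<in> borel_measurable U"
proof -
  have "(\<lambda>x. f (\<sigma> x) * indicator {0<..<1} (\<sigma> x)) \<in> borel_measurable U"
    using measurable_compose[OF mpres_measurable[OF assms(1)] dec01_borel[OF assms(2)]] .
  then show ?thesis
    by (rule measurable_cong[THEN iffD1, rotated]) (use mpres_space[OF assms(1)] in auto)
qed

lemma nn_integral_mpres:
  fixes f :: "real \<Rightarrow> ennreal"
  assumes "mpres \<sigma>" and f: "(\<lambda>x. f x * indicator {0<..<1} x) \<in> borel_measurable borel"
  shows "(\<integral>\<^sup>+x. f (\<sigma> x) \<partial>U) = (\<integral>\<^sup>+x. f x \<partial>U)"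
proof -
  have "(\<integral>\<^sup>+x. f (\<sigma> x) \<partial>U) = (\<integral>\<^sup>+x. f (\<sigma> x) * indicator {0<..<1} (\<sigma> x) \<partial>U)"
    using mpres_space[OF assms(1)] by (intro nn_integral_cong) auto
  also have "\<dots> = (\<integral>\<^sup>+x. f x * indicator {0<..<1} x \<partial>distr U borel \<sigma>)"
    using f mpres_measurable[OF assms(1)] by (subst nn_integral_distr) auto
  also have "\<dots> = (\<integral>\<^sup>+x. f x * indicator {0<..<1} x \<partial>distr U borel (\<lambda>x. x))"
    using assms(1) by (simp add: mpres_def)
  also have "\<dots> = (\<integral>\<^sup>+x. f x * indicator {0<..<1} x \<partial>U)"
    using f by (subst nn_integral_distr) auto
  also have "\<dots> = (\<integral>\<^sup>+x. f x \<partial>U)"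
    by (intro nn_integral_cong) (auto simp: space_U)
  finally show ?thesis .
qed

lemma nn_integral_mpres_mult:
  fixes f g :: "real \<Rightarrow> ennreal"
  assumes "mpres \<sigma>" "dec01 f" "dec01 g"
  shows "(\<integral>\<^sup>+x. f (\<sigma> x) * g (\<sigma> x) \<partial>U) = (\<integral>\<^sup>+x. f x * g x \<partial>U)"
proof (rule nn_integral_mpres[OF assms(1), of "\<lambda>x. f x * g x"])
  have "(\<lambda>x. f x * indicator {0<..<1} x * (g x * indicator {0<..<1} x)) \<in> borel_measurable borel"
    using dec01_borel[OF assms(2)] dec01_borel[OF assms(3)] by measurable
  also have "(\<lambda>x. f x * indicator {0<..<1} x * (g x * indicator {0<..<1} x)) = (\<lambda>x. f x * g x * indicator {0<..<1} x)"
    by (auto simp: indicator_def)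
  finally show "(\<lambda>x. f x * g x * indicator {0<..<1} x) \<in> borel_measurable borel" .
qed

lemma rearr01_mpres:
  fixes f :: "real \<Rightarrow> ennreal"
  assumes s: "mpres \<sigma>" and f: "dec01 f" and "0 \<le> x"
  shows "rearr01 (\<lambda>x. f (\<sigma> x)) x = rearr01 f x"
proof (rule rearr01_cong_emeasure[OF dec01_comp_measurable[OF s f] dec01_measurable[OF f] _ \<open>0 \<le> x\<close>])
  fix t
  have d: "dec01 (\<lambda>x. if t < f x then 1 else 0::ennreal)"
    using f by (auto simp: dec01_def dest: less_le_trans)
  have *: "emeasure U {x \<in> space U. P x} = (\<integral>\<^sup>+x. (if P x then 1 else 0) \<partial>U)"
    if "{x \<in> space U. P x} \<in> sets U" for P
    unfolding nn_integral_indicator[OF that, symmetric] by (intro nn_integral_cong) auto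
  note [measurable] = dec01_comp_measurable[OF s f] dec01_measurable[OF f]
  show "emeasure U {x \<in> space U. t < f (\<sigma> x)} = emeasure U {x \<in> space U. t < f x}"
    using nn_integral_mpres[OF s dec01_borel[OF d]] by (simp add: *)
qed

section \<open>The Hardy-Littlewood inequality\<close>

lemma emeasure_rearr01_gt2_le:
  assumes f[measurable]: "f \<in> borel_measurable U" and g[measurable]: "g \<in> borel_measurable U"
  shows "emeasure U {x \<in> space U. a < f x \<and> b < g x}
    \<le> emeasure U {x \<in> space U. a < rearr01 f x \<and> b < rearr01 g x}" (is "?L \<le> emeasure U ?R")
proof -
  have Lf: "?L \<le> emeasure U {x \<in> space U. a < f x}"
    by (rule emeasure_mono) auto
  have Lg: "?L \<le> emeasure U {x \<in> space U. b < g x}"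
    by (rule emeasure_mono) auto
  show ?thesis
  proof (cases "emeasure U {x \<in> space U. a < f x} \<le> emeasure U {x \<in> space U. b < g x}")
    case True
    have "?R = {x \<in> space U. a < rearr01 f x}"
      using True by (auto simp: space_U rearr01_gt_iff[OF f] rearr01_gt_iff[OF g] intro: less_le_trans)
    then show ?thesis using Lf emeasure_rearr01_gt[OF f, of a] by simp
  next
    case False
    have "?R = {x \<in> space U. b < rearr01 g x}"
      using False by (auto simp: space_U rearr01_gt_iff[OF f] rearr01_gt_iff[OF g] not_le intro: less_trans)
    then show ?thesis using Lg emeasure_rearr01_gt[OF g, of b] by simp
  qed
qed

lemma ennreal_layer_cake: "v = (\<integral>\<^sup>+a. (if 0 < a \<and> ennreal a < v then 1 else 0) \<partial>lborel)"
proof (cases v)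
  case (real r)
  have "(\<integral>\<^sup>+a. (if 0 < a \<and> ennreal a < v then 1 else 0) \<partial>lborel) = (\<integral>\<^sup>+a. indicator {0<..<r} a \<partial>lborel)"
    using real by (intro nn_integral_cong) (auto simp: ennreal_less_iff)
  then show ?thesis using real by simp
next
  case top
  have "(\<integral>\<^sup>+a. (if 0 < a \<and> ennreal a < v then 1 else 0) \<partial>lborel) = (\<integral>\<^sup>+a. indicator {0::real<..} a \<partial>lborel)"
    using top by (intro nn_integral_cong) (auto simp: ennreal_less_iff)
  also have "\<dots> = emeasure lborel {0::real<..}" by simp
  also have "\<dots> = top"
  proof (rule ccontr)
    assume "emeasure lborel {0::real<..} \<noteq> top"
    then obtain r where r: "emeasure lborel {0::real<..} = ennreal r" "0 \<le> r"
      by (cases "emeasure lborel {0::real<..}") auto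
    have "emeasure lborel {0::real<..<r+1} \<le> emeasure lborel {0::real<..}"
      by (rule emeasure_mono) auto
    then show False using r by simp
  qed
  finally show ?thesis using top by simp
qed

lemma nn_integral_mult_layer_cake:
  assumes f[measurable]: "f \<in> borel_measurable U" and g[measurable]: "g \<in> borel_measurable U"
  shows "(\<integral>\<^sup>+x. f x * g x \<partial>U) =
    (\<integral>\<^sup>+a. \<integral>\<^sup>+b. (if 0 < a \<and> 0 < b then emeasure U {x \<in> space U. ennreal a < f x \<and> ennreal b < g x} else 0) \<partial>lborel \<partial>lborel)"
proof -
  interpret A: pair_sigma_finite U "lborel :: real measure"
    by (intro pair_sigma_finite.intro U.sigma_finite_measure_axioms lborel.sigma_finite_measure_axioms)
  let ?I = "\<lambda>a v. (if 0 < a \<and> ennreal a < v then 1 else 0 :: ennreal)"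
  have "(\<integral>\<^sup>+x. f x * g x \<partial>U) = (\<integral>\<^sup>+x. (\<integral>\<^sup>+a. ?I a (f x) \<partial>lborel) * (\<integral>\<^sup>+b. ?I b (g x) \<partial>lborel) \<partial>U)"
    by (simp flip: ennreal_layer_cake)
  also have "\<dots> = (\<integral>\<^sup>+x. (\<integral>\<^sup>+a. (\<integral>\<^sup>+b. ?I a (f x) * ?I b (g x) \<partial>lborel) \<partial>lborel) \<partial>U)"
    by (intro nn_integral_cong) (simp add: nn_integral_cmult nn_integral_multc)
  also have "\<dots> = (\<integral>\<^sup>+a. (\<integral>\<^sup>+x. (\<integral>\<^sup>+b. ?I a (f x) * ?I b (g x) \<partial>lborel) \<partial>U) \<partial>lborel)"
    by (rule A.Fubini'[symmetric]) measurable
  also have "\<dots> = (\<integral>\<^sup>+a. (\<integral>\<^sup>+b. (\<integral>\<^sup>+x. ?I a (f x) * ?I b (g x) \<partial>U) \<partial>lborel) \<partial>lborel)"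
    by (intro nn_integral_cong A.Fubini'[symmetric]) measurable
  also have "\<dots> = (\<integral>\<^sup>+a. \<integral>\<^sup>+b. (if 0 < a \<and> 0 < b then emeasure U {x \<in> space U. ennreal a < f x \<and> ennreal b < g x} else 0) \<partial>lborel \<partial>lborel)"
  proof (intro nn_integral_cong)
    fix a b :: real
    show "(\<integral>\<^sup>+x. ?I a (f x) * ?I b (g x) \<partial>U) = (if 0 < a \<and> 0 < b then emeasure U {x \<in> space U. ennreal a < f x \<and> ennreal b < g x} else 0)"
    proof (cases "0 < a \<and> 0 < b")
      case True
      then show ?thesis
        by (auto simp: nn_integral_indicator[symmetric] simp del: nn_integral_indicator intro!: nn_integral_cong)
    qed auto
  qed
  finally show ?thesis .
qed

text \<open>Level by level in the layer cake formula: superlevel sets of rearrangements are nested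
  intervals, so their intersection has the smaller of the two measures, which no intersection of
  sets with these measures can exceed.\<close>

lemma hardy_littlewood:
  assumes f: "f \<in> borel_measurable U" and g: "g \<in> borel_measurable U"
  shows "(\<integral>\<^sup>+x. f x * g x \<partial>U) \<le> (\<integral>\<^sup>+x. rearr01 f x * rearr01 g x \<partial>U)"
  unfolding nn_integral_mult_layer_cake[OF f g]
    nn_integral_mult_layer_cake[OF dec01_measurable[OF dec01_rearr01[OF f]] dec01_measurable[OF dec01_rearr01[OF g]]]
  by (intro nn_integral_mono) (auto intro: emeasure_rearr01_gt2_le[OF f g])

lemma nn_integral_rearr01_dec01:
  assumes "dec01 f"
  shows "(\<integral>\<^sup>+x. rearr01 f x * g x \<partial>U) = (\<integral>\<^sup>+x. f x * g x \<partial>U)"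
  using rearr01_dec01_AE[OF assms] by (intro nn_integral_cong_AE) auto

lemma hardy_littlewood_dec01:
  assumes f: "f \<in> borel_measurable U" and g: "dec01 g"
  shows "(\<integral>\<^sup>+x. f x * g x \<partial>U) \<le> (\<integral>\<^sup>+x. rearr01 f x * g x \<partial>U)"
  using hardy_littlewood[OF f dec01_measurable[OF g]] nn_integral_rearr01_dec01[OF g, of "rearr01 f"]
  by (simp add: mult.commute)

section \<open>Rearrangement-invariant norms and their biduals\<close>

lemma Mplus_dec01: "dec01 f \<Longrightarrow> f \<in> Mplus"
  by (simp add: Mplus_iff dec01_measurable)

lemma ennreal_lincomb:
  "0 \<le> a \<Longrightarrow> 0 \<le> b \<Longrightarrow> 0 \<le> u \<Longrightarrow> 0 \<le> v \<Longrightarrow> ennreal a * ennreal u + ennreal b * ennreal v = ennreal (a * u + b * v)"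
  by (simp add: ennreal_mult ennreal_plus)

lemma ennreal_inverse_cancel: "0 < y \<Longrightarrow> ennreal y * (ennreal (1 / y) * v) = v"
  by (subst mult.assoc[symmetric], subst ennreal_mult[symmetric]) auto

lemma ennreal_inverse_mult: "0 < y \<Longrightarrow> ennreal (1 / y) * ennreal y = 1"
  by (subst ennreal_mult[symmetric]) auto

lemma Mplus_cmult: "f \<in> Mplus \<Longrightarrow> (\<lambda>x. c * f x) \<in> Mplus"
  by (simp add: Mplus_iff)

context
  fixes Y assumes Y: "ri_function_norm Y"
begin

lemma ri_zero_iff: "f \<in> Mplus \<Longrightarrow> Y f = 0 \<longleftrightarrow> (AE x in U. f x = 0)"
  by (rule Y[unfolded ri_function_norm_def, THEN conjunct1, rule_format])

lemma ri_cmult: "f \<in> Mplus \<Longrightarrow> 0 \<le> c \<Longrightarrow> Y (\<lambda>x. ennreal c * f x) = ennreal c * Y f"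
  by (rule Y[unfolded ri_function_norm_def, THEN conjunct2, THEN conjunct1, rule_format])

lemma ri_add: "f \<in> Mplus \<Longrightarrow> g \<in> Mplus \<Longrightarrow> Y (\<lambda>x. f x + g x) \<le> Y f + Y g"
  by (rule Y[unfolded ri_function_norm_def, THEN conjunct2, THEN conjunct2, THEN conjunct1, rule_format])

lemma ri_mono: "f \<in> Mplus \<Longrightarrow> g \<in> Mplus \<Longrightarrow> AE x in U. f x \<le> g x \<Longrightarrow> Y f \<le> Y g"
  by (rule Y[unfolded ri_function_norm_def, THEN conjunct2, THEN conjunct2, THEN conjunct2, THEN conjunct1, rule_format])

lemma ri_mono_U: "f \<in> Mplus \<Longrightarrow> g \<in> Mplus \<Longrightarrow> (\<And>x. x \<in> space U \<Longrightarrow> f x \<le> g x) \<Longrightarrow> Y f \<le> Y g"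
  by (rule ri_mono) (auto intro: AE_I2)

lemma ri_cong_AE: "f \<in> Mplus \<Longrightarrow> g \<in> Mplus \<Longrightarrow> AE x in U. f x = g x \<Longrightarrow> Y f = Y g"
  by (intro antisym ri_mono) (auto elim: eventually_mono)

lemma ri_monotone_convergence:
  assumes "\<And>j. F j \<in> Mplus" "f \<in> Mplus"
    and "AE x in U. incseq (\<lambda>j. F j x) \<and> (\<lambda>j. F j x) \<longlonglongrightarrow> f x"
  shows "(\<lambda>j. Y (F j)) \<longlonglongrightarrow> Y f"
  by (rule Y[unfolded ri_function_norm_def, THEN conjunct2, THEN conjunct2, THEN conjunct2, THEN conjunct2, THEN conjunct1, rule_format, THEN conjunct2]) (intro conjI allI assms)

lemma ri_one: "Y (\<lambda>_. 1) < \<infinity>"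
  by (rule Y[unfolded ri_function_norm_def, THEN conjunct2, THEN conjunct2, THEN conjunct2, THEN conjunct2, THEN conjunct2, THEN conjunct1])

lemma ri_nn_integral_le: obtains C where "\<And>f. f \<in> Mplus \<Longrightarrow> (\<integral>\<^sup>+x. f x \<partial>U) \<le> ennreal C * Y f"
  using Y[unfolded ri_function_norm_def, THEN conjunct2, THEN conjunct2, THEN conjunct2, THEN conjunct2, THEN conjunct2, THEN conjunct2, THEN conjunct1] by (elim exE) blast

lemma ri_rearr01:
  assumes "f \<in> Mplus" "g \<in> Mplus" "\<And>s. s \<in> {0<..<1} \<Longrightarrow> rearr01 f s = rearr01 g s"
  shows "Y f = Y g"
  by (rule Y[unfolded ri_function_norm_def, THEN conjunct2, THEN conjunct2, THEN conjunct2, THEN conjunct2, THEN conjunct2, THEN conjunct2, THEN conjunct2, THEN bspec, THEN bspec, THEN mp]) (intro assms ballI)+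

lemma ri_convex:
  assumes "f \<in> Mplus" "g \<in> Mplus" "Y f \<le> 1" "Y g \<le> 1" "0 \<le> a" "0 \<le> b" "a + b = 1"
  shows "Y (\<lambda>x. ennreal a * f x + ennreal b * g x) \<le> 1"
proof -
  have "Y (\<lambda>x. ennreal a * f x + ennreal b * g x) \<le> Y (\<lambda>x. ennreal a * f x) + Y (\<lambda>x. ennreal b * g x)"
    using assms by (intro ri_add Mplus_cmult)
  also have "\<dots> \<le> ennreal a * 1 + ennreal b * 1"
    unfolding ri_cmult[OF assms(1,5)] ri_cmult[OF assms(2,6)]
    using assms by (intro add_mono mult_left_mono) auto
  also have "\<dots> = 1" using assms by (simp flip: ennreal_plus)
  finally show ?thesis .
qed

text \<open>The tail infima \<open>w k\<close> increase to the limit and lie below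
  \<open>u k\<close>, so monotone convergence of the norm applies to them.\<close>

lemma ri_Fatou:
  fixes u :: "nat \<Rightarrow> real \<Rightarrow> ennreal"
  assumes u: "\<And>n. u n \<in> Mplus" and p: "p \<in> Mplus" and lim: "AE x in U. (\<lambda>n. u n x) \<longlonglongrightarrow> p x"
    and le: "\<And>n. Y (u n) \<le> 1"
  shows "Y p \<le> 1"
proof -
  define w where "w k x = (INF j\<in>{k..}. u j x)" for k x
  have um[measurable]: "u n \<in> borel_measurable U" for n using u by (simp add: Mplus_iff)
  have w: "w k \<in> Mplus" for k
    unfolding Mplus_iff w_def by (intro borel_measurable_INF) (auto intro: um)
  have "(\<lambda>k. Y (w k)) \<longlonglongrightarrow> Y p"
  proof (rule ri_monotone_convergence[OF w p])
    show "AE x in U. incseq (\<lambda>j. w j x) \<and> (\<lambda>j. w j x) \<longlonglongrightarrow> p x"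
      using lim
    proof eventually_elim
      case (elim x)
      have inc: "incseq (\<lambda>j. w j x)"
        unfolding w_def by (intro incseq_SucI INF_superset_mono) auto
      have "(\<lambda>j. w j x) \<longlonglongrightarrow> (SUP j. w j x)" by (rule LIMSEQ_SUP[OF inc])
      also have "(SUP j. w j x) = liminf (\<lambda>n. u n x)"
        unfolding w_def by (simp add: liminf_SUP_INF)
      also have "\<dots> = p x" by (intro lim_imp_Liminf elim) simp
      finally show ?case using inc by simp
    qed
  qed
  moreover have "Y (w k) \<le> 1" for k
    by (rule order_trans[OF ri_mono_U[OF w u[of k]] le]) (auto simp: w_def intro: INF_lower)
  ultimately show ?thesis by (meson LIMSEQ_le_const2)
qed

section \<open>Separation of a function from the unit ball\<close>

definition ball_below :: "((real \<Rightarrow> ennreal) \<Rightarrow> ennreal) \<Rightarrow> (real \<Rightarrow> real) \<Rightarrow> (real \<Rightarrow> real) set" where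
  "ball_below Z f = {u \<in> borel_measurable U. (\<forall>x\<in>space U. 0 \<le> u x \<and> u x \<le> f x) \<and> Z (\<lambda>x. ennreal (u x)) \<le> 1}"

text \<open>
  The nearest point \<open>p\<close> to \<open>f\<close> in \<open>L\<^sup>2\<close> among the \<open>u\<close> with \<open>0 \<le> u \<le> f\<close> and \<open>Y u \<le> 1\<close> exists;
  the functional \<open>g = f - p\<close> separates \<open>f\<close> from the unit ball.
\<close>
lemma ri_nearest_point:
  fixes f :: "real \<Rightarrow> real"
  assumes f[measurable]: "f \<in> borel_measurable U" and fM: "\<And>x. x \<in> space U \<Longrightarrow> 0 \<le> f x \<and> f x \<le> M"
  obtains p where "p \<in> ball_below Y f"
    "\<And>u. u \<in> ball_below Y f \<Longrightarrow> (LINT x|U. (f x - p x)\<^sup>2) \<le> (LINT x|U. (f x - u x)\<^sup>2)"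
proof -
  define S where "S = ball_below Y f"
  define D where "D u = (LINT x|U. (f x - u x)\<^sup>2)" for u
  define \<delta> where "\<delta> = Inf (D ` S)"
  note S_def = S_def[unfolded ball_below_def]
  have S0: "(\<lambda>_. 0) \<in> S"
    using fM ri_zero_iff[of "\<lambda>_. 0"] by (auto simp: S_def Mplus_iff)
  have D0: "0 \<le> D u" for u unfolding D_def by simp
  have bdd: "bdd_below (D ` S)" by (rule bdd_belowI[of _ 0]) (use D0 in auto)
  have \<delta>_le: "\<delta> \<le> D u" if "u \<in> S" for u
    unfolding \<delta>_def using that bdd by (intro cInf_lower) auto
  \<comment> \<open>The rate \<open>1/16\<close> makes the squared distances of successive terms at
    most \<open>4 * (1/16)^n\<close>; after the loss of a factor \<open>2^n\<close> in
    \<open>step1\<close> the L1 distances remain summable.\<close>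
  have ex: "\<exists>u\<in>S. D u < \<delta> + (1/16)^n" for n :: nat
  proof -
    have "Inf (D ` S) < \<delta> + (1/16)^n" unfolding \<delta>_def by simp
    then show ?thesis using cInf_lessD[of "D ` S"] S0 by auto
  qed
  obtain u where uS: "\<And>n. u n \<in> S" and uD: "\<And>n::nat. D (u n) < \<delta> + (1/16)^n"
    using ex by metis
  have um[measurable]: "u n \<in> borel_measurable U" for n using uS[of n] by (simp add: S_def)
  have ub: "0 \<le> u n x" "u n x \<le> f x" "u n x \<le> M" if "x \<in> space U" for n x
    using uS[of n] fM[OF that] that by (auto simp: S_def intro: order_trans)
  have int: "integrable U (\<lambda>x. (h x)\<^sup>2)" if [measurable]: "h \<in> borel_measurable U" and "\<And>x. x \<in> space U \<Longrightarrow> \<bar>h x\<bar> \<le> K" for h :: "real \<Rightarrow> real" and K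
  proof (rule U.integrable_const_bound[where B="K\<^sup>2"])
    show "AE x in U. norm ((h x)\<^sup>2) \<le> K\<^sup>2"
    proof (rule AE_I2)
      fix x assume "x \<in> space U"
      then have "\<bar>h x\<bar> \<le> \<bar>K\<bar>" using that(2)[of x] by linarith
      then show "norm ((h x)\<^sup>2) \<le> K\<^sup>2" by (simp add: abs_le_square_iff)
    qed
  qed measurable
  \<comment> \<open>Parallelogram identity: the midpoint \<open>v\<close> lies in the convex set
    \<open>S\<close>, so \<open>D v\<close> is at least the infimum \<open>\<delta>\<close>.\<close>
  have step: "(LINT x|U. (u n x - u (Suc n) x)\<^sup>2) \<le> 4 * (1/16)^n" for n
  proof -
    define v where "v x = 1/2 * u n x + 1/2 * u (Suc n) x" for x
    have "Y (\<lambda>x. ennreal (1/2) * ennreal (u n x) + ennreal (1/2) * ennreal (u (Suc n) x)) \<le> 1"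
      using uS[of n] uS[of "Suc n"] by (intro ri_convex) (auto simp: Mplus_iff S_def)
    moreover have "Y (\<lambda>x. ennreal (v x)) = Y (\<lambda>x. ennreal (1/2) * ennreal (u n x) + ennreal (1/2) * ennreal (u (Suc n) x))"
    proof (rule ri_cong_AE)
      show "AE x in U. ennreal (v x) = ennreal (1/2) * ennreal (u n x) + ennreal (1/2) * ennreal (u (Suc n) x)"
        unfolding v_def using ub by (intro AE_I2 ennreal_lincomb[symmetric]) auto
    qed (simp_all add: Mplus_iff v_def[abs_def])
    moreover have "v \<in> borel_measurable U" unfolding v_def by measurable
    moreover have "0 \<le> v x \<and> v x \<le> f x" if "x \<in> space U" for x
      using ub[OF that, of n] ub[OF that, of "Suc n"] by (simp add: v_def)
    ultimately have v: "v \<in> S" by (simp add: S_def)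
    have i1: "integrable U (\<lambda>x. (f x - u n x)\<^sup>2)" for n
      using fM ub by (intro int[where K=M]) (auto simp: abs_le_iff; smt (verit))+
    have i2: "integrable U (\<lambda>x. (f x - v x)\<^sup>2)"
    proof (rule int[where K=M])
      show "\<bar>f x - v x\<bar> \<le> M" if "x \<in> space U" for x
        using conjunct1[OF fM[OF that]] conjunct2[OF fM[OF that]] ub[OF that, of n] ub[OF that, of "Suc n"]
        unfolding v_def abs_le_iff by (intro conjI) linarith+
    qed (simp add: v_def[abs_def])
    have "(LINT x|U. (u n x - u (Suc n) x)\<^sup>2) =
      (LINT x|U. 2 * (f x - u n x)\<^sup>2 + 2 * (f x - u (Suc n) x)\<^sup>2 - 4 * (f x - v x)\<^sup>2)"
      by (intro Bochner_Integration.integral_cong) (auto simp: v_def power2_eq_square field_simps)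
    also have "\<dots> = 2 * D (u n) + 2 * D (u (Suc n)) - 4 * D v"
      using i1 i2 by (simp add: D_def)
    also have "\<dots> \<le> 4 * (1/16)^n"
      using uD[of n] uD[of "Suc n"] \<delta>_le[OF v] zero_le_power[of "1/16::real" n]
      unfolding power_Suc by linarith
    finally show ?thesis .
  qed
  have step1: "(\<integral>\<^sup>+x. ennreal \<bar>u n x - u (Suc n) x\<bar> \<partial>U) \<le> ennreal (5 * (1/2)^n)" for n
  proof -
    have i: "integrable U (\<lambda>x. (u n x - u (Suc n) x)\<^sup>2)"
    proof (rule int[where K=M])
      show "\<bar>u n x - u (Suc n) x\<bar> \<le> M" if "x \<in> space U" for x
        using ub[OF that, of n] ub[OF that, of "Suc n"] by (simp add: abs_le_iff)
    qed simp
    have "(\<integral>\<^sup>+x. ennreal \<bar>u n x - u (Suc n) x\<bar> \<partial>U) \<le> (\<integral>\<^sup>+x. ennreal ((1/2)^n + 2^n * (u n x - u (Suc n) x)\<^sup>2) \<partial>U)"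
    proof (intro nn_integral_mono ennreal_leI)
      fix x
      define d where "d = \<bar>u n x - u (Suc n) x\<bar>"
      \<comment> \<open>The square yields \<open>d \<le> (1/2)^n + 2^n * d\<^sup>2\<close>, a
        pointwise substitute for the Cauchy-Schwarz inequality.\<close>
      have "0 \<le> (2^n * d - 1)\<^sup>2 + 2^n * d" by (simp add: d_def)
      then have "2^n * d \<le> 1 + (2^n * d)\<^sup>2" by (simp add: power2_eq_square algebra_simps)
      then have "(1/2)^n * (2^n * d) \<le> (1/2)^n * (1 + (2^n * d)\<^sup>2)" by (intro mult_left_mono) auto
      moreover have "(1/2)^n * (2^n * d) = d" by (simp add: power_one_over)
      moreover have "(1/2)^n * (2^n * d)\<^sup>2 = 2^n * d\<^sup>2"
        by (simp add: power_one_over power2_eq_square)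
      ultimately have "d \<le> (1/2)^n + 2^n * d\<^sup>2" by (simp add: distrib_left)
      then show "\<bar>u n x - u (Suc n) x\<bar> \<le> (1/2)^n + 2^n * (u n x - u (Suc n) x)\<^sup>2"
        by (simp add: d_def)
    qed
    also have "\<dots> = ennreal (LINT x|U. ((1/2)^n + 2^n * (u n x - u (Suc n) x)\<^sup>2))"
      using i by (intro nn_integral_eq_integral) auto
    also have "(LINT x|U. ((1/2)^n + 2^n * (u n x - u (Suc n) x)\<^sup>2)) = (1/2)^n + 2^n * (LINT x|U. (u n x - u (Suc n) x)\<^sup>2)"
      using i emeasure_U by (simp add: measure_def)
    also have "\<dots> \<le> (1/2)^n + 2^n * (4 * (1/16)^n)"
      using step[of n] by simp
    also have "2^n * (4 * (1/16)^n) = 4 * (1/8::real)^n"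
      by (simp add: power_mult_distrib[symmetric])
    also have "(1/2)^n + 4 * (1/8::real)^n \<le> 5 * (1/2)^n"
      using power_mono[of "1/8::real" "1/2" n] by simp
    finally show ?thesis by (simp add: ennreal_leI)
  qed
  have "(\<integral>\<^sup>+x. (\<Sum>n. ennreal \<bar>u n x - u (Suc n) x\<bar>) \<partial>U) = (\<Sum>n. \<integral>\<^sup>+x. ennreal \<bar>u n x - u (Suc n) x\<bar> \<partial>U)"
    by (rule nn_integral_suminf) measurable
  also have "\<dots> \<le> (\<Sum>n. ennreal (5 * (1/2)^n))"
    by (intro suminf_le step1) auto
  also have "\<dots> = ennreal (\<Sum>n. 5 * (1/2)^n)"
    by (intro suminf_ennreal2) (auto intro!: summable_mult summable_geometric)
  also have "\<dots> < \<infinity>" by simp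
  finally have "(\<integral>\<^sup>+x. (\<Sum>n. ennreal \<bar>u n x - u (Suc n) x\<bar>) \<partial>U) \<noteq> \<infinity>" by simp
  then have "AE x in U. (\<Sum>n. ennreal \<bar>u n x - u (Suc n) x\<bar>) \<noteq> \<infinity>"
    by (intro nn_integral_PInf_AE) auto
  then have conv: "AE x in U. (\<lambda>n. u n x) \<longlonglongrightarrow> lim (\<lambda>n. u n x)"
  proof eventually_elim
    case (elim x)
    then have "summable (\<lambda>n. \<bar>u n x - u (Suc n) x\<bar>)"
      by (intro summable_suminf_not_top) auto
    then have "summable (\<lambda>n. u n x - u (Suc n) x)" by (rule summable_rabs_cancel)
    then have "convergent (\<lambda>n. \<Sum>i<n. u i x - u (Suc i) x)"
      by (simp add: summable_iff_convergent)
    then have "convergent (\<lambda>n. u 0 x - (\<Sum>i<n. u i x - u (Suc i) x))"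
      by (intro convergent_diff convergent_const)
    moreover have "u 0 x - (\<Sum>i<n. u i x - u (Suc i) x) = u n x" for n
      by (induction n) auto
    ultimately show ?case
      by (simp add: convergent_LIMSEQ_iff)
  qed
  \<comment> \<open>Clamping between 0 and \<open>f\<close> controls the value on the null set where
    the sequence diverges and \<open>lim\<close> is arbitrary.\<close>
  define p where "p x = max 0 (min (f x) (lim (\<lambda>n. u n x)))" for x
  have pm[measurable]: "p \<in> borel_measurable U"
    unfolding p_def by (intro borel_measurable_max borel_measurable_min borel_measurable_lim_metric um f) auto
  have pf: "0 \<le> p x \<and> p x \<le> f x" if "x \<in> space U" for x
    using fM[OF that] by (auto simp: p_def)
  have limp: "AE x in U. (\<lambda>n. u n x) \<longlonglongrightarrow> p x"
    using conv AE_space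
  proof eventually_elim
    case (elim x)
    have "0 \<le> lim (\<lambda>n. u n x)" "lim (\<lambda>n. u n x) \<le> f x"
      using ub[OF elim(2)] by (auto intro: LIMSEQ_le_const[OF elim(1)] LIMSEQ_le_const2[OF elim(1)])
    then show ?case using elim(1) by (simp add: p_def)
  qed
  have Yp: "Y (\<lambda>x. ennreal (p x)) \<le> 1"
  proof (rule ri_Fatou[where u="\<lambda>n x. ennreal (u n x)"])
    show "AE x in U. (\<lambda>n. ennreal (u n x)) \<longlonglongrightarrow> ennreal (p x)"
      using limp by eventually_elim (rule tendsto_ennrealI)
    show "Y (\<lambda>x. ennreal (u n x)) \<le> 1" for n using uS[of n] by (simp add: S_def)
  qed (auto simp: Mplus_iff)
  have "(\<lambda>n. D (u n)) \<longlonglongrightarrow> D p"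
    unfolding D_def
  proof (rule integral_dominated_convergence[where w="\<lambda>_. M\<^sup>2"])
    show "AE x in U. (\<lambda>n. (f x - u n x)\<^sup>2) \<longlonglongrightarrow> (f x - p x)\<^sup>2"
      using limp by eventually_elim (intro tendsto_intros)
    show "AE x in U. norm ((f x - u n x)\<^sup>2) \<le> M\<^sup>2" for n
    proof (rule AE_I2)
      fix x assume x: "x \<in> space U"
      have "\<bar>f x - u n x\<bar> \<le> \<bar>M\<bar>" using fM[OF x] ub[OF x, of n] by linarith
      then show "norm ((f x - u n x)\<^sup>2) \<le> M\<^sup>2" by (simp add: abs_le_square_iff)
    qed
  qed auto
  moreover have "(\<lambda>n. \<delta> + (1/16)^n) \<longlonglongrightarrow> \<delta> + 0"
    by (intro tendsto_add tendsto_const LIMSEQ_power_zero) auto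
  ultimately have Dp: "D p \<le> \<delta>"
    using uD by (intro LIMSEQ_le[of "\<lambda>n. D (u n)" _ "\<lambda>n. \<delta> + (1/16)^n"]) (auto intro: less_imp_le)
  show ?thesis
  proof (rule that)
    show "p \<in> ball_below Y f" using pm pf Yp by (simp add: ball_below_def)
    show "(LINT x|U. (f x - p x)\<^sup>2) \<le> (LINT x|U. (f x - u x)\<^sup>2)" if "u \<in> ball_below Y f" for u
      using that \<delta>_le[of u] Dp by (simp add: S_def ball_below_def D_def)
  qed
qed

text \<open>Variational inequality for the nearest point \<open>p\<close>: a small step from
  \<open>p\<close> towards \<open>h\<close> cannot reduce the distance to \<open>f\<close>, so the
  integral of \<open>g * (h - p)\<close> is at most 0 for \<open>g = f - p\<close>, and
  \<open>\<kappa>\<close> is the integral of \<open>g * p\<close>. Strictness comes from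
  \<open>Y p \<le> 1 < Y f\<close>, which forbids \<open>f = p\<close> almost everywhere.\<close>

lemma ri_separation_bounded:
  fixes f :: "real \<Rightarrow> real"
  assumes f[measurable]: "f \<in> borel_measurable U" and fM: "\<And>x. x \<in> space U \<Longrightarrow> 0 \<le> f x \<and> f x \<le> M"
    and Yf: "1 < Y (\<lambda>x. ennreal (f x))"
  obtains g \<kappa> where "g \<in> borel_measurable U" "\<And>x. x \<in> space U \<Longrightarrow> 0 \<le> g x \<and> g x \<le> M"
    "\<And>h N. h \<in> ball_below Y (\<lambda>_. N) \<Longrightarrow> (LINT x|U. g x * h x) \<le> \<kappa>"
    "0 \<le> \<kappa>" "\<kappa> < (LINT x|U. g x * f x)"
proof -
  obtain p where p: "p \<in> ball_below Y f"
    and near: "\<And>u. u \<in> ball_below Y f \<Longrightarrow> (LINT x|U. (f x - p x)\<^sup>2) \<le> (LINT x|U. (f x - u x)\<^sup>2)"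
    using ri_nearest_point[OF f fM] by blast
  have pm[measurable]: "p \<in> borel_measurable U" and pf: "\<And>x. x \<in> space U \<Longrightarrow> 0 \<le> p x \<and> p x \<le> f x"
    and Yp: "Y (\<lambda>x. ennreal (p x)) \<le> 1"
    using p by (auto simp: ball_below_def)
  define g where "g x = f x - p x" for x
  have gm[measurable]: "g \<in> borel_measurable U" unfolding g_def by measurable
  have g: "0 \<le> g x \<and> g x \<le> M" if "x \<in> space U" for x
    using pf[OF that] fM[OF that] by (auto simp: g_def)
  have int: "integrable U (\<lambda>x. a x * b x)" if [measurable]: "a \<in> borel_measurable U" "b \<in> borel_measurable U"
    and "\<And>x. x \<in> space U \<Longrightarrow> \<bar>a x\<bar> \<le> A" "\<And>x. x \<in> space U \<Longrightarrow> \<bar>b x\<bar> \<le> B" for a b :: "real \<Rightarrow> real" and A B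
  proof (rule U.integrable_const_bound[where B="A * B"])
    show "AE x in U. norm (a x * b x) \<le> A * B"
      using that(3,4) by (intro AE_I2) (auto simp: abs_mult intro!: mult_mono intro: order_trans[OF abs_ge_zero])
  qed measurable
  show ?thesis
  proof (rule that[of g "LINT x|U. g x * p x"])
    fix h N assume "h \<in> ball_below Y (\<lambda>_. N)"
    then have hm[measurable]: "h \<in> borel_measurable U" and hN: "\<And>x. x \<in> space U \<Longrightarrow> 0 \<le> h x \<and> h x \<le> N"
      and Yh: "Y (\<lambda>x. ennreal (h x)) \<le> 1" by (auto simp: ball_below_def)
    define d where "d x = h x - p x" for x
    have dm[measurable]: "d \<in> borel_measurable U" unfolding d_def by measurable
    have dN: "\<bar>d x\<bar> \<le> N + M" if "x \<in> space U" for x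
      using pf[OF that] fM[OF that] hN[OF that] by (auto simp: d_def)
    have gM: "\<bar>g x\<bar> \<le> M" if "x \<in> space U" for x using g[OF that] by auto
    have i1: "integrable U (\<lambda>x. g x * g x)" by (rule int[OF gm gm gM gM])
    have i2: "integrable U (\<lambda>x. g x * d x)" by (rule int[OF gm dm gM dN])
    have i3: "integrable U (\<lambda>x. d x * d x)" by (rule int[OF dm dm dN dN])
    have key: "2 * (LINT x|U. g x * d x) \<le> e * (LINT x|U. d x * d x)" if e: "0 < e" "e \<le> 1" for e
    proof -
      define q where "q x = (1 - e) * p x + e * h x" for x
      have qm[measurable]: "q \<in> borel_measurable U" unfolding q_def by measurable
      have q0: "0 \<le> q x" if "x \<in> space U" for x
        using pf[OF that] hN[OF that] e by (auto simp: q_def)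
      have "Y (\<lambda>x. ennreal (q x)) = Y (\<lambda>x. ennreal (1 - e) * ennreal (p x) + ennreal e * ennreal (h x))"
      proof (rule ri_cong_AE)
        show "AE x in U. ennreal (q x) = ennreal (1 - e) * ennreal (p x) + ennreal e * ennreal (h x)"
          unfolding q_def using pf hN e by (intro AE_I2 ennreal_lincomb[symmetric]) auto
      qed (simp_all add: Mplus_iff)
      also have "\<dots> \<le> 1"
        using Yp Yh e by (intro ri_convex) (auto simp: Mplus_iff)
      finally have Yq: "Y (\<lambda>x. ennreal (q x)) \<le> 1" .
      \<comment> \<open>\<open>h\<close> is not assumed to lie below \<open>f\<close>, so the convex
        combination \<open>q\<close> is cut at \<open>f\<close>. The cut stays in the unit ball
        because \<open>Y\<close> is monotone, and it is at least as close to
        \<open>f\<close>.\<close>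
      have "(LINT x|U. (f x - p x)\<^sup>2) \<le> (LINT x|U. (f x - min (f x) (q x))\<^sup>2)"
      proof (rule near)
        have "0 \<le> min (f x) (q x) \<and> min (f x) (q x) \<le> f x" if "x \<in> space U" for x
          using q0[OF that] fM[OF that] by auto
        moreover have "Y (\<lambda>x. ennreal (min (f x) (q x))) \<le> 1"
          by (rule order_trans[OF ri_mono_U Yq]) (auto simp: Mplus_iff intro: ennreal_leI)
        ultimately show "(\<lambda>x. min (f x) (q x)) \<in> ball_below Y f"
          by (simp add: ball_below_def)
      qed
      also have "\<dots> \<le> (LINT x|U. g x * g x - 2 * e * (g x * d x) + e\<^sup>2 * (d x * d x))"
      proof (rule integral_mono_AE')
        have eq: "g x * g x - 2 * e * (g x * d x) + e\<^sup>2 * (d x * d x) = (f x - q x)\<^sup>2" for x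
          by (simp add: q_def g_def d_def power2_eq_square algebra_simps)
        show "integrable U (\<lambda>x. g x * g x - 2 * e * (g x * d x) + e\<^sup>2 * (d x * d x))"
          using i1 i2 i3 by simp
        show "AE x in U. (f x - min (f x) (q x))\<^sup>2 \<le> g x * g x - 2 * e * (g x * d x) + e\<^sup>2 * (d x * d x)"
          unfolding eq by (intro AE_I2) (auto simp: min_def)
        show "AE x in U. 0 \<le> g x * g x - 2 * e * (g x * d x) + e\<^sup>2 * (d x * d x)"
          unfolding eq by simp
      qed
      also have "\<dots> = (LINT x|U. g x * g x) - 2 * e * (LINT x|U. g x * d x) + e\<^sup>2 * (LINT x|U. d x * d x)"
        using i1 i2 i3 by simp
      finally have "2 * e * (LINT x|U. g x * d x) \<le> e\<^sup>2 * (LINT x|U. d x * d x)"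
        by (simp add: g_def power2_eq_square)
      then have "e * (2 * (LINT x|U. g x * d x)) \<le> e * (e * (LINT x|U. d x * d x))"
        by (simp add: power2_eq_square mult_ac)
      then show ?thesis using e by simp
    qed
    have "(LINT x|U. g x * d x) \<le> 0"
    proof (rule ccontr)
      assume n: "\<not> (LINT x|U. g x * d x) \<le> 0"
      define G K where "G = (LINT x|U. g x * d x)" and "K = (LINT x|U. d x * d x)"
      have G: "G > 0" using n by (simp add: G_def)
      have K: "K \<ge> 0" by (simp add: K_def)
      \<comment> \<open>Chosen so that \<open>e * K \<le> G\<close>, which contradicts
        \<open>2 * G \<le> e * K\<close> as \<open>G\<close> is positive.\<close>
      define e where "e = min 1 (G / (K + 1))"
      have "0 < e" "e \<le> 1" using G K by (auto simp: e_def)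
      then have "2 * G \<le> e * K" using key by (simp add: G_def K_def)
      also have "\<dots> \<le> (G / (K + 1)) * (K + 1)"
        using G K by (intro mult_mono) (auto simp: e_def)
      also have "\<dots> = G" using K by simp
      finally show False using G by simp
    qed
    moreover have "(LINT x|U. g x * h x) = (LINT x|U. g x * p x + g x * d x)"
      by (intro Bochner_Integration.integral_cong) (auto simp: d_def algebra_simps)
    moreover have "integrable U (\<lambda>x. g x * p x)"
      using pf fM by (intro int[where A=M and B=M] gM) (auto intro: order_trans)
    ultimately show "(LINT x|U. g x * h x) \<le> (LINT x|U. g x * p x)"
      using i2 by simp
  next
    have gM: "\<bar>g x\<bar> \<le> M" if "x \<in> space U" for x using g[OF that] by auto
    have i1: "integrable U (\<lambda>x. g x * g x)" by (rule int[OF gm gm gM gM])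
    have i2: "integrable U (\<lambda>x. g x * p x)"
      using pf fM by (intro int[where A=M and B=M] gM) (auto intro: order_trans)
    have "(LINT x|U. g x * g x) \<noteq> 0"
    proof
      assume "(LINT x|U. g x * g x) = 0"
      then have "AE x in U. g x * g x = 0"
        using i1 by (subst (asm) integral_nonneg_eq_0_iff_AE) auto
      then have "AE x in U. ennreal (f x) = ennreal (p x)"
        by eventually_elim (simp add: g_def)
      then have "Y (\<lambda>x. ennreal (f x)) = Y (\<lambda>x. ennreal (p x))"
        by (intro ri_cong_AE) (auto simp: Mplus_iff)
      then show False using Yp Yf by simp
    qed
    then have "0 < (LINT x|U. g x * g x)"
      using integral_nonneg_AE[of "\<lambda>x. g x * g x" U] by (simp add: less_le)
    moreover have "(LINT x|U. g x * f x) = (LINT x|U. g x * p x + g x * g x)"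
      by (intro Bochner_Integration.integral_cong) (auto simp: g_def algebra_simps)
    ultimately show "(LINT x|U. g x * p x) < (LINT x|U. g x * f x)"
      using i1 i2 by simp
    show "0 \<le> (LINT x|U. g x * p x)"
      using g pf by (intro integral_nonneg_AE AE_I2) auto
  qed (use g in \<open>auto simp: gm\<close>)
qed

text \<open>Unbounded functions are reached by truncation: \<open>f\<close> at a level
  \<open>n\<close> where the norm still exceeds 1, by monotone convergence of the norm, and the
  competitors \<open>h\<close> at levels tending to infinity. Dividing by a \<open>c\<close>
  strictly between \<open>\<kappa>\<close> and the integral of \<open>g * f'\<close> turns the
  separation into one by the value 1; \<open>c\<close> is positive also when
  \<open>\<kappa> = 0\<close>.\<close>

lemma ri_separation:
  assumes f: "f \<in> Mplus" and Yf: "1 < Y f"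
  obtains g where "g \<in> Mplus" "\<And>h. h \<in> Mplus \<Longrightarrow> Y h \<le> 1 \<Longrightarrow> (\<integral>\<^sup>+x. h x * g x \<partial>U) \<le> 1"
    "1 < (\<integral>\<^sup>+x. f x * g x \<partial>U)"
proof -
  have cut: "(\<lambda>n. min v (ennreal (real n))) \<longlonglongrightarrow> v" for v :: ennreal
  proof -
    have "(\<lambda>n. min v (of_nat n)) \<longlonglongrightarrow> min v top"
      by (intro tendsto_min tendsto_const of_nat_tendsto_top_ennreal)
    then show ?thesis by (simp add: ennreal_of_nat_eq_real_of_nat)
  qed
  have inc: "incseq (\<lambda>n. min v (ennreal (real n)))" for v
    by (intro incseq_SucI min.mono ennreal_leI) auto
  have fm[measurable]: "f \<in> borel_measurable U" using f by (simp add: Mplus_iff)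
  define F where "F n x = min (f x) (ennreal (real n))" for n x
  have Fm[measurable]: "F n \<in> borel_measurable U" for n unfolding F_def by measurable
  have "(\<lambda>n. Y (F n)) \<longlonglongrightarrow> Y f"
    by (rule ri_monotone_convergence) (auto simp: Mplus_iff f fm F_def intro: cut inc)
  then have "\<forall>\<^sub>F n in sequentially. 1 < Y (F n)"
    using Yf by (simp add: order_tendstoD)
  then obtain n where n: "1 < Y (F n)" by (auto simp: eventually_sequentially)
  define f' where "f' x = enn2real (F n x)" for x
  have Ff: "F n x = ennreal (f' x)" for x
    unfolding f'_def F_def by (simp add: min_less_iff_disj)
  have f'm: "f' \<in> borel_measurable U" unfolding f'_def by measurable
  have f'n: "0 \<le> f' x \<and> f' x \<le> real n" for x
    unfolding f'_def F_def by (auto intro!: enn2real_leI)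
  have "F n = (\<lambda>x. ennreal (f' x))" using Ff by (rule ext)
  then have Yf': "1 < Y (\<lambda>x. ennreal (f' x))" using n by simp
  obtain g \<kappa> where gm[measurable]: "g \<in> borel_measurable U"
    and g: "\<And>x. x \<in> space U \<Longrightarrow> 0 \<le> g x \<and> g x \<le> real n"
    and gh: "\<And>h N. h \<in> ball_below Y (\<lambda>_. N) \<Longrightarrow> (LINT x|U. g x * h x) \<le> \<kappa>"
    and \<kappa>: "0 \<le> \<kappa>" "\<kappa> < (LINT x|U. g x * f' x)"
    using ri_separation_bounded[OF f'm f'n Yf'] by blast
  obtain c where c: "\<kappa> < c" "c < (LINT x|U. g x * f' x)" using dense[OF \<kappa>(2)] by auto
  have c0: "0 < c" using \<kappa> c by simp
  define G where "G x = ennreal (g x / c)" for x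
  have Gm[measurable]: "G \<in> borel_measurable U" unfolding G_def by measurable
  have toint: "(\<integral>\<^sup>+x. ennreal (h x) * G x \<partial>U) = ennreal ((LINT x|U. g x * h x) / c)"
    if hm[measurable]: "h \<in> borel_measurable U" and hN: "\<And>x. 0 \<le> h x \<and> h x \<le> N" for h N
  proof -
    have "integrable U (\<lambda>x. g x * h x)"
    proof (rule U.integrable_const_bound[where B="real n * N"])
      show "AE x in U. norm (g x * h x) \<le> real n * N"
        using g hN by (intro AE_I2) (auto simp: abs_mult intro!: mult_mono)
    qed measurable
    then have i: "integrable U (\<lambda>x. g x * h x / c)" by simp
    have "(\<integral>\<^sup>+x. ennreal (h x) * G x \<partial>U) = (\<integral>\<^sup>+x. ennreal (g x * h x / c) \<partial>U)"
      using g hN c0 by (intro nn_integral_cong) (auto simp: G_def ennreal_mult'[symmetric] mult_ac)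
    also have "\<dots> = ennreal (LINT x|U. g x * h x / c)"
      using g hN c0 i by (intro nn_integral_eq_integral AE_I2) auto
    finally show ?thesis by simp
  qed
  show ?thesis
  proof (rule that[of G])
    show "G \<in> Mplus" by (simp add: Mplus_iff)
    have "1 < ennreal ((LINT x|U. g x * f' x) / c)"
      using c c0 by (simp add: ennreal_less_iff[of 1, simplified])
    also have "\<dots> = (\<integral>\<^sup>+x. F n x * G x \<partial>U)"
      using toint[OF f'm f'n] by (simp add: Ff)
    also have "\<dots> \<le> (\<integral>\<^sup>+x. f x * G x \<partial>U)"
      by (intro nn_integral_mono mult_right_mono) (auto simp: F_def)
    finally show "1 < (\<integral>\<^sup>+x. f x * G x \<partial>U)" .
  next
    fix h assume h: "h \<in> Mplus" "Y h \<le> 1"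
    have hm[measurable]: "h \<in> borel_measurable U" using h by (simp add: Mplus_iff)
    define H where "H m x = min (h x) (ennreal (real m))" for m :: nat and x
    have le: "(\<integral>\<^sup>+x. H m x * G x \<partial>U) \<le> 1" for m
    proof -
      have Hr: "H m x = ennreal (enn2real (H m x))" for x
        unfolding H_def by (simp add: min_less_iff_disj)
      have Hm[measurable]: "H m \<in> borel_measurable U" unfolding H_def by measurable
      have Hb: "0 \<le> enn2real (H m x) \<and> enn2real (H m x) \<le> real m" for x
        unfolding H_def by (auto intro!: enn2real_leI)
      have "Y (H m) \<le> 1"
        by (rule order_trans[OF ri_mono_U h(2)]) (auto simp: Mplus_iff H_def)
      moreover have "H m = (\<lambda>x. ennreal (enn2real (H m x)))" using Hr by (rule ext)
      ultimately have Y1: "Y (\<lambda>x. ennreal (enn2real (H m x))) \<le> 1" by simp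
      have "(LINT x|U. g x * enn2real (H m x)) \<le> \<kappa>"
        by (rule gh[of _ "real m"]) (use Hb Y1 in \<open>auto simp: ball_below_def\<close>)
      then have "(LINT x|U. g x * enn2real (H m x)) / c \<le> 1" using c c0 by simp
      moreover have "(\<integral>\<^sup>+x. ennreal (enn2real (H m x)) * G x \<partial>U) = ennreal ((LINT x|U. g x * enn2real (H m x)) / c)"
        by (rule toint[OF _ Hb]) measurable
      ultimately show ?thesis unfolding Hr[symmetric] by simp
    qed
    have "(\<lambda>m. \<integral>\<^sup>+x. H m x * G x \<partial>U) \<longlonglongrightarrow> (\<integral>\<^sup>+x. h x * G x \<partial>U)"
    proof (rule nn_integral_LIMSEQ)
      show "incseq (\<lambda>m x. H m x * G x)"
        unfolding H_def by (intro incseq_SucI le_funI mult_right_mono min.mono ennreal_leI) auto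
      show "(\<lambda>m. H m x * G x) \<longlonglongrightarrow> h x * G x" for x
        unfolding H_def by (subst (1 2) mult.commute, intro ennreal_tendsto_cmult cut) (auto simp: G_def)
    qed (auto simp: H_def)
    then show "(\<integral>\<^sup>+x. h x * G x \<partial>U) \<le> 1"
      using le by (meson LIMSEQ_le_const2)
  qed
qed

text \<open>The Lorentz-Luxemburg theorem. For the bound from above \<open>f\<close> is scaled to
  norm 1, with \<open>Y f\<close> zero or infinite treated apart. For the converse \<open>f\<close>
  is divided by some \<open>q\<close> strictly between the two values; the function separating the
  quotient lies in the associate unit ball, and its integral against \<open>f\<close> is at least
  \<open>q\<close>.\<close>

lemma associate_associate_norm:
  assumes f: "f \<in> Mplus"
  shows "associate_norm (associate_norm Y) f = Y f"
proof (rule antisym)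
  have fm[measurable]: "f \<in> borel_measurable U" using f by (simp add: Mplus_iff)
  show "associate_norm (associate_norm Y) f \<le> Y f"
    unfolding associate_norm_def[of "associate_norm Y"]
  proof (rule SUP_least)
    fix g assume "g \<in> {g \<in> Mplus. associate_norm Y g \<le> 1}"
    then have g: "g \<in> Mplus" "associate_norm Y g \<le> 1" by auto
    have gm[measurable]: "g \<in> borel_measurable U" using g by (simp add: Mplus_iff)
    have unit: "(\<integral>\<^sup>+x. g x * h x \<partial>U) \<le> 1" if "h \<in> Mplus" "Y h \<le> 1" for h
      using g(2) that unfolding associate_norm_def by (auto simp: SUP_le_iff mult.commute)
    show "(\<integral>\<^sup>+x. g x * f x \<partial>U) \<le> Y f"
    proof (cases "Y f")
      case top then show ?thesis by simp
    next
      case (real y)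
      show ?thesis
      proof (cases "y = 0")
        case True
        then have "AE x in U. f x = 0" using ri_zero_iff[OF f] real by simp
        then have "(\<integral>\<^sup>+x. g x * f x \<partial>U) = (\<integral>\<^sup>+x. 0 \<partial>U)"
          by (intro nn_integral_cong_AE) auto
        then show ?thesis by simp
      next
        case False
        then have y: "0 < y" using real by simp
        have "(\<integral>\<^sup>+x. g x * (ennreal (1/y) * f x) \<partial>U) \<le> 1"
          using y by (intro unit Mplus_cmult f) (simp add: ri_cmult[OF f] real ennreal_inverse_mult)
        also have "(\<integral>\<^sup>+x. g x * (ennreal (1/y) * f x) \<partial>U) = ennreal (1/y) * (\<integral>\<^sup>+x. g x * f x \<partial>U)"
          by (subst nn_integral_cmult[symmetric]) (auto simp: mult_ac)
        finally have "ennreal y * (ennreal (1/y) * (\<integral>\<^sup>+x. g x * f x \<partial>U)) \<le> ennreal y * 1"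
          by (rule mult_left_mono) simp
        then show ?thesis
          using y unfolding ennreal_inverse_cancel[OF y] real by simp
      qed
    qed
  qed
  show "Y f \<le> associate_norm (associate_norm Y) f"
  proof (rule ccontr)
    assume "\<not> Y f \<le> associate_norm (associate_norm Y) f"
    then obtain q where q: "associate_norm (associate_norm Y) f < ennreal q" "ennreal q < Y f"
      using ennreal_rat_dense[of "associate_norm (associate_norm Y) f" "Y f"] by (auto simp: not_le)
    then have q0: "0 < q" by (metis ennreal_neg le_less_trans not_le not_less_zero)
    define F where "F x = ennreal (1/q) * f x" for x
    have F: "F \<in> Mplus" unfolding F_def by (rule Mplus_cmult[OF f])
    have "ennreal (1/q) * ennreal q < ennreal (1/q) * Y f"
      using q0 q(2) by (intro ennreal_mult_strict_left_mono) auto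
    also have "\<dots> = Y F" unfolding F_def using q0 by (simp add: ri_cmult[OF f])
    finally have "1 < Y F" unfolding ennreal_inverse_mult[OF q0] .
    obtain g where g: "g \<in> Mplus" "\<And>h. h \<in> Mplus \<Longrightarrow> Y h \<le> 1 \<Longrightarrow> (\<integral>\<^sup>+x. h x * g x \<partial>U) \<le> 1"
      "1 < (\<integral>\<^sup>+x. F x * g x \<partial>U)"
      using ri_separation[OF F \<open>1 < Y F\<close>] by blast
    have gm[measurable]: "g \<in> borel_measurable U" using g by (simp add: Mplus_iff)
    have g1: "associate_norm Y g \<le> 1"
      unfolding associate_norm_def using g(2) by (auto intro: SUP_least)
    have "ennreal q * 1 \<le> ennreal q * (\<integral>\<^sup>+x. F x * g x \<partial>U)"
      using g(3) by (intro mult_left_mono) auto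
    also have "\<dots> = (\<integral>\<^sup>+x. g x * f x \<partial>U)"
    proof -
      have "(\<integral>\<^sup>+x. F x * g x \<partial>U) = ennreal (1/q) * (\<integral>\<^sup>+x. g x * f x \<partial>U)"
        unfolding F_def by (subst nn_integral_cmult[symmetric]) (auto simp: mult_ac)
      then show ?thesis
        by (simp only: ennreal_inverse_cancel[OF q0])
    qed
    also have "\<dots> \<le> associate_norm (associate_norm Y) f"
      unfolding associate_norm_def[of "associate_norm Y"]
      using g(1) g1 by (intro SUP_upper) auto
    finally show False using q(1) by simp
  qed
qed

end

section \<open>The iterated Hardy operator and its adjoint\<close>

lemma ennreal_eq_if_less_iff:
  fixes a b :: ennreal
  assumes "\<And>t. t < a \<longleftrightarrow> t < b"
  shows "a = b"
  using assms[of a] assms[of b] by (metis less_irrefl linorder_neqE)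

lemma less_ennreal_cmult_iff:
  assumes "0 < c"
  shows "t < ennreal c * v \<longleftrightarrow> ennreal (1 / c) * t < v"
proof
  assume "t < ennreal c * v"
  then have "ennreal (1/c) * t < ennreal (1/c) * (ennreal c * v)"
    using assms by (intro ennreal_mult_strict_left_mono) auto
  also have "\<dots> = v" using ennreal_inverse_cancel[of "1/c" v] assms by simp
  finally show "ennreal (1 / c) * t < v" .
next
  assume "ennreal (1 / c) * t < v"
  then have "ennreal c * (ennreal (1/c) * t) < ennreal c * v"
    using assms by (intro ennreal_mult_strict_left_mono) auto
  then show "t < ennreal c * v" unfolding ennreal_inverse_cancel[OF assms] .
qed

lemma rearr01_cmult:
  assumes g: "g \<in> borel_measurable U" and c: "0 < c" and s: "0 \<le> s"
  shows "rearr01 (\<lambda>x. ennreal c * g x) s = ennreal c * rearr01 g s"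
proof (rule ennreal_eq_if_less_iff)
  fix t
  have "(\<lambda>x. ennreal c * g x) \<in> borel_measurable U" using g by measurable
  then show "t < rearr01 (\<lambda>x. ennreal c * g x) s \<longleftrightarrow> t < ennreal c * rearr01 g s"
    by (simp add: rearr01_gt_iff[OF _ s] g less_ennreal_cmult_iff[OF c])
qed

lemma associate_norm_le_iff:
  "associate_norm X g \<le> c \<longleftrightarrow> (\<forall>f\<in>Mplus. X f \<le> 1 \<longrightarrow> (\<integral>\<^sup>+x. f x * g x \<partial>U) \<le> c)"
  unfolding associate_norm_def by (auto simp: SUP_le_iff)

lemma associate_norm_upper:
  "f \<in> Mplus \<Longrightarrow> X f \<le> 1 \<Longrightarrow> (\<integral>\<^sup>+x. f x * g x \<partial>U) \<le> associate_norm X g"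
  using associate_norm_le_iff by blast

lemma associate_norm_mono:
  "(\<And>x. x \<in> space U \<Longrightarrow> g x \<le> h x) \<Longrightarrow> associate_norm X g \<le> associate_norm X h"
  unfolding associate_norm_le_iff
  by (auto intro!: order_trans[OF nn_integral_mono associate_norm_upper] mult_left_mono)

lemma associate_norm_cong:
  "(\<And>x. x \<in> space U \<Longrightarrow> g x = h x) \<Longrightarrow> associate_norm X g = associate_norm X h"
  by (intro antisym associate_norm_mono) auto

lemma associate_norm_cmult:
  assumes g[measurable]: "g \<in> borel_measurable U"
  shows "associate_norm X (\<lambda>x. c * g x) = c * associate_norm X g"
proof (cases "{f \<in> Mplus. X f \<le> 1} = {}")
  case True
  then show ?thesis unfolding associate_norm_def True by (simp add: bot_ennreal)
next
  case False
  have "(\<integral>\<^sup>+x. f x * (c * g x) \<partial>U) = c * (\<integral>\<^sup>+x. f x * g x \<partial>U)" if "f \<in> Mplus" for f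
  proof -
    have [measurable]: "f \<in> borel_measurable U" using that by (simp add: Mplus_iff)
    have "(\<integral>\<^sup>+x. f x * (c * g x) \<partial>U) = (\<integral>\<^sup>+x. c * (f x * g x) \<partial>U)"
      by (simp add: mult_ac)
    then show ?thesis by (simp add: nn_integral_cmult)
  qed
  then show ?thesis
    using False unfolding associate_norm_def by (simp add: SUP_mult_left_ennreal cong: SUP_cong_simp)
qed

lemma associate_norm_add:
  assumes g[measurable]: "g \<in> borel_measurable U" and h[measurable]: "h \<in> borel_measurable U"
  shows "associate_norm X (\<lambda>x. g x + h x) \<le> associate_norm X g + associate_norm X h"
  unfolding associate_norm_le_iff
proof (intro ballI impI)
  fix f assume f: "f \<in> Mplus" "X f \<le> 1"
  then have [measurable]: "f \<in> borel_measurable U" by (simp add: Mplus_iff)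
  have "(\<integral>\<^sup>+x. f x * (g x + h x) \<partial>U) = (\<integral>\<^sup>+x. f x * g x \<partial>U) + (\<integral>\<^sup>+x. f x * h x \<partial>U)"
    by (simp add: distrib_left nn_integral_add)
  also have "\<dots> \<le> associate_norm X g + associate_norm X h"
    using f by (intro add_mono associate_norm_upper)
  finally show "(\<integral>\<^sup>+x. f x * (g x + h x) \<partial>U) \<le> associate_norm X g + associate_norm X h" .
qed

text \<open>The cut-off \<open>0 < r < s\<close> is part of the kernel, so operator and adjoint are
  integrals of the same kernel over the whole unit interval and Tonelli applies without change of
  limits.\<close>

definition hardy_ker :: "nat \<Rightarrow> real \<Rightarrow> real \<Rightarrow> ennreal" where
  "hardy_ker m s r = ennreal (if 0 < r \<and> r < s then ln (s / r) ^ (m - 1) / s else 0)"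

lemma hardy_ker_measurable [measurable (raw)]:
  assumes [measurable]: "s \<in> borel_measurable M" "r \<in> borel_measurable M"
  shows "(\<lambda>x. hardy_ker m (s x) (r x)) \<in> borel_measurable M"
  unfolding hardy_ker_def by measurable

definition hardy :: "nat \<Rightarrow> (real \<Rightarrow> ennreal) \<Rightarrow> real \<Rightarrow> ennreal" where
  "hardy m g s = (\<integral>\<^sup>+r. hardy_ker m s r * g r \<partial>U)"

definition hardy_adj :: "nat \<Rightarrow> (real \<Rightarrow> ennreal) \<Rightarrow> real \<Rightarrow> ennreal" where
  "hardy_adj m f r = (\<integral>\<^sup>+s. hardy_ker m s r * f s \<partial>U)"

interpretation UU: pair_sigma_finite U U
  by (intro pair_sigma_finite.intro U.sigma_finite_measure_axioms)

lemma hardy_measurable [measurable]: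
  assumes [measurable]: "g \<in> borel_measurable U"
  shows "hardy m g \<in> borel_measurable U"
proof -
  have "(\<lambda>s. \<integral>\<^sup>+r. hardy_ker m s r * g r \<partial>U) \<in> borel_measurable U" by measurable
  then show ?thesis by (simp add: hardy_def[abs_def])
qed

lemma hardy_adj_measurable [measurable]:
  assumes [measurable]: "f \<in> borel_measurable U"
  shows "hardy_adj m f \<in> borel_measurable U"
proof -
  have "(\<lambda>r. \<integral>\<^sup>+s. hardy_ker m s r * f s \<partial>U) \<in> borel_measurable U" by measurable
  then show ?thesis by (simp add: hardy_adj_def[abs_def])
qed

lemma hardy_hardy_adj_adjoint:
  assumes [measurable]: "f \<in> borel_measurable U" "g \<in> borel_measurable U"
  shows "(\<integral>\<^sup>+s. f s * hardy m g s \<partial>U) = (\<integral>\<^sup>+r. hardy_adj m f r * g r \<partial>U)"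
proof -
  have "(\<integral>\<^sup>+s. f s * hardy m g s \<partial>U) = (\<integral>\<^sup>+s. \<integral>\<^sup>+r. f s * (hardy_ker m s r * g r) \<partial>U \<partial>U)"
    unfolding hardy_def by (intro nn_integral_cong nn_integral_cmult[symmetric]) measurable
  also have "\<dots> = (\<integral>\<^sup>+r. \<integral>\<^sup>+s. f s * (hardy_ker m s r * g r) \<partial>U \<partial>U)"
    by (rule UU.Fubini'[symmetric]) measurable
  also have "\<dots> = (\<integral>\<^sup>+r. \<integral>\<^sup>+s. hardy_ker m s r * f s * g r \<partial>U \<partial>U)"
    by (simp add: mult_ac)
  also have "\<dots> = (\<integral>\<^sup>+r. hardy_adj m f r * g r \<partial>U)"
    unfolding hardy_adj_def by (intro nn_integral_cong nn_integral_multc) measurable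
  finally show ?thesis .
qed

lemma hardy_mono:
  "(\<And>x. x \<in> space U \<Longrightarrow> g x \<le> h x) \<Longrightarrow> hardy m g s \<le> hardy m h s"
  unfolding hardy_def by (intro nn_integral_mono mult_left_mono) auto

lemma hardy_cong:
  "(\<And>x. x \<in> space U \<Longrightarrow> g x = h x) \<Longrightarrow> hardy m g s = hardy m h s"
  unfolding hardy_def by (intro nn_integral_cong) auto

lemma hardy_cong_AE:
  "AE x in U. g x = h x \<Longrightarrow> hardy m g s = hardy m h s"
  unfolding hardy_def by (intro nn_integral_cong_AE) (auto elim: eventually_mono)

lemma hardy_cmult:
  assumes [measurable]: "g \<in> borel_measurable U"
  shows "hardy m (\<lambda>x. c * g x) s = c * hardy m g s"
proof -
  have "hardy m (\<lambda>x. c * g x) s = (\<integral>\<^sup>+r. c * (hardy_ker m s r * g r) \<partial>U)"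
    unfolding hardy_def by (simp add: mult_ac)
  then show ?thesis unfolding hardy_def by (simp add: nn_integral_cmult)
qed

lemma hardy_add:
  assumes [measurable]: "g \<in> borel_measurable U" "h \<in> borel_measurable U"
  shows "hardy m (\<lambda>x. g x + h x) s = hardy m g s + hardy m h s"
  unfolding hardy_def by (simp add: distrib_left nn_integral_add)

text \<open>For fixed \<open>s\<close> the kernel decreases in \<open>r\<close>, so the monotonicity
  does not depend on \<open>f\<close>.\<close>

lemma dec01_hardy_adj: "dec01 (hardy_adj m f)"
  unfolding dec01_def hardy_adj_def
proof (intro allI impI nn_integral_mono mult_right_mono)
  fix x y s :: real assume xy: "0 < x" "x \<le> y" "y < 1" and s: "s \<in> space U"
  show "hardy_ker m s y \<le> hardy_ker m s x"
  proof (cases "y < s")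
    case True
    then have "ln (s / y) \<le> ln (s / x)" "0 \<le> ln (s / y)"
      using xy by (auto simp: frac_le)
    then show ?thesis
      using True xy by (auto simp: hardy_ker_def intro!: ennreal_leI divide_right_mono power_mono)
  qed (auto simp: hardy_ker_def)
qed simp

text \<open>The substitution \<open>r = s * x\<close> removes \<open>s\<close> from kernel and
  domain and leaves it in the argument of \<open>g\<close> alone, which makes monotonicity of
  \<open>hardy m g\<close> evident.\<close>

lemma hardy_scaled:
  assumes g: "dec01 g" and s: "s \<in> space U"
  shows "hardy m g s = (\<integral>\<^sup>+x. ennreal (ln (1 / x) ^ (m - 1)) * g (s * x) \<partial>U)"
proof -
  have s01: "0 < s" "s < 1" using s by (auto simp: space_U)
  note [measurable] = dec01_borel[OF g]
  have "hardy m g s = (\<integral>\<^sup>+r. hardy_ker m s r * (g r * indicator {0<..<1} r) \<partial>lborel)"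
    unfolding hardy_def nn_integral_U by (simp add: mult_ac)
  also have "\<dots> = ennreal \<bar>s\<bar> * (\<integral>\<^sup>+x. hardy_ker m s (0 + s * x) * (g (0 + s * x) * indicator {0<..<1} (0 + s * x)) \<partial>lborel)"
    using s01 by (intro nn_integral_real_affine) auto
  also have "\<dots> = (\<integral>\<^sup>+x. ennreal s * (hardy_ker m s (s * x) * (g (s * x) * indicator {0<..<1} (s * x))) \<partial>lborel)"
    using s01 by (subst nn_integral_cmult[symmetric]) auto
  also have "\<dots> = (\<integral>\<^sup>+x. ennreal (ln (1 / x) ^ (m - 1)) * g (s * x) * indicator {0<..<1} x \<partial>lborel)"
  proof (intro nn_integral_cong)
    fix x :: real
    show "ennreal s * (hardy_ker m s (s * x) * (g (s * x) * indicator {0<..<1} (s * x))) =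
      ennreal (ln (1 / x) ^ (m - 1)) * g (s * x) * indicator {0<..<1} x"
    proof (cases "0 < x \<and> x < 1")
      case True
      then have "s * x < 1" using s01 using True mult_strict_mono[of s 1 x 1] by simp
      moreover have "ennreal s * hardy_ker m s (s * x) = ennreal (ln (1 / x) ^ (m - 1))"
        using True s01 by (simp add: hardy_ker_def ennreal_mult[symmetric])
      ultimately show ?thesis using True s01 by (simp add: mult.assoc[symmetric])
    next
      case False
      then have "hardy_ker m s (s * x) = 0" using s01 by (auto simp: hardy_ker_def zero_less_mult_iff)
      then show ?thesis using False by auto
    qed
  qed
  finally show ?thesis unfolding nn_integral_U .
qed

lemma dec01_hardy:
  assumes g: "dec01 g"
  shows "dec01 (hardy m g)"
  unfolding dec01_def
proof (intro allI impI)
  fix x y :: real assume xy: "0 < x" "x \<le> y" "y < 1"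
  then have U: "x \<in> space U" "y \<in> space U" by (auto simp: space_U)
  show "hardy m g y \<le> hardy m g x"
    unfolding hardy_scaled[OF g U(1)] hardy_scaled[OF g U(2)]
  proof (intro nn_integral_mono mult_left_mono)
    fix z assume z: "z \<in> space U"
    have "x * z \<le> y * z" "0 < x * z" using xy z by (auto simp: space_U)
    moreover have "y * z < 1" using xy z mult_strict_mono[of y 1 z 1] by (simp add: space_U)
    ultimately show "g (y * z) \<le> g (x * z)" using g by (auto intro: dec01D)
  qed simp
qed

lemma nn_integral_log_power:
  assumes "0 < r" "r \<le> s" "1 \<le> m"
  shows "(\<integral>\<^sup>+t. ennreal (ln (t / r) ^ (m - 1) / t) * indicator {r..s} t \<partial>lborel) = ennreal (ln (s / r) ^ m / m)"
proof -
  have "(\<integral>\<^sup>+t. ennreal (ln (t / r) ^ (m - 1) / t) * indicator {r..s} t \<partial>lborel) =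
    ennreal (ln (s / r) ^ m / m - ln (r / r) ^ m / m)"
  proof (rule nn_integral_FTC_Icc)
    show "((\<lambda>t. ln (t / r) ^ m / m) has_real_derivative ln (t / r) ^ (m - 1) / t) (at t)"
      if "t \<in> {r..s}" for t
      using that assms by (auto intro!: derivative_eq_intros simp: field_simps)
    show "0 \<le> ln (t / r) ^ (m - 1) / t" if "t \<in> {r..s}" for t
      using that assms by auto
  qed (use assms in auto)
  then show ?thesis using assms by (simp add: zero_power)
qed

lemma hardy_ker_integral:
  assumes "r \<in> space U" "s \<in> space U \<or> s = 1" "1 \<le> m"
  shows "(\<integral>\<^sup>+t. hardy_ker m t r * indicator {..<s} t \<partial>U) = (if r < s then ennreal (ln (s / r) ^ m / m) else 0)"
proof -
  have rs: "0 < r" "r < 1" "0 < s" "s \<le> 1" using assms by (auto simp: space_U)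
  have "(\<integral>\<^sup>+t. hardy_ker m t r * indicator {..<s} t \<partial>U) = (\<integral>\<^sup>+t. ennreal (ln (t / r) ^ (m - 1) / t) * indicator {r..s} t \<partial>lborel)"
    unfolding nn_integral_U
  proof (rule nn_integral_cong_AE)
    show "AE t in lborel. hardy_ker m t r * indicator {..<s} t * indicator {0<..<1} t =
      ennreal (ln (t / r) ^ (m - 1) / t) * indicator {r..s} t"
      using AE_lborel_singleton[of r] AE_lborel_singleton[of s]
      by eventually_elim (use rs in \<open>auto simp: hardy_ker_def indicator_def\<close>)
  qed
  also have "\<dots> = (if r < s then ennreal (ln (s / r) ^ m / m) else 0)"
  proof (cases "r < s")
    case True
    then show ?thesis using nn_integral_log_power[of r s m] rs assms by simp
  next
    case False
    have "(\<integral>\<^sup>+t. ennreal (ln (t / r) ^ (m - 1) / t) * indicator {r..s} t \<partial>lborel) = (\<integral>\<^sup>+t. 0 \<partial>(lborel :: real measure))"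
      using AE_lborel_singleton[of r] by (intro nn_integral_cong_AE) (use False in \<open>auto elim!: eventually_mono simp: indicator_def\<close>)
    then show ?thesis using False by simp
  qed
  finally show ?thesis .
qed

lemma hardy1_hardy:
  assumes [measurable]: "g \<in> borel_measurable U" and m: "1 \<le> m" and s: "s \<in> space U"
  shows "hardy 1 (hardy m g) s = ennreal (1 / m) * hardy (Suc m) g s"
proof -
  have "hardy 1 (hardy m g) s = (\<integral>\<^sup>+t. \<integral>\<^sup>+r. hardy_ker 1 s t * (hardy_ker m t r * g r) \<partial>U \<partial>U)"
    unfolding hardy_def by (intro nn_integral_cong nn_integral_cmult[symmetric]) measurable
  also have "\<dots> = (\<integral>\<^sup>+r. \<integral>\<^sup>+t. hardy_ker 1 s t * (hardy_ker m t r * g r) \<partial>U \<partial>U)"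
    by (rule UU.Fubini'[symmetric]) measurable
  also have "\<dots> = (\<integral>\<^sup>+r. ennreal (1 / m) * (hardy_ker (Suc m) s r * g r) \<partial>U)"
  proof (intro nn_integral_cong)
    fix r assume r: "r \<in> space U"
    have "(\<integral>\<^sup>+t. hardy_ker 1 s t * (hardy_ker m t r * g r) \<partial>U) = (\<integral>\<^sup>+t. ennreal (1 / s) * (hardy_ker m t r * indicator {..<s} t) * g r \<partial>U)"
      by (intro nn_integral_cong) (auto simp: hardy_ker_def indicator_def space_U mult_ac)
    also have "\<dots> = ennreal (1 / s) * (\<integral>\<^sup>+t. hardy_ker m t r * indicator {..<s} t \<partial>U) * g r"
      by (simp add: nn_integral_cmult nn_integral_multc)
    also have "ennreal (1 / s) * (\<integral>\<^sup>+t. hardy_ker m t r * indicator {..<s} t \<partial>U) = ennreal (1 / m) * hardy_ker (Suc m) s r"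
      unfolding hardy_ker_integral[OF r disjI1[OF s] m] using r s
      by (auto simp: hardy_ker_def space_U ennreal_mult[symmetric] mult_ac)
    finally show "(\<integral>\<^sup>+t. hardy_ker 1 s t * (hardy_ker m t r * g r) \<partial>U) = ennreal (1 / m) * (hardy_ker (Suc m) s r * g r)"
      by (simp add: mult_ac)
  qed
  also have "\<dots> = ennreal (1 / m) * hardy (Suc m) g s"
    unfolding hardy_def by (rule nn_integral_cmult) measurable
  finally show ?thesis .
qed

lemma hardy_Suc:
  assumes "g \<in> borel_measurable U" and m: "1 \<le> m" and "s \<in> space U"
  shows "hardy (Suc m) g s = ennreal m * hardy 1 (hardy m g) s"
  unfolding hardy1_hardy[OF assms] using ennreal_inverse_cancel[of "real m"] m by simp

text \<open>Induction on \<open>k\<close>, peeling off \<open>hardy 1\<close> by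
  \<open>hardy_Suc\<close>. The constant produced is the Beta function value \<open>B(k, h)\<close>:
  it starts at \<open>1 / h\<close> and is multiplied by \<open>k / (k + h)\<close> in each
  step.\<close>

lemma hardy_comp:
  assumes "1 \<le> k" "1 \<le> h"
  shows "\<exists>c>0. \<forall>g\<in>borel_measurable U. \<forall>s\<in>space U. hardy k (hardy h g) s = ennreal c * hardy (k + h) g s"
  using assms(1)
proof (induction k rule: dec_induct)
  case base
  show ?case
    using hardy1_hardy[OF _ assms(2)] assms(2) by (intro exI[of _ "1 / real h"]) auto
next
  case (step k)
  then obtain c where c: "c > 0" "\<And>g s. g \<in> borel_measurable U \<Longrightarrow> s \<in> space U \<Longrightarrow> hardy k (hardy h g) s = ennreal c * hardy (k + h) g s"
    by auto
  have "hardy (Suc k) (hardy h g) s = ennreal (real k * c / (k + h)) * hardy (Suc k + h) g s"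
    if g[measurable]: "g \<in> borel_measurable U" and s: "s \<in> space U" for g s
  proof -
    have "hardy (Suc k) (hardy h g) s = ennreal k * hardy 1 (hardy k (hardy h g)) s"
      using step s by (intro hardy_Suc) auto
    also have "hardy 1 (hardy k (hardy h g)) s = hardy 1 (\<lambda>s. ennreal c * hardy (k + h) g s) s"
      by (intro hardy_cong c g)
    also have "\<dots> = ennreal c * hardy 1 (hardy (k + h) g) s"
      by (intro hardy_cmult) measurable
    also have "hardy 1 (hardy (k + h) g) s = ennreal (1 / (k + h)) * hardy (Suc (k + h)) g s"
      using step s by (subst hardy1_hardy) auto
    also have "ennreal k * (ennreal c * (ennreal (1 / (k + h)) * hardy (Suc (k + h)) g s)) =
      ennreal (real k * c / (k + h)) * hardy (Suc k + h) g s"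
      using c by (simp add: mult.assoc[symmetric] ennreal_mult[symmetric] del: of_nat_add)
    finally show ?thesis .
  qed
  then show ?case
    using step c by (intro exI[of _ "real k * c / (k + h)"]) auto
qed

lemma hardy1_one:
  assumes "s \<in> space U"
  shows "hardy 1 (\<lambda>_. 1) s = 1"
proof -
  have "hardy 1 (\<lambda>_. 1) s = (\<integral>\<^sup>+r. ennreal (1 / s) * indicator {0<..<s} r \<partial>U)"
    unfolding hardy_def using assms by (intro nn_integral_cong) (auto simp: hardy_ker_def indicator_def space_U)
  also have "\<dots> = ennreal (1 / s) * emeasure U {0<..<s}"
    using assms by (intro nn_integral_cmult_indicator) (auto simp: sets_restrict_space_iff space_U)
  also have "\<dots> = 1"
    using assms by (auto simp: emeasure_U_Ioo space_U ennreal_inverse_mult)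
  finally show ?thesis .
qed

lemma hardy_one:
  assumes "1 \<le> m"
  shows "\<exists>K\<ge>0. \<forall>s\<in>space U. hardy m (\<lambda>_. 1) s = ennreal K"
  using assms
proof (induction m rule: dec_induct)
  case base
  then show ?case using hardy1_one by (intro exI[of _ 1]) auto
next
  case (step m)
  then obtain K where K: "K \<ge> 0" "\<And>s. s \<in> space U \<Longrightarrow> hardy m (\<lambda>_. 1) s = ennreal K" by auto
  have "hardy (Suc m) (\<lambda>_. 1) s = ennreal (m * K)" if s: "s \<in> space U" for s
  proof -
    have "hardy (Suc m) (\<lambda>_. 1) s = ennreal m * hardy 1 (hardy m (\<lambda>_. 1)) s"
      using step s by (intro hardy_Suc) auto
    also have "hardy 1 (hardy m (\<lambda>_. 1)) s = hardy 1 (\<lambda>_. ennreal K * 1) s"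
      by (intro hardy_cong) (simp add: K)
    also have "\<dots> = ennreal K * hardy 1 (\<lambda>_. 1) s"
      by (rule hardy_cmult) measurable
    also have "hardy 1 (\<lambda>_. 1) s = 1" by (rule hardy1_one[OF s])
    finally show ?thesis using K(1) by (simp add: ennreal_mult)
  qed
  then show ?case using K(1) by (intro exI[of _ "m * K"]) auto
qed

section \<open>The tilde norm as a polar\<close>

lemma tilde_associate_norm_eq:
  assumes "g \<in> borel_measurable U"
  shows "tilde_associate_norm m X g = associate_norm X (hardy m (rearr01 g))"
  unfolding tilde_associate_norm_def
proof (rule associate_norm_cong)
  fix s assume s: "s \<in> space U"
  note [measurable] = dec01_borel[OF dec01_rearr01[OF assms]]
  have "(\<integral>\<^sup>+r\<in>{0<..<s}. (ennreal (ln (s / r) ^ (m - 1)) * rearr01 g r) \<partial>lebesgue) =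
    (\<integral>\<^sup>+r. ennreal (ln (s / r) ^ (m - 1)) * indicator {0<..<s} r * (rearr01 g r * indicator {0<..<1} r) \<partial>lborel)"
    unfolding nn_integral_completion using s by (intro nn_integral_cong) (auto simp: indicator_def space_U)
  then have "ennreal (1 / s) * (\<integral>\<^sup>+r\<in>{0<..<s}. (ennreal (ln (s / r) ^ (m - 1)) * rearr01 g r) \<partial>lebesgue) =
    (\<integral>\<^sup>+r. ennreal (1 / s) * (ennreal (ln (s / r) ^ (m - 1)) * indicator {0<..<s} r * (rearr01 g r * indicator {0<..<1} r)) \<partial>lborel)"
    by (subst nn_integral_cmult) auto
  also have "\<dots> = hardy m (rearr01 g) s"
    unfolding hardy_def nn_integral_U
    using s by (intro nn_integral_cong)
      (auto simp: indicator_def hardy_ker_def space_U mult.assoc[symmetric] ennreal_mult[symmetric] mult.commute[of _ "1 / s"])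
  finally show "ennreal (1 / s) * (\<integral>\<^sup>+r\<in>{0<..<s}. (ennreal (ln (s / r) ^ (m - 1)) * rearr01 g r) \<partial>lebesgue) = hardy m (rearr01 g) s" .
qed

lemma hardy_adj_one:
  assumes "1 \<le> m" "r \<in> space U"
  shows "hardy_adj m (\<lambda>_. 1) r = ennreal (ln (1 / r) ^ m / m)"
proof -
  have "hardy_adj m (\<lambda>_. 1) r = (\<integral>\<^sup>+t. hardy_ker m t r * indicator {..<1} t \<partial>U)"
    unfolding hardy_adj_def by (intro nn_integral_cong) (auto simp: space_U)
  then show ?thesis
    using hardy_ker_integral[of r 1 m] assms by (simp add: space_U)
qed

lemma ennreal_mult3: "0 \<le> a \<Longrightarrow> 0 \<le> b \<Longrightarrow> 0 \<le> c \<Longrightarrow> ennreal (a * b * c) = ennreal a * (ennreal b * ennreal c)"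
  by (simp add: ennreal_mult mult.assoc)

text \<open>The first clause makes \<open>tilde_associate_norm\<close> finite on constants, the
  second bounds it from below by a weighted integral. Stated this weakly, the property passes to
  \<open>XG_norm m X\<close>, so that the tilde construction can be applied twice.\<close>

definition admissible :: "((real \<Rightarrow> ennreal) \<Rightarrow> ennreal) \<Rightarrow> bool" where
  "admissible X \<longleftrightarrow> (\<exists>C. \<forall>f\<in>Mplus. X f \<le> 1 \<longrightarrow> (\<integral>\<^sup>+x. f x \<partial>U) \<le> ennreal C) \<and>
     (\<exists>c>0. X (\<lambda>_. ennreal c) \<le> 1)"

text \<open>Since \<open>ln (2 / s)\<close> stays above \<open>ln 2\<close> on the unit interval,
  weights with negative exponent are bounded there and inverse to those with positive
  exponent.\<close>

definition wt :: "real \<Rightarrow> real \<Rightarrow> ennreal" where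
  "wt a s = ennreal (ln (2 / s) powr a)"

lemma dec01_wt:
  assumes "0 \<le> a"
  shows "dec01 (wt a)"
  unfolding dec01_def wt_def using assms by (auto intro!: ennreal_leI powr_mono2 divide_left_mono)

lemma dec01_mult:
  fixes f g :: "real \<Rightarrow> ennreal"
  assumes "dec01 f" "dec01 g"
  shows "dec01 (\<lambda>x. f x * g x)"
  using assms unfolding dec01_def by (auto intro!: mult_mono)

lemma dec01_const: "dec01 (\<lambda>_. c)"
  by (simp add: dec01_def)

text \<open>Used to discard the points near 1, where \<open>ln (1 / x)\<close> degenerates while
  \<open>ln (2 / x)\<close> does not. The right half of the integral is compared with the left one
  through the value at \<open>1/2\<close>.\<close>

lemma nn_integral_dec01_half:
  assumes f: "dec01 f"
  shows "(\<integral>\<^sup>+x. f x \<partial>U) \<le> 2 * (\<integral>\<^sup>+x. f x * indicator {..<1/2} x \<partial>U)"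
proof -
  note [measurable] = dec01_measurable[OF f]
  have ind: "emeasure U {x \<in> space U. 1/2 \<le> x} = emeasure U {x \<in> space U. x < 1/2}"
  proof -
    have eq: "{x \<in> space U. x < 1/2} = {0<..<1/2}" "{x \<in> space U. 1/2 \<le> x} = {1/2..<1}" by (auto simp: space_U)
    show ?thesis unfolding eq by (subst (1 2) emeasure_restrict_space) auto
  qed
  have "(\<integral>\<^sup>+x. f x * indicator {1/2..} x \<partial>U) \<le> (\<integral>\<^sup>+x. f (1/2) * indicator {x \<in> space U. 1/2 \<le> x} x \<partial>U)"
    by (intro nn_integral_mono) (auto simp: indicator_def space_U intro: dec01D[OF f])
  also have "\<dots> = f (1/2) * emeasure U {x \<in> space U. 1/2 \<le> x}"
    by (rule nn_integral_cmult_indicator) measurable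
  also have "\<dots> = (\<integral>\<^sup>+x. f (1/2) * indicator {x \<in> space U. x < 1/2} x \<partial>U)"
    unfolding ind by (rule nn_integral_cmult_indicator[symmetric]) measurable
  also have "\<dots> \<le> (\<integral>\<^sup>+x. f x * indicator {..<1/2} x \<partial>U)"
    by (intro nn_integral_mono) (auto simp: indicator_def space_U intro: dec01D[OF f])
  finally have "(\<integral>\<^sup>+x. f x * indicator {1/2..} x \<partial>U) \<le> (\<integral>\<^sup>+x. f x * indicator {..<1/2} x \<partial>U)" .
  moreover have "(\<integral>\<^sup>+x. f x \<partial>U) = (\<integral>\<^sup>+x. f x * indicator {..<1/2} x + f x * indicator {1/2..} x \<partial>U)"
    by (intro nn_integral_cong) (auto simp: indicator_def)
  moreover have "\<dots> = (\<integral>\<^sup>+x. f x * indicator {..<1/2} x \<partial>U) + (\<integral>\<^sup>+x. f x * indicator {1/2..} x \<partial>U)"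
    by (intro nn_integral_add) auto
  ultimately show ?thesis by (simp add: mult_2 add_left_mono)
qed

lemma tilde_associate_norm_cmult:
  assumes g: "g \<in> borel_measurable U" and c: "0 < c"
  shows "tilde_associate_norm m X (\<lambda>x. ennreal c * g x) = ennreal c * tilde_associate_norm m X g"
proof -
  have gm: "(\<lambda>x. ennreal c * g x) \<in> borel_measurable U" using g by measurable
  have r[measurable]: "rearr01 g \<in> borel_measurable U" by (rule dec01_measurable[OF dec01_rearr01[OF g]])
  have "hardy m (rearr01 (\<lambda>x. ennreal c * g x)) s = hardy m (\<lambda>x. ennreal c * rearr01 g x) s" for s
    by (intro hardy_cong rearr01_cmult g c) (auto simp: space_U)
  also have "hardy m (\<lambda>x. ennreal c * rearr01 g x) s = ennreal c * hardy m (rearr01 g) s" for s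
    by (rule hardy_cmult[OF r])
  finally have "hardy m (rearr01 (\<lambda>x. ennreal c * g x)) = (\<lambda>s. ennreal c * hardy m (rearr01 g) s)"
    by (rule ext)
  then show ?thesis
    by (simp add: tilde_associate_norm_eq g gm associate_norm_cmult)
qed

text \<open>Testing the associate norm with the constant \<open>c\<close> from
  \<open>admissible\<close> gives the integral of \<open>ln (1 / x) ^ m / m\<close> against
  \<open>rearr01 g\<close>. For \<open>x < 1/2\<close> one has
  \<open>ln (2 / x) \<le> 2 * ln (1 / x)\<close>, whence \<open>2 ^ m\<close>; the other factor 2 is
  the price for restricting to this half.\<close>

lemma nn_integral_wt_le_tilde_associate_norm:
  assumes X: "admissible X" and m: "1 \<le> m"
  shows "\<exists>C>0. \<forall>g\<in>borel_measurable U. (\<integral>\<^sup>+x. wt m x * rearr01 g x \<partial>U) \<le> ennreal C * tilde_associate_norm m X g"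
proof -
  obtain c where c: "c > 0" "X (\<lambda>_. ennreal c) \<le> 1" using X by (auto simp: admissible_def)
  have "(\<integral>\<^sup>+x. wt m x * rearr01 g x \<partial>U) \<le> ennreal (2 * 2 ^ m * m / c) * tilde_associate_norm m X g"
    if g: "g \<in> borel_measurable U" for g
  proof -
    have dg: "dec01 (rearr01 g)" by (rule dec01_rearr01[OF g])
    note [measurable] = dec01_measurable[OF dg]
    have half: "(\<integral>\<^sup>+x. wt m x * rearr01 g x \<partial>U) \<le> 2 * (\<integral>\<^sup>+x. wt m x * rearr01 g x * indicator {..<1/2} x \<partial>U)"
      by (intro nn_integral_dec01_half dec01_mult dec01_wt dg) simp
    have L: "(\<integral>\<^sup>+x. ennreal c * (ennreal (ln (1 / x) ^ m / m) * rearr01 g x) \<partial>U) \<le> tilde_associate_norm m X g"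
    proof -
      have "(\<integral>\<^sup>+x. ennreal c * (ennreal (ln (1 / x) ^ m / m) * rearr01 g x) \<partial>U) =
        ennreal c * (\<integral>\<^sup>+x. ennreal (ln (1 / x) ^ m / m) * rearr01 g x \<partial>U)"
        by (simp add: nn_integral_cmult)
      also have "(\<integral>\<^sup>+x. ennreal (ln (1 / x) ^ m / m) * rearr01 g x \<partial>U) = (\<integral>\<^sup>+x. hardy_adj m (\<lambda>_. 1) x * rearr01 g x \<partial>U)"
        by (intro nn_integral_cong) (simp add: hardy_adj_one[OF m])
      also have "\<dots> = (\<integral>\<^sup>+x. 1 * hardy m (rearr01 g) x \<partial>U)"
        by (rule hardy_hardy_adj_adjoint[symmetric]) measurable
      also have "ennreal c * (\<integral>\<^sup>+x. 1 * hardy m (rearr01 g) x \<partial>U) = (\<integral>\<^sup>+x. ennreal c * hardy m (rearr01 g) x \<partial>U)"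
        by (simp add: nn_integral_cmult)
      also have "\<dots> \<le> tilde_associate_norm m X g"
        unfolding tilde_associate_norm_eq[OF g] using c by (intro associate_norm_upper) (auto simp: Mplus_iff)
      finally show ?thesis .
    qed
    have "(\<integral>\<^sup>+x. wt m x * rearr01 g x * indicator {..<1/2} x \<partial>U) \<le>
      (\<integral>\<^sup>+x. ennreal (2 ^ m * m / c) * (ennreal c * (ennreal (ln (1 / x) ^ m / m) * rearr01 g x)) \<partial>U)"
    proof (intro nn_integral_mono)
      fix x assume x: "x \<in> space U"
      show "wt m x * rearr01 g x * indicator {..<1/2} x \<le>
        ennreal (2 ^ m * m / c) * (ennreal c * (ennreal (ln (1 / x) ^ m / m) * rearr01 g x))"
      proof (cases "x < 1/2")
        case True
        have "ln (2 / x) \<le> ln ((1 / x) ^ 2)"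
          using True x by (subst ln_le_cancel_iff) (auto simp: space_U power2_eq_square field_simps)
        also have "\<dots> = 2 * ln (1 / x)" using x by (subst ln_realpow) (auto simp: space_U)
        finally have "ln (2 / x) ^ m \<le> (2 * ln (1 / x)) ^ m"
          using x by (intro power_mono) (auto simp: space_U)
        also have "\<dots> = 2 ^ m * m / c * c * (ln (1 / x) ^ m / m)"
          using c m by (simp add: power_mult_distrib)
        finally have "wt m x \<le> ennreal (2 ^ m * m / c * c * (ln (1 / x) ^ m / m))"
          using x True by (auto simp: wt_def space_U powr_realpow intro!: ennreal_leI)
        also have "\<dots> = ennreal (2 ^ m * m / c) * (ennreal c * ennreal (ln (1 / x) ^ m / m))"
          using c x by (intro ennreal_mult3) (auto simp: space_U)
        finally have "wt m x * rearr01 g x \<le> ennreal (2 ^ m * m / c) * (ennreal c * ennreal (ln (1 / x) ^ m / m)) * rearr01 g x"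
          by (intro mult_right_mono) auto
        then show ?thesis using True by (simp add: mult.assoc)
      qed simp
    qed
    also have "\<dots> = ennreal (2 ^ m * m / c) * (\<integral>\<^sup>+x. ennreal c * (ennreal (ln (1 / x) ^ m / m) * rearr01 g x) \<partial>U)"
      by (rule nn_integral_cmult) measurable
    also have "\<dots> \<le> ennreal (2 ^ m * m / c) * tilde_associate_norm m X g"
      by (rule mult_left_mono[OF L]) simp
    finally have "2 * (\<integral>\<^sup>+x. wt m x * rearr01 g x * indicator {..<1/2} x \<partial>U) \<le> ennreal 2 * (ennreal (2 ^ m * m / c) * tilde_associate_norm m X g)"
      unfolding ennreal_numeral by (rule mult_left_mono) simp
    also have "\<dots> = ennreal (2 * (2 ^ m * m / c)) * tilde_associate_norm m X g"
      using c by (subst ennreal_mult) (auto simp: mult.assoc)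
    finally show ?thesis using half by (simp add: mult.assoc)
  qed
  then show ?thesis
    using c m by (intro exI[of _ "2 * 2 ^ m * m / c"]) auto
qed

text \<open>\<open>hardy m\<close> maps constants to constants, and the first clause of
  \<open>admissible\<close> bounds the integrals against these. The maximum with 1 in
  \<open>D\<close> keeps the divisor positive.\<close>

lemma tilde_associate_norm_const_finite:
  assumes X: "admissible X" and m: "1 \<le> m"
  shows "\<exists>c>0. tilde_associate_norm m X (\<lambda>_. ennreal c) \<le> 1"
proof -
  obtain C where C: "\<And>f. f \<in> Mplus \<Longrightarrow> X f \<le> 1 \<Longrightarrow> (\<integral>\<^sup>+x. f x \<partial>U) \<le> ennreal C" using X by (auto simp: admissible_def)
  obtain K where K: "K \<ge> 0" "\<And>s. s \<in> space U \<Longrightarrow> hardy m (\<lambda>_. 1) s = ennreal K" using hardy_one[OF m] by auto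
  define D where "D = max 1 (K * C)"
  have "associate_norm X (hardy m (rearr01 (\<lambda>_. 1))) \<le> ennreal D"
    unfolding associate_norm_le_iff
  proof (intro ballI impI)
    fix f assume f: "f \<in> Mplus" "X f \<le> 1"
    then have [measurable]: "f \<in> borel_measurable U" by (simp add: Mplus_iff)
    have "(\<integral>\<^sup>+x. f x * hardy m (rearr01 (\<lambda>_. 1)) x \<partial>U) = (\<integral>\<^sup>+x. f x * ennreal K \<partial>U)"
    proof (intro nn_integral_cong)
      fix x assume x: "x \<in> space U"
      have "hardy m (rearr01 (\<lambda>_. 1)) x = hardy m (\<lambda>_. 1) x"
        by (intro hardy_cong_AE rearr01_dec01_AE dec01_const)
      then show "f x * hardy m (rearr01 (\<lambda>_. 1)) x = f x * ennreal K" using K x by simp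
    qed
    also have "\<dots> = (\<integral>\<^sup>+x. f x \<partial>U) * ennreal K" by (rule nn_integral_multc) measurable
    also have "\<dots> \<le> ennreal C * ennreal K" using C[OF f] by (rule mult_right_mono) simp
    also have "\<dots> \<le> ennreal D"
      using K(1) by (simp add: ennreal_mult''[symmetric] D_def mult.commute ennreal_leI)
    finally show "(\<integral>\<^sup>+x. f x * hardy m (rearr01 (\<lambda>_. 1)) x \<partial>U) \<le> ennreal D" .
  qed
  then have "tilde_associate_norm m X (\<lambda>_. 1) \<le> ennreal D" by (simp add: tilde_associate_norm_eq)
  then have "ennreal (1 / D) * tilde_associate_norm m X (\<lambda>_. 1) \<le> ennreal (1 / D) * ennreal D"
    by (rule mult_left_mono) simp
  also have "\<dots> = 1" by (rule ennreal_inverse_mult) (simp add: D_def)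
  also have "ennreal (1 / D) * tilde_associate_norm m X (\<lambda>_. 1) = tilde_associate_norm m X (\<lambda>_. ennreal (1 / D) * 1)"
    by (rule tilde_associate_norm_cmult[symmetric]) (auto simp: D_def)
  finally show ?thesis by (intro exI[of _ "1 / D"]) (auto simp: D_def)
qed

lemma nn_integral_hardy_adj_le_tilde_associate_norm:
  assumes f: "f \<in> Mplus" "X f \<le> 1" and g: "g \<in> borel_measurable U"
  shows "(\<integral>\<^sup>+x. hardy_adj m f x * rearr01 g x \<partial>U) \<le> tilde_associate_norm m X g"
proof -
  note [measurable] = dec01_measurable[OF dec01_rearr01[OF g]]
  have "(\<integral>\<^sup>+x. hardy_adj m f x * rearr01 g x \<partial>U) = (\<integral>\<^sup>+x. f x * hardy m (rearr01 g) x \<partial>U)"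
    using f(1) by (intro hardy_hardy_adj_adjoint[symmetric]) (auto simp: Mplus_iff)
  also have "\<dots> \<le> tilde_associate_norm m X g"
    unfolding tilde_associate_norm_eq[OF g] using f by (rule associate_norm_upper)
  finally show ?thesis .
qed

lemma tilde_associate_norm_rearr01:
  assumes "f \<in> borel_measurable U" "g \<in> borel_measurable U" "\<And>s. s \<in> space U \<Longrightarrow> rearr01 f s = rearr01 g s"
  shows "tilde_associate_norm m X f = tilde_associate_norm m X g"
  using assms by (auto simp: tilde_associate_norm_eq intro!: associate_norm_cong hardy_cong)

text \<open>
  The tilde norm is the polar of its prescribed associate \<open>N\<close>. As \<open>N\<close> is itself a supremum of linear
  functionals, namely those given by \<open>hardy_adj m f \<circ> \<sigma>\<close> with \<open>X f \<le> 1\<close> and \<open>\<sigma>\<close> measure preserving,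
  the polar of the polar is \<open>N\<close> again.
\<close>
lemma tilde_polar:
  assumes X: "admissible X" and m: "1 \<le> m"
  defines "N \<equiv> tilde_associate_norm m X"
  shows "ri_function_norm (associate_norm N)"
    and "\<And>g. g \<in> Mplus \<Longrightarrow> associate_norm (associate_norm N) g = N g"
proof -
  define Y where "Y = associate_norm N"
  obtain c where c: "c > 0" "N (\<lambda>_. ennreal c) \<le> 1"
    using tilde_associate_norm_const_finite[OF X m] unfolding N_def by auto
  obtain C where C: "C > 0" "\<And>g. g \<in> borel_measurable U \<Longrightarrow> (\<integral>\<^sup>+x. wt m x * rearr01 g x \<partial>U) \<le> ennreal C * N g"
    using nn_integral_wt_le_tilde_associate_norm[OF X m] unfolding N_def by auto
  have Y_upper: "(\<integral>\<^sup>+x. g x * f x \<partial>U) \<le> Y f" if "g \<in> Mplus" "N g \<le> 1" for f g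
    unfolding Y_def using that by (rule associate_norm_upper)
  have Y_mono: "Y f \<le> Y g" if "AE x in U. f x \<le> g x" for f g
    unfolding Y_def associate_norm_le_iff
  proof (intro ballI impI)
    fix h assume h: "h \<in> Mplus" "N h \<le> 1"
    have "(\<integral>\<^sup>+x. h x * f x \<partial>U) \<le> (\<integral>\<^sup>+x. h x * g x \<partial>U)"
      using that by (intro nn_integral_mono_AE) (auto elim!: eventually_mono intro: mult_left_mono)
    also have "\<dots> \<le> associate_norm N g" using h by (rule associate_norm_upper)
    finally show "(\<integral>\<^sup>+x. h x * f x \<partial>U) \<le> associate_norm N g" .
  qed
  have cU: "ennreal c * (\<integral>\<^sup>+x. f x \<partial>U) \<le> Y f" if "f \<in> Mplus" for f
  proof -
    have "ennreal c * (\<integral>\<^sup>+x. f x \<partial>U) = (\<integral>\<^sup>+x. ennreal c * f x \<partial>U)"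
      using that by (intro nn_integral_cmult[symmetric]) (simp add: Mplus_iff)
    also have "\<dots> \<le> Y f" using c by (intro Y_upper) (auto simp: Mplus_iff)
    finally show ?thesis .
  qed
  have ri: "ri_function_norm Y"
    unfolding ri_function_norm_def
  proof (intro conjI ballI allI impI)
    fix f assume f: "f \<in> Mplus"
    then have fm[measurable]: "f \<in> borel_measurable U" by (simp add: Mplus_iff)
    show "Y f = 0 \<longleftrightarrow> (AE x in U. f x = 0)"
    proof
      assume "Y f = 0"
      then have "(\<integral>\<^sup>+x. f x \<partial>U) = 0" using cU[OF f] c by simp
      then show "AE x in U. f x = 0" by (subst (asm) nn_integral_0_iff_AE) auto
    next
      assume ae: "AE x in U. f x = 0"
      have "Y f \<le> Y (\<lambda>_. 0)" by (rule Y_mono) (use ae in \<open>auto elim: eventually_mono\<close>)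
      also have "Y (\<lambda>_. 0) \<le> 0" unfolding Y_def associate_norm_le_iff by simp
      finally show "Y f = 0" by simp
    qed
    show "Y (\<lambda>x. ennreal a * f x) = ennreal a * Y f" for a :: real
      unfolding Y_def by (rule associate_norm_cmult[OF fm])
    show "Y (\<lambda>x. f x + g x) \<le> Y f + Y g" if "g \<in> Mplus" for g
      unfolding Y_def using that by (intro associate_norm_add) (auto simp: Mplus_iff)
    show "Y f \<le> Y g" if "AE x in U. f x \<le> g x" for g using that by (rule Y_mono)
    show "Y f = Y g" if g: "g \<in> Mplus" and eq: "\<forall>s\<in>{0<..<1}. rearr01 f s = rearr01 g s" for g
    proof -
      have le: "Y f \<le> Y g" if f: "f \<in> Mplus" and g: "g \<in> Mplus" and eq: "\<forall>s\<in>{0<..<1}. rearr01 f s = rearr01 g s" for f g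
        unfolding Y_def associate_norm_le_iff
      proof (intro ballI impI)
        fix h assume h: "h \<in> Mplus" "N h \<le> 1"
        have hm: "h \<in> borel_measurable U" and fm: "f \<in> borel_measurable U" and gm: "g \<in> borel_measurable U"
          using h f g by (auto simp: Mplus_iff)
        have dh: "dec01 (rearr01 h)" by (rule dec01_rearr01[OF hm])
        obtain \<sigma> where \<sigma>: "mpres \<sigma>" "AE x in U. g x = rearr01 g (\<sigma> x)"
          by (rule mpres_rearr01_exists[OF gm])
        \<comment> \<open>The rearrangement of \<open>h\<close> placed in the order of
          \<open>g\<close>: it has the same \<open>N\<close>, and its integral against
          \<open>g\<close> equals that of the two rearrangements, the largest value Hardy-Littlewood
          allows.\<close>
        define h' where "h' x = rearr01 h (\<sigma> x)" for x
        have h'm: "h' \<in> borel_measurable U"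
          unfolding h'_def by (rule dec01_comp_measurable[OF \<sigma>(1) dh])
        have h'N: "N h' = N h"
        proof -
          have "N h' = N (rearr01 h)"
            unfolding N_def h'_def using h'm[unfolded h'_def] dec01_measurable[OF dh]
            by (rule tilde_associate_norm_rearr01) (auto intro: rearr01_mpres[OF \<sigma>(1) dh] simp: space_U)
          also have "\<dots> = N h"
          proof -
            have "associate_norm X (hardy m (rearr01 (rearr01 h))) = associate_norm X (hardy m (rearr01 h))"
              by (intro associate_norm_cong hardy_cong_AE rearr01_dec01_AE dh)
            then show ?thesis unfolding N_def by (simp add: tilde_associate_norm_eq hm dec01_measurable[OF dh])
          qed
          finally show ?thesis .
        qed
        have "(\<integral>\<^sup>+x. h x * f x \<partial>U) \<le> (\<integral>\<^sup>+x. rearr01 h x * rearr01 f x \<partial>U)"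
          by (rule hardy_littlewood[OF hm fm])
        also have "\<dots> = (\<integral>\<^sup>+x. rearr01 h x * rearr01 g x \<partial>U)"
          using eq by (intro nn_integral_cong) (auto simp: space_U)
        also have "\<dots> = (\<integral>\<^sup>+x. rearr01 h (\<sigma> x) * rearr01 g (\<sigma> x) \<partial>U)"
          by (rule nn_integral_mpres_mult[OF \<sigma>(1) dh dec01_rearr01[OF gm], symmetric])
        also have "\<dots> = (\<integral>\<^sup>+x. h' x * g x \<partial>U)"
          using \<sigma>(2) by (intro nn_integral_cong_AE) (auto elim!: eventually_mono simp: h'_def)
        also have "\<dots> \<le> associate_norm N g"
          using h h'm h'N by (intro associate_norm_upper) (auto simp: Mplus_iff)
        finally show "(\<integral>\<^sup>+x. h x * f x \<partial>U) \<le> associate_norm N g" .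
      qed
      show ?thesis using le[OF f g eq] le[OF g f] eq by (auto intro: antisym)
    qed
  next
    show "Y (\<lambda>_. 1) < \<infinity>"
    proof -
      define b :: real where "b = ln 2 ^ m"
      have b: "0 < b" by (simp add: b_def)
      have "Y (\<lambda>_. 1) \<le> ennreal (C / b)"
        unfolding Y_def associate_norm_le_iff
      proof (intro ballI impI)
        fix g assume g: "g \<in> Mplus" "N g \<le> 1"
        then have gm[measurable]: "g \<in> borel_measurable U" by (simp add: Mplus_iff)
        note [measurable] = dec01_measurable[OF dec01_rearr01[OF gm]]
        have "ennreal b * (\<integral>\<^sup>+x. g x * 1 \<partial>U) \<le> ennreal b * (\<integral>\<^sup>+x. rearr01 g x * 1 \<partial>U)"
          by (intro mult_left_mono hardy_littlewood_dec01 gm dec01_const) simp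
        also have "\<dots> = (\<integral>\<^sup>+x. ennreal b * (rearr01 g x * 1) \<partial>U)"
          by (rule nn_integral_cmult[symmetric]) measurable
        also have "\<dots> \<le> (\<integral>\<^sup>+x. wt m x * rearr01 g x \<partial>U)"
        proof (intro nn_integral_mono)
          fix x assume x: "x \<in> space U"
          have "b \<le> ln (2 / x) ^ m"
            unfolding b_def using x by (intro power_mono) (auto simp: space_U field_simps)
          then have "ennreal b \<le> wt m x"
            using x by (auto simp: wt_def powr_realpow space_U intro: ennreal_leI)
          then show "ennreal b * (rearr01 g x * 1) \<le> wt m x * rearr01 g x"
            by (simp add: mult_right_mono)
        qed
        also have "\<dots> \<le> ennreal C * 1"
          using C(2)[OF gm] mult_left_mono[OF g(2), of "ennreal C"] by (auto intro: order_trans)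
        finally have "ennreal (1/b) * (ennreal b * (\<integral>\<^sup>+x. g x * 1 \<partial>U)) \<le> ennreal (1/b) * (ennreal C * 1)"
          by (rule mult_left_mono) simp
        then show "(\<integral>\<^sup>+x. g x * 1 \<partial>U) \<le> ennreal (C / b)"
          using b C(1) ennreal_inverse_cancel[of "1/b"] by (simp add: ennreal_mult[symmetric])
      qed
      then show ?thesis by (rule le_less_trans) simp
    qed
    show "\<exists>C. \<forall>f\<in>Mplus. (\<integral>\<^sup>+x. f x \<partial>U) \<le> ennreal C * Y f"
    proof (intro exI[of _ "1 / c"] ballI)
      fix f assume "f \<in> Mplus"
      then have "ennreal (1/c) * (ennreal c * (\<integral>\<^sup>+x. f x \<partial>U)) \<le> ennreal (1/c) * Y f"
        by (intro mult_left_mono cU) auto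
      then show "(\<integral>\<^sup>+x. f x \<partial>U) \<le> ennreal (1 / c) * Y f"
        using c ennreal_inverse_cancel[of "1/c"] by simp
    qed
  next
    fix F and f :: "real \<Rightarrow> ennreal"
    assume *: "(\<forall>j::nat. F j \<in> Mplus) \<and> f \<in> Mplus \<and>
        (AE x in U. incseq (\<lambda>j. F j x) \<and> (\<lambda>j. F j x) \<longlonglongrightarrow> f x)"
    have Fm[measurable]: "F j \<in> borel_measurable U" for j using * by (simp add: Mplus_iff)
    have ae: "AE x in U. incseq (\<lambda>j. F j x) \<and> (\<lambda>j. F j x) \<longlonglongrightarrow> f x" using * by simp
    show inc: "incseq (\<lambda>j. Y (F j))"
    proof (intro incseq_SucI Y_mono)
      fix j show "AE x in U. F j x \<le> F (Suc j) x"
        using ae by eventually_elim (auto simp: incseq_Suc_iff)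
    qed
    have "Y f = (SUP j. Y (F j))"
    proof (rule antisym)
      show "(SUP j. Y (F j)) \<le> Y f"
      proof (intro SUP_least Y_mono)
        fix j show "AE x in U. F j x \<le> f x"
          using ae by eventually_elim (auto intro: incseq_le)
      qed
      show "Y f \<le> (SUP j. Y (F j))"
        unfolding Y_def[abs_def] associate_norm_le_iff[of N f]
      proof (intro ballI impI)
        fix g assume g: "g \<in> Mplus" "N g \<le> 1"
        then have gm[measurable]: "g \<in> borel_measurable U" by (simp add: Mplus_iff)
        have "(\<integral>\<^sup>+x. g x * f x \<partial>U) = (\<integral>\<^sup>+x. (SUP j. g x * F j x) \<partial>U)"
        proof (rule nn_integral_cong_AE)
          show "AE x in U. g x * f x = (SUP j. g x * F j x)"
            using ae
          proof eventually_elim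
            case (elim x)
            then have "f x = (SUP j. F j x)" using LIMSEQ_SUP LIMSEQ_unique by blast
            then show ?case by (simp add: SUP_mult_left_ennreal)
          qed
        qed
        also have "\<dots> = (SUP j. \<integral>\<^sup>+x. g x * F j x \<partial>U)"
        proof (rule nn_integral_monotone_convergence_SUP_AE)
          show "AE x in U. g x * F j x \<le> g x * F (Suc j) x" for j
            using ae by eventually_elim (auto simp: incseq_Suc_iff intro: mult_left_mono)
        qed measurable
        also have "\<dots> \<le> (SUP j. associate_norm N (F j))"
          using g by (intro SUP_mono) (auto intro: associate_norm_upper)
        finally show "(\<integral>\<^sup>+x. g x * f x \<partial>U) \<le> (SUP j. associate_norm N (F j))" .
      qed
    qed
    then show "(\<lambda>j. Y (F j)) \<longlonglongrightarrow> Y f" using LIMSEQ_SUP[OF inc] by simp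
  qed
  then show "ri_function_norm (associate_norm N)" by (simp add: Y_def)
  fix g assume "g \<in> Mplus"
  then have gm[measurable]: "g \<in> borel_measurable U" by (simp add: Mplus_iff)
  show "associate_norm (associate_norm N) g = N g"
  proof (rule antisym)
    show "associate_norm (associate_norm N) g \<le> N g"
      unfolding associate_norm_le_iff[of "associate_norm N"]
    proof (intro ballI impI)
      fix f assume f: "f \<in> Mplus" "associate_norm N f \<le> 1"
      then have [measurable]: "f \<in> borel_measurable U" by (simp add: Mplus_iff)
      show "(\<integral>\<^sup>+x. f x * g x \<partial>U) \<le> N g"
      proof (rule dense_ge)
        fix y assume y: "N g < y"
        \<comment> \<open>\<open>N g\<close> may vanish, so \<open>g\<close> is normalised by a
          number \<open>q\<close> slightly above it.\<close>
        obtain q where q: "N g < ennreal q" "ennreal q < y" using ennreal_rat_dense[OF y] by auto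
        have q0: "0 < q" using q(1) by (metis ennreal_neg le_less_trans not_le not_less_zero)
        have "N (\<lambda>x. ennreal (1/q) * g x) = ennreal (1/q) * N g"
          unfolding N_def using q0 by (intro tilde_associate_norm_cmult) auto
        also have "\<dots> \<le> ennreal (1/q) * ennreal q" using q(1) by (intro mult_left_mono) auto
        finally have "N (\<lambda>x. ennreal (1/q) * g x) \<le> 1" unfolding ennreal_inverse_mult[OF q0] .
        then have "(\<integral>\<^sup>+x. ennreal (1/q) * g x * f x \<partial>U) \<le> associate_norm N f"
          by (intro associate_norm_upper) (simp add: Mplus_iff)
        also have "(\<integral>\<^sup>+x. ennreal (1/q) * g x * f x \<partial>U) = ennreal (1/q) * (\<integral>\<^sup>+x. f x * g x \<partial>U)"
          by (subst nn_integral_cmult[symmetric]) (auto simp: mult_ac)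
        finally have "ennreal (1/q) * (\<integral>\<^sup>+x. f x * g x \<partial>U) \<le> 1" using f(2) by (rule order_trans)
        then have "ennreal q * (ennreal (1/q) * (\<integral>\<^sup>+x. f x * g x \<partial>U)) \<le> ennreal q * 1"
          by (rule mult_left_mono) simp
        then show "(\<integral>\<^sup>+x. f x * g x \<partial>U) \<le> y"
          unfolding ennreal_inverse_cancel[OF q0] using q(2) by simp
      qed
    qed
    have dg: "dec01 (rearr01 g)" by (rule dec01_rearr01[OF gm])
    show "N g \<le> associate_norm (associate_norm N) g"
      unfolding N_def tilde_associate_norm_eq[OF gm] associate_norm_le_iff[of X]
    proof (intro ballI impI)
      fix f assume f: "f \<in> Mplus" "X f \<le> 1"
      then have fm[measurable]: "f \<in> borel_measurable U" by (simp add: Mplus_iff)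
      note [measurable] = dec01_measurable[OF dg]
      obtain \<sigma> where \<sigma>: "mpres \<sigma>" "AE x in U. g x = rearr01 g (\<sigma> x)"
        by (rule mpres_rearr01_exists[OF gm])
      \<comment> \<open>Arranged in the order of \<open>g\<close>, the decreasing function
        \<open>hardy_adj m f\<close> makes Hardy-Littlewood an equality. That it belongs to the
        polar ball is Hardy-Littlewood again, now as an inequality for each
        \<open>g1\<close>.\<close>
      define h where "h x = hardy_adj m f (\<sigma> x)" for x
      have hm: "h \<in> borel_measurable U"
        unfolding h_def by (rule dec01_comp_measurable[OF \<sigma>(1) dec01_hardy_adj])
      have Yh: "associate_norm N h \<le> 1"
        unfolding associate_norm_le_iff
      proof (intro ballI impI)
        fix g1 assume g1: "g1 \<in> Mplus" "N g1 \<le> 1"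
        then have g1m: "g1 \<in> borel_measurable U" by (simp add: Mplus_iff)
        have "(\<integral>\<^sup>+x. g1 x * h x \<partial>U) \<le> (\<integral>\<^sup>+x. rearr01 g1 x * rearr01 h x \<partial>U)"
          by (rule hardy_littlewood[OF g1m hm])
        also have "\<dots> = (\<integral>\<^sup>+x. rearr01 (hardy_adj m f) x * rearr01 g1 x \<partial>U)"
          unfolding h_def by (intro nn_integral_cong) (auto simp: rearr01_mpres[OF \<sigma>(1) dec01_hardy_adj] space_U mult.commute)
        also have "\<dots> = (\<integral>\<^sup>+x. hardy_adj m f x * rearr01 g1 x \<partial>U)"
          by (rule nn_integral_rearr01_dec01[OF dec01_hardy_adj])
        also have "\<dots> \<le> N g1"
          unfolding N_def using f g1m by (rule nn_integral_hardy_adj_le_tilde_associate_norm)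
        finally show "(\<integral>\<^sup>+x. g1 x * h x \<partial>U) \<le> 1" using g1(2) by simp
      qed
      have "(\<integral>\<^sup>+x. f x * hardy m (rearr01 g) x \<partial>U) = (\<integral>\<^sup>+x. hardy_adj m f x * rearr01 g x \<partial>U)"
        by (rule hardy_hardy_adj_adjoint) measurable
      also have "\<dots> = (\<integral>\<^sup>+x. hardy_adj m f (\<sigma> x) * rearr01 g (\<sigma> x) \<partial>U)"
        by (rule nn_integral_mpres_mult[OF \<sigma>(1) dec01_hardy_adj dg, symmetric])
      also have "\<dots> = (\<integral>\<^sup>+x. h x * g x \<partial>U)"
        using \<sigma>(2) by (intro nn_integral_cong_AE) (auto elim!: eventually_mono simp: h_def)
      also have "\<dots> \<le> associate_norm (associate_norm N) g"
        using hm Yh by (intro associate_norm_upper) (auto simp: Mplus_iff)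
      finally show "(\<integral>\<^sup>+x. f x * hardy m (rearr01 g) x \<partial>U) \<le> associate_norm (associate_norm (tilde_associate_norm m X)) g"
        by (simp add: N_def)
    qed
  qed
qed

section \<open>Hoelder inequalities and duality on decreasing functions\<close>

lemma dec01_rearr01': "dec01 (rearr01 f)"
  unfolding rearr01_def by (rule dec01_rearrangement)

lemma rearr01_rearr01:
  assumes "f \<in> borel_measurable U" "0 \<le> s"
  shows "rearr01 (rearr01 f) s = rearr01 f s"
  by (rule rearr01_cong_emeasure) (use assms in \<open>auto simp: emeasure_rearr01_gt dec01_measurable[OF dec01_rearr01']\<close>)

text \<open>\<open>g\<close> is normalised by the bound \<open>C\<close> and \<open>X'' = X\<close>
  is applied to \<open>f\<close>; in this way no case distinction on \<open>Y f\<close> being zero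
  or infinite arises.\<close>

lemma ri_hoelder:
  assumes Y: "ri_function_norm Y" and f: "f \<in> Mplus" and g: "g \<in> Mplus"
    and le: "associate_norm Y g \<le> ennreal C" and C: "0 < C"
  shows "(\<integral>\<^sup>+x. g x * f x \<partial>U) \<le> ennreal C * Y f"
proof -
  have [measurable]: "f \<in> borel_measurable U" "g \<in> borel_measurable U" using f g by (auto simp: Mplus_iff)
  have "associate_norm Y (\<lambda>x. ennreal (1 / C) * g x) = ennreal (1 / C) * associate_norm Y g"
    by (rule associate_norm_cmult) measurable
  also have "\<dots> \<le> ennreal (1 / C) * ennreal C" by (rule mult_left_mono[OF le]) simp
  finally have "associate_norm Y (\<lambda>x. ennreal (1 / C) * g x) \<le> 1" unfolding ennreal_inverse_mult[OF C] .
  then have "(\<integral>\<^sup>+x. ennreal (1 / C) * g x * f x \<partial>U) \<le> associate_norm (associate_norm Y) f"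
    by (intro associate_norm_upper Mplus_cmult g)
  also have "\<dots> = Y f" by (rule associate_associate_norm[OF Y f])
  finally have "(\<integral>\<^sup>+x. ennreal (1 / C) * (g x * f x) \<partial>U) \<le> Y f" by (simp add: mult.assoc)
  then have "ennreal C * (\<integral>\<^sup>+x. ennreal (1 / C) * (g x * f x) \<partial>U) \<le> ennreal C * Y f" by (rule mult_left_mono) simp
  then show ?thesis
    by (subst (asm) nn_integral_cmult) (auto simp: ennreal_inverse_cancel[OF C] simp del: ennreal_mult_eq_top_iff)
qed

text \<open>A test function \<open>f\<close> is replaced by its rearrangement in the order of
  \<open>g\<close>. This has the same norm, and its integral against \<open>g\<close> is that of
  \<open>rearr01 f\<close> against \<open>rearr01 g\<close>.\<close>

lemma associate_norm_rearr01_le: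
  assumes X: "ri_function_norm X" and g: "g \<in> borel_measurable U"
  shows "associate_norm X (rearr01 g) \<le> associate_norm X g"
  unfolding associate_norm_le_iff
proof (intro ballI impI)
  fix f assume f: "f \<in> Mplus" "X f \<le> 1"
  then have fm: "f \<in> borel_measurable U" by (simp add: Mplus_iff)
  note df = dec01_rearr01'[of f]
  obtain \<sigma> where \<sigma>: "mpres \<sigma>" "AE x in U. g x = rearr01 g (\<sigma> x)"
    by (rule mpres_rearr01_exists[OF g])
  have m: "(\<lambda>x. rearr01 f (\<sigma> x)) \<in> Mplus"
    using dec01_comp_measurable[OF \<sigma>(1) df] by (simp add: Mplus_iff)
  have "X (\<lambda>x. rearr01 f (\<sigma> x)) = X f"
    using fm by (intro ri_rearr01[OF X m f(1)]) (auto simp: rearr01_mpres[OF \<sigma>(1) df] rearr01_rearr01)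
  then have X1: "X (\<lambda>x. rearr01 f (\<sigma> x)) \<le> 1" using f by simp
  have "(\<integral>\<^sup>+x. f x * rearr01 g x \<partial>U) \<le> (\<integral>\<^sup>+x. rearr01 f x * rearr01 g x \<partial>U)"
    by (rule hardy_littlewood_dec01[OF fm dec01_rearr01'])
  also have "\<dots> = (\<integral>\<^sup>+x. rearr01 f (\<sigma> x) * rearr01 g (\<sigma> x) \<partial>U)"
    by (rule nn_integral_mpres_mult[OF \<sigma>(1) df dec01_rearr01', symmetric])
  also have "\<dots> = (\<integral>\<^sup>+x. rearr01 f (\<sigma> x) * g x \<partial>U)"
    using \<sigma>(2) by (intro nn_integral_cong_AE) (auto elim!: eventually_mono)
  also have "\<dots> \<le> associate_norm X g" using m X1 by (rule associate_norm_upper)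
  finally show "(\<integral>\<^sup>+x. f x * rearr01 g x \<partial>U) \<le> associate_norm X g" .
qed

lemma associate_norm_dec01_le:
  assumes X: "ri_function_norm X" and g: "dec01 g"
    and le: "\<And>f. dec01 f \<Longrightarrow> X f \<le> 1 \<Longrightarrow> (\<integral>\<^sup>+x. f x * g x \<partial>U) \<le> c"
  shows "associate_norm X g \<le> c"
  unfolding associate_norm_le_iff
proof (intro ballI impI)
  fix f assume f: "f \<in> Mplus" "X f \<le> 1"
  then have fm: "f \<in> borel_measurable U" by (simp add: Mplus_iff)
  have "X (rearr01 f) = X f"
    using fm by (intro ri_rearr01[OF X _ f(1)] Mplus_dec01 dec01_rearr01') (auto simp: rearr01_rearr01)
  then have "(\<integral>\<^sup>+x. rearr01 f x * g x \<partial>U) \<le> c" using f by (intro le dec01_rearr01') simp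
  then show "(\<integral>\<^sup>+x. f x * g x \<partial>U) \<le> c"
    using hardy_littlewood_dec01[OF fm g] by (rule order_trans[rotated])
qed

lemma tilde_associate_norm_dec01:
  assumes "dec01 g"
  shows "tilde_associate_norm m X g = associate_norm X (hardy m g)"
  unfolding tilde_associate_norm_eq[OF dec01_measurable[OF assms]]
  by (intro associate_norm_cong hardy_cong_AE rearr01_dec01_AE assms)

text \<open>The polar norm of \<open>tilde_polar\<close> is a witness, so the choice in
  \<open>tilde_norm\<close> delivers a norm with the prescribed associate.\<close>

lemma
  assumes "admissible X" "1 \<le> m"
  shows ri_tilde_norm: "ri_function_norm (tilde_norm m X)"
    and associate_tilde_norm: "\<And>g. g \<in> Mplus \<Longrightarrow> associate_norm (tilde_norm m X) g = tilde_associate_norm m X g"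
proof -
  have "\<exists>Y. ri_function_norm Y \<and> (\<forall>g\<in>Mplus. associate_norm Y g = tilde_associate_norm m X g)"
    using tilde_polar[OF assms] by blast
  from someI_ex[OF this] have "ri_function_norm (tilde_norm m X) \<and>
    (\<forall>g\<in>Mplus. associate_norm (tilde_norm m X) g = tilde_associate_norm m X g)"
    unfolding tilde_norm_def .
  then show "ri_function_norm (tilde_norm m X)"
    "\<And>g. g \<in> Mplus \<Longrightarrow> associate_norm (tilde_norm m X) g = tilde_associate_norm m X g" by auto
qed

text \<open>By \<open>X'' = X\<close> and Hardy-Littlewood, decreasing test functions suffice for a
  decreasing \<open>f\<close>. Together with \<open>tilde_norm_hoelder\<close> for the opposite
  direction, this reduces estimates of tilde norms to the associate norm of
  \<open>hardy m g\<close>.\<close>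

lemma tilde_norm_dec01_le:
  assumes X: "admissible X" "1 \<le> m" and f: "dec01 f"
    and le: "\<And>g. dec01 g \<Longrightarrow> associate_norm X (hardy m g) \<le> 1 \<Longrightarrow> (\<integral>\<^sup>+x. g x * f x \<partial>U) \<le> c"
  shows "tilde_norm m X f \<le> c"
proof -
  have "associate_norm (associate_norm (tilde_norm m X)) f \<le> c"
    unfolding associate_norm_le_iff[of "associate_norm (tilde_norm m X)"]
  proof (intro ballI impI)
    fix g assume g: "g \<in> Mplus" "associate_norm (tilde_norm m X) g \<le> 1"
    then have gm: "g \<in> borel_measurable U" by (simp add: Mplus_iff)
    have "associate_norm X (hardy m (rearr01 g)) \<le> 1"
      using g by (simp add: associate_tilde_norm[OF X] tilde_associate_norm_eq[OF gm])
    then have "(\<integral>\<^sup>+x. rearr01 g x * f x \<partial>U) \<le> c" by (rule le[OF dec01_rearr01'])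
    then show "(\<integral>\<^sup>+x. g x * f x \<partial>U) \<le> c"
      using hardy_littlewood_dec01[OF gm f] by (rule order_trans[rotated])
  qed
  then show ?thesis
    by (simp add: associate_associate_norm[OF ri_tilde_norm[OF X] Mplus_dec01[OF f]])
qed

lemma tilde_norm_hoelder:
  assumes X: "admissible X" "1 \<le> m" and f: "f \<in> Mplus" and g: "dec01 g"
    and le: "associate_norm X (hardy m g) \<le> ennreal C" and C: "0 < C"
  shows "(\<integral>\<^sup>+x. g x * f x \<partial>U) \<le> ennreal C * tilde_norm m X f"
  by (rule ri_hoelder[OF ri_tilde_norm[OF X] f Mplus_dec01[OF g] _ C])
    (simp add: associate_tilde_norm[OF X] Mplus_dec01[OF g] tilde_associate_norm_dec01[OF g] le)

section \<open>The weighted norms \<open>XG_norm\<close>\<close>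

lemma XG_norm_eq: "XG_norm m X f = tilde_norm m X (\<lambda>s. wt (m / 2) s * rearr01 f s)"
  unfolding XG_norm_def wt_def ..

lemma XG_norm_dec01:
  assumes X: "admissible X" "1 \<le> m" and f: "dec01 f"
  shows "XG_norm m X f = tilde_norm m X (\<lambda>s. wt (m / 2) s * f s)"
  unfolding XG_norm_eq
proof (rule ri_cong_AE[OF ri_tilde_norm[OF X]])
  show "AE x in U. wt (m / 2) x * rearr01 f x = wt (m / 2) x * f x"
    using rearr01_dec01_AE[OF f] by eventually_elim simp
qed (auto intro!: Mplus_dec01 dec01_mult dec01_wt dec01_rearr01' f)

lemma admissible_ri:
  assumes X: "ri_function_norm X"
  shows "admissible X"
  unfolding admissible_def
proof
  obtain C where C: "\<And>f. f \<in> Mplus \<Longrightarrow> (\<integral>\<^sup>+x. f x \<partial>U) \<le> ennreal C * X f" using ri_nn_integral_le[OF X] by blast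
  show "\<exists>C. \<forall>f\<in>Mplus. X f \<le> 1 \<longrightarrow> (\<integral>\<^sup>+x. f x \<partial>U) \<le> ennreal C"
  proof (intro exI ballI impI)
    fix f assume "f \<in> Mplus" "X f \<le> 1"
    then show "(\<integral>\<^sup>+x. f x \<partial>U) \<le> ennreal C"
      using C[of f] mult_left_mono[of "X f" 1 "ennreal C"] by (auto intro: order_trans)
  qed
  obtain d where d: "X (\<lambda>_. 1) = ennreal d" "0 \<le> d" using ri_one[OF X] by (cases "X (\<lambda>_. 1)") auto
  have "X (\<lambda>_. ennreal (1 / (d + 1))) = ennreal (1 / (d + 1)) * X (\<lambda>_. 1)"
    using ri_cmult[OF X, of "\<lambda>_. 1" "1 / (d + 1)"] d by (simp add: Mplus_iff)
  also have "\<dots> = ennreal (1 / (d + 1) * d)" using d by (simp add: ennreal_mult[symmetric])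
  also have "\<dots> \<le> ennreal 1" using d by (intro ennreal_leI) simp
  finally show "\<exists>c>0. X (\<lambda>_. ennreal c) \<le> 1" using d by (intro exI[of _ "1 / (d + 1)"]) simp
qed

lemma wt_ge: "0 \<le> a \<Longrightarrow> x \<in> space U \<Longrightarrow> ennreal (ln 2 powr a) \<le> wt a x"
  unfolding wt_def by (intro ennreal_leI powr_mono2) (auto simp: space_U field_simps)

lemma wt_mult: "x \<in> space U \<Longrightarrow> wt a x * wt b x = wt (a + b) x"
  by (auto simp: wt_def ennreal_mult[symmetric] powr_add)

lemma wt_minus_mult: "x \<in> space U \<Longrightarrow> wt (- a) x * (wt a x * v) = v" "x \<in> space U \<Longrightarrow> wt a x * (wt (- a) x * v) = v"
  unfolding mult.assoc[symmetric] by (auto simp: wt_mult) (auto simp: wt_def space_U)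

lemma wt_minus_mono: "0 \<le> a \<Longrightarrow> 0 < r \<Longrightarrow> r \<le> t \<Longrightarrow> t < 1 \<Longrightarrow> wt (- a) r \<le> wt (- a) t"
  unfolding wt_def by (intro ennreal_leI powr_mono2') (auto intro: divide_left_mono)

lemma wt_measurable [measurable]: "wt a \<in> borel_measurable U"
  unfolding wt_def by measurable

text \<open>The clause on constants says that the tilde norm of \<open>wt (m / 2)\<close> is finite.
  By duality this is a bound for the integral of \<open>g * wt (m / 2)\<close>, and
  \<open>nn_integral_wt_le_tilde_associate_norm\<close> bounds even that of \<open>g * wt m\<close>;
  the excess factor is at least \<open>ln 2 powr (m / 2)\<close>.\<close>

lemma admissible_XG_norm:
  assumes X: "admissible X" and m: "1 \<le> m"
  shows "admissible (XG_norm m X)"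
  unfolding admissible_def
proof
  let ?Y = "tilde_norm m X" and ?w = "wt (m / 2)"
  note Y = ri_tilde_norm[OF X m]
  have b: "0 < ln (2::real) powr (m / 2)" by simp
  obtain C where C: "\<And>f. f \<in> Mplus \<Longrightarrow> (\<integral>\<^sup>+x. f x \<partial>U) \<le> ennreal C * ?Y f" using ri_nn_integral_le[OF Y] by blast
  show "\<exists>C. \<forall>f\<in>Mplus. XG_norm m X f \<le> 1 \<longrightarrow> (\<integral>\<^sup>+x. f x \<partial>U) \<le> ennreal C"
  proof (intro exI[of _ "1 / (ln 2 powr (m / 2)) * max 0 C"] ballI impI)
    fix f assume f: "f \<in> Mplus" "XG_norm m X f \<le> 1"
    then have fm: "f \<in> borel_measurable U" by (simp add: Mplus_iff)
    note [measurable] = dec01_measurable[OF dec01_rearr01'[of f]]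
    have "ennreal (ln 2 powr (m / 2)) * (\<integral>\<^sup>+x. f x \<partial>U) \<le> ennreal (ln 2 powr (m / 2)) * (\<integral>\<^sup>+x. rearr01 f x \<partial>U)"
      using hardy_littlewood_dec01[OF fm dec01_const[of 1]] by (intro mult_left_mono) auto
    also have "\<dots> = (\<integral>\<^sup>+x. ennreal (ln 2 powr (m / 2)) * rearr01 f x \<partial>U)"
      by (rule nn_integral_cmult[symmetric]) measurable
    also have "\<dots> \<le> (\<integral>\<^sup>+x. ?w x * rearr01 f x \<partial>U)"
      by (intro nn_integral_mono mult_right_mono wt_ge) auto
    also have "\<dots> \<le> ennreal C * XG_norm m X f"
      unfolding XG_norm_eq by (rule C) (simp add: Mplus_iff)
    also have "\<dots> \<le> ennreal C * 1" using f(2) by (rule mult_left_mono) simp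
    also have "\<dots> \<le> ennreal (max 0 C)" by (simp add: ennreal_leI)
    finally have "ennreal (1 / (ln 2 powr (m / 2))) * (ennreal (ln 2 powr (m / 2)) * (\<integral>\<^sup>+x. f x \<partial>U)) \<le>
      ennreal (1 / (ln 2 powr (m / 2))) * ennreal (max 0 C)"
      by (rule mult_left_mono) simp
    also have "ennreal (1 / (ln 2 powr (m / 2))) * (ennreal (ln 2 powr (m / 2)) * (\<integral>\<^sup>+x. f x \<partial>U)) = (\<integral>\<^sup>+x. f x \<partial>U)"
      using ennreal_inverse_cancel[of "1 / (ln 2 powr (m / 2))"] b by simp
    also have "ennreal (1 / (ln 2 powr (m / 2))) * ennreal (max 0 C) = ennreal (1 / (ln 2 powr (m / 2)) * max 0 C)"
      by (rule ennreal_mult[symmetric]) auto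
    finally show "(\<integral>\<^sup>+x. f x \<partial>U) \<le> ennreal (1 / (ln 2 powr (m / 2)) * max 0 C)" .
  qed
  show "\<exists>c>0. XG_norm m X (\<lambda>_. ennreal c) \<le> 1"
  proof -
    obtain C1 where C1: "C1 > 0" "\<And>g. g \<in> borel_measurable U \<Longrightarrow> (\<integral>\<^sup>+x. wt m x * rearr01 g x \<partial>U) \<le> ennreal C1 * tilde_associate_norm m X g"
      using nn_integral_wt_le_tilde_associate_norm[OF X m] by auto
    define D where "D = C1 / ln 2 powr (m / 2)"
    have D: "0 < D" using C1(1) by (simp add: D_def)
    have Yw: "?Y ?w \<le> ennreal D"
    proof (rule tilde_norm_dec01_le[OF X m])
      show "dec01 ?w" by (rule dec01_wt) simp
      fix g assume g: "dec01 g" "associate_norm X (hardy m g) \<le> 1"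
      note [measurable] = dec01_measurable[OF g(1)]
      have "ennreal (ln 2 powr (m / 2)) * (\<integral>\<^sup>+x. g x * ?w x \<partial>U) = (\<integral>\<^sup>+x. ennreal (ln 2 powr (m / 2)) * (g x * ?w x) \<partial>U)"
        by (rule nn_integral_cmult[symmetric]) measurable
      also have "\<dots> \<le> (\<integral>\<^sup>+x. ?w x * (g x * ?w x) \<partial>U)"
        by (intro nn_integral_mono mult_right_mono wt_ge) auto
      also have "\<dots> = (\<integral>\<^sup>+x. rearr01 g x * wt m x \<partial>U)"
        unfolding nn_integral_rearr01_dec01[OF g(1)]
      proof (intro nn_integral_cong)
        fix x assume "x \<in> space U"
        then have "?w x * ?w x = wt m x" by (simp add: wt_mult)
        then show "?w x * (g x * ?w x) = g x * wt m x" by (metis mult.assoc mult.commute)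
      qed
      also have "\<dots> \<le> ennreal C1 * tilde_associate_norm m X g"
        using C1(2)[of g] by (simp add: mult.commute)
      also have "\<dots> \<le> ennreal C1 * 1"
        unfolding tilde_associate_norm_dec01[OF g(1)] using g(2) by (rule mult_left_mono) simp
      finally have "ennreal (1 / (ln 2 powr (m / 2))) * (ennreal (ln 2 powr (m / 2)) * (\<integral>\<^sup>+x. g x * ?w x \<partial>U)) \<le>
        ennreal (1 / (ln 2 powr (m / 2))) * (ennreal C1 * 1)"
        by (rule mult_left_mono) simp
      also have "ennreal (1 / (ln 2 powr (m / 2))) * (ennreal (ln 2 powr (m / 2)) * (\<integral>\<^sup>+x. g x * ?w x \<partial>U)) = (\<integral>\<^sup>+x. g x * ?w x \<partial>U)"
        using ennreal_inverse_cancel[of "1 / (ln 2 powr (m / 2))"] b by simp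
      also have "ennreal (1 / (ln 2 powr (m / 2))) * (ennreal C1 * 1) = ennreal D"
        using C1(1) by (simp add: D_def ennreal_mult[symmetric])
      finally show "(\<integral>\<^sup>+x. g x * ?w x \<partial>U) \<le> ennreal D" .
    qed
    have "XG_norm m X (\<lambda>_. ennreal (1 / D)) = ?Y (\<lambda>x. ennreal (1 / D) * ?w x)"
      unfolding XG_norm_dec01[OF X m dec01_const] by (simp add: mult.commute)
    also have "\<dots> = ennreal (1 / D) * ?Y ?w"
      using D by (intro ri_cmult[OF Y]) (auto simp: Mplus_iff)
    also have "\<dots> \<le> ennreal (1 / D) * ennreal D" by (rule mult_left_mono[OF Yw]) simp
    also have "\<dots> = 1" by (rule ennreal_inverse_mult[OF D])
    finally show ?thesis using D by (intro exI[of _ "1 / D"]) simp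
  qed
qed

text \<open>By definition \<open>hardy m\<close> is bounded from the tilde associate into the
  associate of \<open>X\<close> on decreasing functions; its adjoint is therefore bounded from
  \<open>X\<close> into the tilde norm.\<close>

lemma tilde_norm_hardy_adj_le:
  assumes X: "admissible X" "1 \<le> m" and f: "f \<in> Mplus" "X f \<le> 1"
  shows "tilde_norm m X (hardy_adj m f) \<le> 1"
proof (rule tilde_norm_dec01_le[OF X dec01_hardy_adj])
  fix g assume g: "dec01 g" "associate_norm X (hardy m g) \<le> 1"
  have "(\<integral>\<^sup>+x. g x * hardy_adj m f x \<partial>U) = (\<integral>\<^sup>+x. f x * hardy m g x \<partial>U)"
    using f dec01_measurable[OF g(1)] by (subst hardy_hardy_adj_adjoint) (auto simp: Mplus_iff mult.commute)
  also have "\<dots> \<le> associate_norm X (hardy m g)" using f by (rule associate_norm_upper)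
  finally show "(\<integral>\<^sup>+x. g x * hardy_adj m f x \<partial>U) \<le> 1" using g(2) by simp
qed

section \<open>Logarithmic weights\<close>

lemma ennreal_mult3': "0 \<le> a \<Longrightarrow> 0 \<le> b \<Longrightarrow> 0 \<le> c \<Longrightarrow> ennreal (a * (b * c)) = ennreal a * (ennreal b * ennreal c)"
  by (simp add: ennreal_mult)

lemma ennreal_mult_rearrange:
  fixes A B C D I :: ennreal
  assumes "A * B = C * D"
  shows "A * I * B = C * (D * I)"
proof -
  have "A * I * B = A * B * I" by (simp only: mult_ac)
  then show ?thesis by (simp only: assms mult.assoc)
qed

lemma log_ratio_le:
  assumes "0 < r" "r < t" "t < s" "s < (1::real)"
  shows "ln (2 / r) * ln (s / t) \<le> ln (s / r) * ln (2 / t)"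
proof -
  define x y z where "x = ln s - ln t" and "y = ln t - ln r" and "z = ln 2 - ln s"
  have "0 < x" "0 < y" "0 < z" using assms by (auto simp: x_def y_def z_def)
  moreover have "ln (2 / r) = x + y + z" "ln (s / t) = x" "ln (s / r) = x + y" "ln (2 / t) = x + z"
    using assms by (auto simp: x_def y_def z_def ln_div)
  moreover have "(x + y) * (x + z) - (x + y + z) * x = y * z" by (simp add: algebra_simps)
  ultimately show ?thesis by (smt (verit) mult_pos_pos)
qed

text \<open>The weights produce \<open>R powr (k / 2) = q ^ k\<close> with
  \<open>q = sqrt R\<close>. Enlarging \<open>k - 1\<close> of these factors to \<open>R\<close>
  allows \<open>log_ratio_le\<close> to absorb them in \<open>ln (s / t) ^ (k - 1)\<close>. The
  remaining \<open>q\<close> is kept, as it has to be integrated over \<open>t\<close>.\<close>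

lemma hardy_ker_wt_le:
  assumes rts: "0 < r" "r < t" "t < s" "s < 1" and k: "1 \<le> k" and h: "1 \<le> h"
  shows "ln (s / t) ^ (k - 1) / s * (ln (t / r) ^ (h - 1) / t) * (ln (2 / t) powr - (k / 2) * ln (2 / r) powr (k / 2))
    \<le> ln (s / r) ^ (k + h - 2) / s * (sqrt (ln (2 / r) / ln (2 / t)) / t)"
proof -
  define R where "R = ln (2 / r) / ln (2 / t)"
  define q where "q = sqrt R"
  have wt: "0 < ln (2 / t)" "0 < ln (2 / r)" "ln (2 / t) \<le> ln (2 / r)"
    using rts by (auto simp: frac_le)
  have R: "1 \<le> R" using wt by (simp add: R_def)
  have q: "0 < q" "1 \<le> q" "q \<le> R"
  proof -
    show "1 \<le> q" "0 < q" using R by (auto simp: q_def)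
    then have "q * 1 \<le> q * q" by (intro mult_left_mono) auto
    also have "q * q = R" using R by (simp add: q_def)
    finally show "q \<le> R" by simp
  qed
  have "ln (2 / t) powr - (k / 2) * ln (2 / r) powr (k / 2) = R powr (k / 2)"
    using wt by (simp add: R_def powr_divide powr_minus field_simps)
  also have "\<dots> = (R powr (1 / 2)) powr k" by (simp add: powr_powr)
  also have "\<dots> = q ^ k" using R q by (simp add: powr_half_sqrt q_def powr_realpow)
  also have "\<dots> = q ^ (k - 1) * q" using k by (cases k) auto
  also have "\<dots> \<le> R ^ (k - 1) * q" using q by (intro mult_right_mono power_mono) auto
  finally have 1: "ln (2 / t) powr - (k / 2) * ln (2 / r) powr (k / 2) \<le> R ^ (k - 1) * q" .
  have ls: "0 \<le> ln (s / t)" "0 \<le> ln (t / r)" "ln (t / r) \<le> ln (s / r)" "0 \<le> ln (s / r)"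
    using rts by (auto simp: divide_right_mono)
  have "ln (s / t) * R \<le> ln (s / r)"
    using log_ratio_le[OF rts] wt by (simp add: R_def field_simps)
  then have 2: "(ln (s / t) * R) ^ (k - 1) \<le> ln (s / r) ^ (k - 1)"
    using ls R by (intro power_mono) auto
  have "ln (s / t) ^ (k - 1) / s * (ln (t / r) ^ (h - 1) / t) * (ln (2 / t) powr - (k / 2) * ln (2 / r) powr (k / 2))
    \<le> ln (s / t) ^ (k - 1) / s * (ln (t / r) ^ (h - 1) / t) * (R ^ (k - 1) * q)"
    using 1 rts ls by (intro mult_left_mono) auto
  also have "\<dots> = (ln (s / t) * R) ^ (k - 1) * ln (t / r) ^ (h - 1) * (q / (s * t))"
    by (simp add: power_mult_distrib)
  also have "\<dots> \<le> ln (s / r) ^ (k - 1) * ln (s / r) ^ (h - 1) * (q / (s * t))"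
    using ls q rts power_mono[OF ls(3,2), of "h - 1"] by (intro mult_right_mono mult_mono[OF 2]) auto
  also have "ln (s / r) ^ (k - 1) * ln (s / r) ^ (h - 1) = ln (s / r) ^ (k + h - 2)"
  proof -
    have "k - 1 + (h - 1) = k + h - 2" using k h by simp
    then show ?thesis unfolding power_add[symmetric] by (rule arg_cong)
  qed
  also have "ln (s / r) ^ (k + h - 2) * (q / (s * t)) = ln (s / r) ^ (k + h - 2) / s * (sqrt (ln (2 / r) / ln (2 / t)) / t)"
    by (simp add: q_def R_def)
  finally show ?thesis .
qed

text \<open>The derivative of \<open>ln (2 / t)\<close> is \<open>- 1 / t\<close>, so the integral
  is \<open>2 * (a - sqrt a * sqrt b)\<close> for the values \<open>a \<ge> b\<close> of
  \<open>ln (2 / t)\<close> at \<open>r\<close> and \<open>s\<close>, and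
  \<open>sqrt a * sqrt b \<ge> b\<close>.\<close>

lemma nn_integral_sqrt_log_ratio:
  assumes "0 < r" "r < s" "s < 1"
  shows "(\<integral>\<^sup>+t. ennreal (sqrt (ln (2 / r) / ln (2 / t)) / t) * indicator {r..s} t \<partial>lborel) \<le> ennreal (2 * ln (s / r))"
proof -
  define F where "F t = - 2 * sqrt (ln (2 / r)) * sqrt (ln (2 / t))" for t
  have "(\<integral>\<^sup>+t. ennreal (sqrt (ln (2 / r) / ln (2 / t)) / t) * indicator {r..s} t \<partial>lborel) = ennreal (F s - F r)"
  proof (rule nn_integral_FTC_Icc)
    fix t assume t: "t \<in> {r..s}"
    then have w: "0 < t" "0 < ln (2 / t)" using assms by auto
    show "(F has_real_derivative sqrt (ln (2 / r) / ln (2 / t)) / t) (at t)"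
      unfolding F_def
      by (rule derivative_eq_intros refl | use w in \<open>simp add: real_sqrt_divide field_simps\<close>)+
    show "0 \<le> sqrt (ln (2 / r) / ln (2 / t)) / t" using w assms by auto
  qed (use assms in auto)
  also have "\<dots> \<le> ennreal (2 * ln (s / r))"
  proof (rule ennreal_leI)
    define a b where "a = ln (2 / r)" and "b = ln (2 / s)"
    have ab: "0 < b" "b \<le> a" using assms by (auto simp: a_def b_def frac_le)
    have "sqrt b * sqrt b \<le> sqrt a * sqrt b" using ab by (intro mult_right_mono) auto
    then have "b \<le> sqrt a * sqrt b" using ab by simp
    moreover have "F s - F r = 2 * a - 2 * (sqrt a * sqrt b)"
      using ab by (simp add: F_def a_def[symmetric] b_def[symmetric])
    moreover have "ln (s / r) = a - b" using assms by (simp add: a_def b_def ln_div)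
    ultimately show "F s - F r \<le> 2 * ln (s / r)" by simp
  qed
  finally show ?thesis .
qed

lemma hardy_ker_wt_integral_le:
  assumes r: "r \<in> space U" and s: "s \<in> space U" and k: "1 \<le> k" and h: "1 \<le> h"
  shows "(\<integral>\<^sup>+t. hardy_ker k s t * (wt (- (k / 2)) t * (hardy_ker h t r * wt (k / 2) r)) \<partial>U) \<le> ennreal 2 * hardy_ker (k + h) s r"
proof (cases "r < s")
  case True
  have rs: "0 < r" "r < s" "s < 1" using r s True by (auto simp: space_U)
  define B where "B = ln (s / r) ^ (k + h - 2) / s"
  have B: "0 \<le> B" using rs by (simp add: B_def)
  have "(\<integral>\<^sup>+t. hardy_ker k s t * (wt (- (k / 2)) t * (hardy_ker h t r * wt (k / 2) r)) \<partial>U) \<le>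
    (\<integral>\<^sup>+t. ennreal B * (ennreal (sqrt (ln (2 / r) / ln (2 / t)) / t) * indicator {r..s} t) \<partial>lborel)"
    unfolding nn_integral_U
  proof (intro nn_integral_mono)
    fix t :: real
    show "hardy_ker k s t * (wt (- (k / 2)) t * (hardy_ker h t r * wt (k / 2) r)) * indicator {0<..<1} t \<le>
      ennreal B * (ennreal (sqrt (ln (2 / r) / ln (2 / t)) / t) * indicator {r..s} t)"
    proof (cases "r < t \<and> t < s")
      case True
      then have t: "0 < t" "t < 1" using rs by auto
      have ls: "0 \<le> ln (s / t)" "0 \<le> ln (t / r)" using True rs t by auto
      have "hardy_ker k s t * (wt (- (k / 2)) t * (hardy_ker h t r * wt (k / 2) r)) =
        ennreal (ln (s / t) ^ (k - 1) / s * (ln (t / r) ^ (h - 1) / t) * (ln (2 / t) powr - (k / 2) * ln (2 / r) powr (k / 2)))"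
        using True rs t ls by (simp add: hardy_ker_def wt_def ennreal_mult[symmetric] mult_ac)
      also have "\<dots> \<le> ennreal (B * (sqrt (ln (2 / r) / ln (2 / t)) / t))"
        unfolding B_def using True rs by (intro ennreal_leI hardy_ker_wt_le k h) auto
      also have "\<dots> = ennreal B * ennreal (sqrt (ln (2 / r) / ln (2 / t)) / t)"
        using B by (rule ennreal_mult')
      finally show ?thesis using True t by simp
    next
      case False
      then have "hardy_ker k s t = 0 \<or> hardy_ker h t r = 0" by (auto simp: hardy_ker_def)
      then show ?thesis by auto
    qed
  qed
  also have "\<dots> = ennreal B * (\<integral>\<^sup>+t. (ennreal (sqrt (ln (2 / r) / ln (2 / t)) / t) * indicator {r..s} t) \<partial>lborel)"
    by (rule nn_integral_cmult) simp
  also have "\<dots> \<le> ennreal B * ennreal (2 * ln (s / r))"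
    by (intro mult_left_mono nn_integral_sqrt_log_ratio rs) simp
  also have "\<dots> = ennreal (2 * (ln (s / r) ^ (k + h - 1) / s))"
  proof -
    have "k + h - 1 = Suc (k + h - 2)" using k h by simp
    then show ?thesis using B rs by (simp add: B_def ennreal_mult[symmetric] mult_ac)
  qed
  also have "\<dots> = ennreal 2 * hardy_ker (k + h) s r"
    using rs by (subst ennreal_mult) (auto simp: hardy_ker_def)
  finally show ?thesis .
next
  case False
  then have "hardy_ker k s t = 0 \<or> hardy_ker h t r = 0" for t by (auto simp: hardy_ker_def)
  then have "hardy_ker k s t * (wt (- (k / 2)) t * (hardy_ker h t r * wt (k / 2) r)) = 0" for t by auto
  then have "(\<integral>\<^sup>+t. hardy_ker k s t * (wt (- (k / 2)) t * (hardy_ker h t r * wt (k / 2) r)) \<partial>U) = (\<integral>\<^sup>+t. 0 \<partial>U)"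
    by (intro nn_integral_cong)
  then show ?thesis by simp
qed

text \<open>Tonelli reduces this to a comparison of kernels. It is the place in the upper estimate
  where the weight crosses both operators.\<close>

lemma hardy_wt_hardy_wt_le:
  assumes G[measurable]: "G \<in> borel_measurable U" and s: "s \<in> space U" and k: "1 \<le> k" and h: "1 \<le> h"
  shows "hardy k (\<lambda>t. wt (- (k / 2)) t * hardy h (\<lambda>r. wt (k / 2) r * G r) t) s \<le> ennreal 2 * hardy (k + h) G s"
proof -
  have "hardy k (\<lambda>t. wt (- (k / 2)) t * hardy h (\<lambda>r. wt (k / 2) r * G r) t) s =
    (\<integral>\<^sup>+t. \<integral>\<^sup>+r. hardy_ker k s t * (wt (- (k / 2)) t * (hardy_ker h t r * (wt (k / 2) r * G r))) \<partial>U \<partial>U)"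
    unfolding hardy_def by (simp add: nn_integral_cmult[symmetric])
  also have "\<dots> = (\<integral>\<^sup>+r. \<integral>\<^sup>+t. hardy_ker k s t * (wt (- (k / 2)) t * (hardy_ker h t r * (wt (k / 2) r * G r))) \<partial>U \<partial>U)"
    by (rule UU.Fubini'[symmetric]) measurable
  also have "\<dots> = (\<integral>\<^sup>+r. (\<integral>\<^sup>+t. hardy_ker k s t * (wt (- (k / 2)) t * (hardy_ker h t r * wt (k / 2) r)) \<partial>U) * G r \<partial>U)"
    by (intro nn_integral_cong) (simp add: nn_integral_multc[symmetric] mult.assoc)
  also have "\<dots> \<le> (\<integral>\<^sup>+r. ennreal 2 * hardy_ker (k + h) s r * G r \<partial>U)"
    by (intro nn_integral_mono mult_right_mono hardy_ker_wt_integral_le s k h) auto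
  also have "\<dots> = ennreal 2 * hardy (k + h) G s"
    unfolding hardy_def by (subst nn_integral_cmult[symmetric]) (auto simp: mult.assoc)
  finally show ?thesis .
qed

text \<open>The substitution \<open>s powr \<theta>\<close> carries the interval from
  \<open>r'\<close> to 1 onto that from \<open>r\<close> to 1 and multiplies both
  \<open>ln (s / r')\<close> and the measure \<open>ds / s\<close> by \<open>\<theta>\<close>, which
  accounts for \<open>k + 1\<close> factors. As \<open>s powr \<theta> \<le> s\<close>, the
  decreasing \<open>f\<close> only gains.\<close>

lemma hardy_adj_scaling:
  assumes f: "dec01 f" and r: "0 < r" "r \<le> r'" "r' < 1"
  defines "\<theta> \<equiv> ln r / ln r'"
  shows "ennreal (\<theta> ^ Suc k) * hardy_adj (Suc k) f r' \<le> hardy_adj (Suc k) f r"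
proof -
  have ln: "ln r \<le> ln r'" "ln r' < 0" using r by auto
  have \<theta>: "1 \<le> \<theta>" unfolding \<theta>_def using ln by (simp add: divide_simps)
  define f0 where "f0 x = f x * indicator {0<..<1} x" for x
  have f0[measurable]: "f0 \<in> borel_measurable borel" unfolding f0_def by (rule dec01_borel[OF f])
  have rpow: "r' powr \<theta> = r" using r ln by (simp add: powr_def \<theta>_def)
  have "hardy_adj (Suc k) f r = (\<integral>\<^sup>+s. hardy_ker (Suc k) s r * f0 s * indicator {r' powr \<theta>..1 powr \<theta>} s \<partial>lborel)"
    unfolding hardy_adj_def nn_integral_U using r
    by (intro nn_integral_cong) (auto simp: rpow f0_def hardy_ker_def indicator_def)
  also have "\<dots> = (\<integral>\<^sup>+s. hardy_ker (Suc k) (s powr \<theta>) r * f0 (s powr \<theta>) * ennreal (\<theta> * s powr (\<theta> - 1)) * indicator {r'..1} s \<partial>lborel)"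
  proof (rule nn_integral_substitution_aux)
    show "((\<lambda>s. s powr \<theta>) has_real_derivative \<theta> * s powr (\<theta> - 1)) (at s)" if "s \<in> {r'..1}" for s
      using that r by (auto intro!: derivative_eq_intros)
    show "continuous_on {r'..1} (\<lambda>s. \<theta> * s powr (\<theta> - 1))"
      using r by (intro continuous_intros) auto
  qed (use \<theta> r in auto)
  also have "\<dots> \<ge> (\<integral>\<^sup>+s. ennreal (\<theta> ^ Suc k) * (hardy_ker (Suc k) s r' * f0 s) \<partial>lborel)"
  proof (intro nn_integral_mono)
    fix s :: real
    show "ennreal (\<theta> ^ Suc k) * (hardy_ker (Suc k) s r' * f0 s) \<le>
      hardy_ker (Suc k) (s powr \<theta>) r * f0 (s powr \<theta>) * ennreal (\<theta> * s powr (\<theta> - 1)) * indicator {r'..1} s"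
    proof (cases "r' < s \<and> s < 1")
      case True
      then have s: "0 < s" "s < 1" using r by auto
      have sp: "s powr \<theta> \<le> s powr 1" using s \<theta> by (intro powr_mono') auto
      then have sp: "0 < s powr \<theta>" "s powr \<theta> \<le> s" using s by auto
      have "r < s powr \<theta>"
        unfolding rpow[symmetric] using True r \<theta> by (intro powr_less_mono2) auto
      then have "hardy_ker (Suc k) (s powr \<theta>) r = ennreal (ln (s powr \<theta> / r' powr \<theta>) ^ k / s powr \<theta>)"
        using r by (simp add: hardy_ker_def rpow)
      also have "s powr \<theta> / r' powr \<theta> = (s / r') powr \<theta>" using s r by (simp add: powr_divide)
      also have "ln ((s / r') powr \<theta>) = \<theta> * ln (s / r')" using s r by (simp add: ln_powr)
      finally have "hardy_ker (Suc k) (s powr \<theta>) r * ennreal (\<theta> * s powr (\<theta> - 1)) =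
        ennreal ((\<theta> * ln (s / r')) ^ k / s powr \<theta> * (\<theta> * s powr (\<theta> - 1)))"
        using \<theta> s True r by (subst ennreal_mult) auto
      also have "(\<theta> * ln (s / r')) ^ k / s powr \<theta> * (\<theta> * s powr (\<theta> - 1)) = \<theta> ^ Suc k * (ln (s / r') ^ k / s)"
        using s by (simp add: powr_diff power_mult_distrib)
      also have "ennreal (\<theta> ^ Suc k * (ln (s / r') ^ k / s)) = ennreal (\<theta> ^ Suc k) * hardy_ker (Suc k) s r'"
        using \<theta> True r s by (subst ennreal_mult) (auto simp: hardy_ker_def)
      finally have eq: "hardy_ker (Suc k) (s powr \<theta>) r * ennreal (\<theta> * s powr (\<theta> - 1)) = ennreal (\<theta> ^ Suc k) * hardy_ker (Suc k) s r'" .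
      have "f0 s = f s" "f0 (s powr \<theta>) = f (s powr \<theta>)"
        unfolding f0_def using s(1,2) sp(1) le_less_trans[OF sp(2) s(2)] by simp_all
      then have "f0 s \<le> f0 (s powr \<theta>)"
        using dec01D[OF f sp(1,2) s(2)] by simp
      then have "ennreal (\<theta> ^ Suc k) * hardy_ker (Suc k) s r' * f0 s \<le> hardy_ker (Suc k) (s powr \<theta>) r * ennreal (\<theta> * s powr (\<theta> - 1)) * f0 (s powr \<theta>)"
        unfolding eq by (rule mult_left_mono) simp
      then show ?thesis using True by (simp add: mult_ac)
    next
      case False
      then have "hardy_ker (Suc k) s r' * f0 s = 0" by (auto simp: hardy_ker_def f0_def)
      then show ?thesis by (simp only: mult_zero_right zero_le)
    qed
  qed
  also have "(\<integral>\<^sup>+s. ennreal (\<theta> ^ Suc k) * (hardy_ker (Suc k) s r' * f0 s) \<partial>lborel) = ennreal (\<theta> ^ Suc k) * (\<integral>\<^sup>+s. hardy_ker (Suc k) s r' * f0 s \<partial>lborel)"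
    by (rule nn_integral_cmult) simp
  also have "(\<integral>\<^sup>+s. hardy_ker (Suc k) s r' * f0 s \<partial>lborel) = hardy_adj (Suc k) f r'"
    unfolding hardy_adj_def nn_integral_U f0_def by (simp add: mult.assoc)
  finally show ?thesis .
qed

text \<open>From \<open>r'\<close> to \<open>r\<close> the adjoint grows at least by
  \<open>\<theta> ^ k\<close>, while \<open>ln (2 / r) \<le> \<theta> * ln (2 / r')\<close> shows
  that the weight shrinks at most by \<open>\<theta> powr - (k / 2)\<close>. This makes the product
  a decreasing test function for \<open>XG_norm k X\<close>.\<close>

lemma dec01_wt_hardy_adj:
  assumes f: "dec01 f" and k: "1 \<le> k"
  shows "dec01 (\<lambda>r. wt (- (k / 2)) r * hardy_adj k f r)"
  unfolding dec01_def
proof (intro allI impI)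
  fix r r' :: real assume r: "0 < r" "r \<le> r'" "r' < 1"
  define \<theta> where "\<theta> = ln r / ln r'"
  have ln: "ln r \<le> ln r'" "ln r' < 0" using r by auto
  have \<theta>: "1 \<le> \<theta>" unfolding \<theta>_def using ln by (simp add: divide_simps)
  have w: "0 < ln (2 / r)" "0 < ln (2 / r')" using r by auto
  have "ln (2 / r) = ln 2 - \<theta> * ln r'" using r ln by (simp add: \<theta>_def ln_div)
  also have "\<dots> \<le> \<theta> * ln 2 - \<theta> * ln r'" using mult_right_mono[OF \<theta>, of "ln 2"] by simp
  also have "\<dots> = \<theta> * ln (2 / r')" using r by (simp add: ln_div algebra_simps)
  finally have le: "ln (2 / r) \<le> \<theta> * ln (2 / r')" .
  have "ln (2 / r') powr - (k / 2) \<le> ln (2 / r') powr - (k / 2) * \<theta> powr (k / 2)"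
    using \<theta> by (simp add: ge_one_powr_ge_zero mult_le_cancel_left1)
  also have "\<theta> powr (k / 2) = \<theta> powr - (k / 2) * \<theta> ^ k"
    using \<theta> by (simp add: powr_realpow[symmetric] powr_add[symmetric])
  also have "ln (2 / r') powr - (k / 2) * (\<theta> powr - (k / 2) * \<theta> ^ k) = (\<theta> * ln (2 / r')) powr - (k / 2) * \<theta> ^ k"
    using \<theta> w by (simp add: powr_mult)
  also have "\<dots> \<le> ln (2 / r) powr - (k / 2) * \<theta> ^ k"
    using le w \<theta> by (intro mult_right_mono powr_mono2') auto
  finally have "wt (- (k / 2)) r' \<le> wt (- (k / 2)) r * ennreal (\<theta> ^ k)"
    using \<theta> by (simp add: wt_def ennreal_mult[symmetric] ennreal_leI)
  then have "wt (- (k / 2)) r' * hardy_adj k f r' \<le> wt (- (k / 2)) r * ennreal (\<theta> ^ k) * hardy_adj k f r'"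
    by (rule mult_right_mono) simp
  also have "\<dots> \<le> wt (- (k / 2)) r * hardy_adj k f r"
    using hardy_adj_scaling[OF f r, of "k - 1"] k by (simp add: mult.assoc \<theta>_def mult_left_mono)
  finally show "wt (- (k / 2)) r' * hardy_adj k f r' \<le> wt (- (k / 2)) r * hardy_adj k f r" .
qed

text \<open>The inequality \<open>0 \<le> (a - b) * (c - d)\<close>, rearranged to avoid subtraction
  in \<open>ennreal\<close>.\<close>

lemma chebyshev_ennreal:
  fixes a b c d :: ennreal
  assumes "b \<le> a" "d \<le> c"
  shows "a * d + b * c \<le> a * c + b * d"
proof -
  obtain x where x: "a = b + x" using assms(1) by (auto simp: le_iff_add)
  have "a * d + b * c = b * d + x * d + b * c" by (simp add: x distrib_right)
  also have "\<dots> \<le> b * d + x * c + b * c" by (intro add_mono mult_left_mono assms(2)) auto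
  also have "\<dots> = a * c + b * d" by (simp add: x distrib_right add_ac)
  finally show ?thesis .
qed

lemma emeasure_U_interval: "0 < t \<Longrightarrow> t \<le> 1 \<Longrightarrow> emeasure U {t / 2<..<t} = ennreal (t / 2)"
  by (subst emeasure_restrict_space) auto

lemma sets_U_interval: "0 < t \<Longrightarrow> t \<le> 1 \<Longrightarrow> {t / 2<..<t} \<in> sets U"
  by (auto simp: sets_restrict_space_iff space_U)

section \<open>A decreasing dyadic majorant\<close>

context
  fixes \<psi> :: "real \<Rightarrow> ennreal" and a :: real
begin

definition eta :: "real \<Rightarrow> ennreal" where
  "eta s = wt (- a) s * \<psi> s"

text \<open>
  \<open>dyadic_maj \<psi> a\<close> is a decreasing majorant of \<open>eta \<psi> a\<close> up to the factor \<open>2 powr a\<close>. The dyadic supremum makes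
  all level sets of positive measure, so that one can average over them.
\<close>
definition dyadic_sup :: "real \<Rightarrow> ennreal" where
  "dyadic_sup s = (SUP i\<in>{i. 1 \<le> i \<and> s \<le> (1 / 2) ^ i}. eta ((1 / 2) ^ i))"

text \<open>The shift to \<open>s / 2\<close> lets the supremum include the largest dyadic point not
  above \<open>s\<close>; there \<open>\<psi>\<close> is at least \<open>\<psi> s\<close>, which the
  points above \<open>s\<close> would not guarantee.\<close>

definition dyadic_maj :: "real \<Rightarrow> ennreal" where
  "dyadic_maj s = dyadic_sup (s / 2)"

text \<open>The factor \<open>2 powr a\<close> is the loss in \<open>eta_doubling\<close>; the other
  2 compares the length \<open>t\<close> with that of the block from \<open>t / 2\<close> to
  \<open>t\<close>.\<close>

definition dbl_const :: real where "dbl_const = 2 * 2 powr a"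

definition level_of :: "real \<Rightarrow> real set" where
  "level_of s = {t \<in> space U. dyadic_sup t = dyadic_sup s}"

text \<open>Kernel of the conditional expectation given \<open>dyadic_sup\<close>. It is symmetric,
  so averaging is self-adjoint and can be moved from one factor of an integral to the other.\<close>

definition level_ker :: "real \<Rightarrow> real \<Rightarrow> ennreal" where
  "level_ker s t = (if dyadic_sup t = dyadic_sup s then inverse (emeasure U (level_of s)) else 0)"

definition level_avg :: "(real \<Rightarrow> ennreal) \<Rightarrow> real \<Rightarrow> ennreal" where
  "level_avg f s = (\<integral>\<^sup>+t. level_ker s t * f t \<partial>U)"

lemma dbl_const_pos: "0 < dbl_const" by (simp add: dbl_const_def)

context
  assumes \<psi>: "dec01 \<psi>" and a: "0 \<le> a"
begin

lemma eta_measurable [measurable]: "eta \<in> borel_measurable U"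
proof -
  note [measurable] = dec01_measurable[OF \<psi>]
  show ?thesis unfolding eta_def[abs_def] by measurable
qed

lemma antimono_dyadic_sup: "x \<le> y \<Longrightarrow> dyadic_sup y \<le> dyadic_sup x"
  unfolding dyadic_sup_def by (intro SUP_subset_mono) auto

lemma dec01_dyadic_sup: "dec01 dyadic_sup" and dec01_dyadic_maj: "dec01 dyadic_maj"
  by (auto simp: dec01_def dyadic_maj_def intro: antimono_dyadic_sup)

lemma dyadic_sup_upper: "1 \<le> i \<Longrightarrow> s \<le> (1 / 2) ^ i \<Longrightarrow> eta ((1 / 2) ^ i) \<le> dyadic_sup s"
  unfolding dyadic_sup_def by (intro SUP_upper) auto

text \<open>\<open>\<psi>\<close> is larger at \<open>u\<close>, and the weight loses at most
  \<open>2 powr a\<close>: from \<open>t * t \<le> 2 * u\<close> follows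
  \<open>ln (2 / u) \<le> 2 * ln (2 / t)\<close>.\<close>

lemma eta_doubling:
  assumes "0 < t" "t / 2 \<le> u" "u \<le> t" "t < 1"
  shows "eta t \<le> ennreal (2 powr a) * eta u"
proof -
  have w: "0 < ln (2 / t)" "0 < ln (2 / u)" using assms by auto
  have "t * t \<le> 2 * u" using mult_left_mono[of t 1 t] assms by linarith
  then have "ln (2 / u) \<le> ln ((2 / t) ^ 2)"
    using assms by (subst ln_le_cancel_iff) (auto simp: field_simps power2_eq_square)
  also have "\<dots> = 2 * ln (2 / t)" using assms by (subst ln_realpow) auto
  finally have "(2 * ln (2 / t)) powr (- a) \<le> ln (2 / u) powr (- a)"
    using w a by (intro powr_mono2') auto
  then have "2 powr a * (2 * ln (2 / t)) powr (- a) \<le> 2 powr a * ln (2 / u) powr (- a)"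
    by (rule mult_left_mono) simp
  also have "2 powr a * (2 * ln (2 / t)) powr (- a) = ln (2 / t) powr (- a)"
    using w by (simp add: powr_mult powr_minus)
  finally have "wt (- a) t \<le> ennreal (2 powr a) * wt (- a) u"
    by (simp add: wt_def ennreal_mult[symmetric] ennreal_leI)
  then show ?thesis
    unfolding eta_def mult.assoc[symmetric] using assms by (intro mult_mono dec01D[OF \<psi>]) auto
qed

lemma eta_le_dyadic_maj:
  assumes s: "s \<in> space U"
  shows "eta s \<le> ennreal (2 powr a) * dyadic_maj s"
proof -
  have s01: "0 < s" "s < 1" using s by (auto simp: space_U)
  define i where "i = (LEAST i. (1 / 2 :: real) ^ i \<le> s)"
  have ex: "\<exists>i. (1 / 2 :: real) ^ i \<le> s" using real_arch_pow_inv[of s "1/2"] s01 by (auto intro: less_imp_le)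
  have i: "(1 / 2) ^ i \<le> s" unfolding i_def by (rule LeastI_ex[OF ex])
  have i0: "i \<noteq> 0" using i s01 by (cases i) auto
  then have "\<not> (1 / 2) ^ (i - 1) \<le> s" unfolding i_def by (intro not_less_Least) auto
  then have lt: "s / 2 \<le> (1 / 2) ^ i" using i0 by (cases i) auto
  have "wt (- a) s \<le> ennreal (2 powr a) * wt (- a) ((1 / 2) ^ i)"
  proof -
    have "ln (2 / (1 / 2) ^ i) \<le> ln ((2 / s) ^ 2)"
    proof (subst ln_le_cancel_iff)
      have "2 / (1 / 2) ^ i \<le> 2 / (s / 2)" using lt s01 by (intro divide_left_mono) auto
      also have "\<dots> = 4 / s" by simp
      also have "\<dots> \<le> (2 / s) ^ 2" using s01 by (simp add: field_simps power2_eq_square)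
      finally show "2 / (1 / 2) ^ i \<le> (2 / s) ^ 2" .
    qed (use s01 in auto)
    also have "\<dots> = 2 * ln (2 / s)" using s01 by (subst ln_realpow) auto
    finally have le: "ln (2 / (1 / 2) ^ i) \<le> 2 * ln (2 / s)" .
    have pos: "0 < ln (2 / (1 / 2 :: real) ^ i)"
    proof (rule ln_gt_zero)
      have "(1 / 2 :: real) ^ i \<le> 1" by (simp add: power_le_one)
      then show "1 < 2 / (1 / 2 :: real) ^ i" by (subst less_divide_eq_1_pos) auto
    qed
    have "(2 * ln (2 / s)) powr (- a) \<le> ln (2 / (1 / 2) ^ i) powr (- a)"
      using le pos a by (intro powr_mono2') auto
    then have "2 powr a * (2 * ln (2 / s)) powr (- a) \<le> 2 powr a * ln (2 / (1 / 2) ^ i) powr (- a)"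
      by (rule mult_left_mono) simp
    also have "2 powr a * (2 * ln (2 / s)) powr (- a) = ln (2 / s) powr (- a)"
      using s01 by (simp add: powr_mult powr_minus)
    finally show ?thesis by (simp add: wt_def ennreal_mult[symmetric] ennreal_leI)
  qed
  moreover have "\<psi> s \<le> \<psi> ((1 / 2) ^ i)" using i s01 by (intro dec01D[OF \<psi>]) auto
  ultimately have "eta s \<le> ennreal (2 powr a) * eta ((1 / 2) ^ i)"
    unfolding eta_def mult.assoc[symmetric] by (intro mult_mono) auto
  also have "\<dots> \<le> ennreal (2 powr a) * dyadic_maj s"
    unfolding dyadic_maj_def using i0 lt by (intro mult_left_mono dyadic_sup_upper) auto
  finally show ?thesis .
qed

lemma eta_block:
  assumes t: "0 < t" "t < 1"
  shows "eta t * ennreal (t / 2) \<le> ennreal (2 powr a) * (\<integral>\<^sup>+u. indicator {t / 2<..<t} u * eta u \<partial>U)"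
proof -
  have [measurable]: "{t / 2<..<t} \<in> sets U" using t by (intro sets_U_interval) auto
  have "eta t * ennreal (t / 2) = (\<integral>\<^sup>+u. eta t * indicator {t / 2<..<t} u \<partial>U)"
    using t by (subst nn_integral_cmult_indicator) (auto simp: emeasure_U_interval)
  also have "\<dots> \<le> (\<integral>\<^sup>+u. ennreal (2 powr a) * (indicator {t / 2<..<t} u * eta u) \<partial>U)"
    using t by (intro nn_integral_mono) (auto simp: indicator_def intro: eta_doubling)
  also have "\<dots> = ennreal (2 powr a) * (\<integral>\<^sup>+u. indicator {t / 2<..<t} u * eta u \<partial>U)"
    by (rule nn_integral_cmult) measurable
  finally show ?thesis .
qed

lemma eta_block':
  assumes t: "0 < t" "t < 1"
  shows "eta t \<le> ennreal dbl_const * (\<integral>\<^sup>+u. indicator {t / 2<..<t} u * (ennreal (1 / t) * eta u) \<partial>U)"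
proof -
  have [measurable]: "{t / 2<..<t} \<in> sets U" using t by (intro sets_U_interval) auto
  have "eta t * ennreal (t / 2) * ennreal (2 / t) \<le> ennreal (2 powr a) * (\<integral>\<^sup>+u. indicator {t / 2<..<t} u * eta u \<partial>U) * ennreal (2 / t)"
    by (intro mult_right_mono eta_block t) auto
  also have "eta t * ennreal (t / 2) * ennreal (2 / t) = eta t"
    using t by (simp add: mult.assoc ennreal_mult[symmetric])
  also have "ennreal (2 powr a) * (\<integral>\<^sup>+u. indicator {t / 2<..<t} u * eta u \<partial>U) * ennreal (2 / t) =
    ennreal dbl_const * (ennreal (1 / t) * (\<integral>\<^sup>+u. indicator {t / 2<..<t} u * eta u \<partial>U))"
  proof -
    have "ennreal (2 powr a) * ennreal (2 / t) = ennreal dbl_const * ennreal (1 / t)"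
      using t by (simp add: dbl_const_def ennreal_mult[symmetric] mult.commute)
    then show ?thesis by (rule ennreal_mult_rearrange)
  qed
  also have "ennreal (1 / t) * (\<integral>\<^sup>+u. indicator {t / 2<..<t} u * eta u \<partial>U) = (\<integral>\<^sup>+u. ennreal (1 / t) * (indicator {t / 2<..<t} u * eta u) \<partial>U)"
    by (rule nn_integral_cmult[symmetric]) measurable
  finally show ?thesis by (simp add: mult.left_commute)
qed

lemma eta_le_hardy1:
  assumes s: "s \<in> space U"
  shows "eta s \<le> ennreal dbl_const * hardy 1 eta s"
proof -
  have s01: "0 < s" "s < 1" using s by (auto simp: space_U)
  have "(\<integral>\<^sup>+u. indicator {s / 2<..<s} u * (ennreal (1 / s) * eta u) \<partial>U) \<le> hardy 1 eta s"
    unfolding hardy_def using s01 by (intro nn_integral_mono) (auto simp: indicator_def hardy_ker_def)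
  then show ?thesis
    using eta_block'[OF s01] by (meson mult_left_mono order_trans zero_le)
qed

lemma dyadic_maj_local:
  assumes rs: "0 < r" "r < s" "s < 1"
  shows "dyadic_maj r \<le> dyadic_maj s + ennreal dbl_const * (\<integral>\<^sup>+u. indicator {r / 4<..<s} u * (ennreal (1 / u) * eta u) \<partial>U)"
  unfolding dyadic_maj_def dyadic_sup_def[of "r / 2"]
proof (rule SUP_least)
  fix i :: nat assume "i \<in> {i. 1 \<le> i \<and> r / 2 \<le> (1 / 2) ^ i}"
  then have i: "1 \<le> i" "r / 2 \<le> (1 / 2) ^ i" by auto
  define t where "t = (1 / 2 :: real) ^ i"
  have t: "0 < t" "t < 1" using i by (auto simp: t_def power_less_one_iff)
  show "eta ((1 / 2) ^ i) \<le> dyadic_sup (s / 2) + ennreal dbl_const * (\<integral>\<^sup>+u. indicator {r / 4<..<s} u * (ennreal (1 / u) * eta u) \<partial>U)"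
  proof (cases "s / 2 \<le> t")
    case True
    then have "eta ((1 / 2) ^ i) \<le> dyadic_sup (s / 2)" using i by (intro dyadic_sup_upper) (auto simp: t_def)
    then show ?thesis by (simp add: add_increasing2)
  next
    case False
    have "eta t \<le> ennreal dbl_const * (\<integral>\<^sup>+u. indicator {t / 2<..<t} u * (ennreal (1 / t) * eta u) \<partial>U)"
      by (rule eta_block'[OF t])
    also have "\<dots> \<le> ennreal dbl_const * (\<integral>\<^sup>+u. indicator {r / 4<..<s} u * (ennreal (1 / u) * eta u) \<partial>U)"
      using t i False rs
      by (intro mult_left_mono nn_integral_mono)
        (auto simp: indicator_def t_def[symmetric] intro!: mult_right_mono ennreal_leI divide_left_mono)
    finally show ?thesis by (simp add: t_def add_increasing)
  qed
qed

text \<open>\<open>dyadic_maj_local\<close> is averaged over \<open>r < s\<close>. After Tonelli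
  each \<open>u\<close> collects the \<open>r\<close> below \<open>4 * u\<close>, whose measure
  cancels \<open>1 / u\<close> and leaves the factor 4.\<close>

lemma hardy1_dyadic_maj:
  assumes s: "s \<in> space U"
  shows "hardy 1 dyadic_maj s \<le> dyadic_maj s + ennreal (4 * dbl_const) * hardy 1 eta s"
proof -
  have s01: "0 < s" "s < 1" using s by (auto simp: space_U)
  define J where "J r = (\<integral>\<^sup>+u. indicator {r / 4<..<s} u * (ennreal (1 / u) * eta u) \<partial>U)" for r
  have mJ[measurable]: "(\<lambda>x. indicator {fst x / 4<..<s} (snd x) :: ennreal) \<in> borel_measurable (U \<Otimes>\<^sub>M U)"
  proof -
    have "(\<lambda>x. indicator {fst x / 4<..<s} (snd x) :: ennreal) = (\<lambda>x. if fst x / 4 < snd x \<and> snd x < s then 1 else 0)"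
      by (auto simp: indicator_def)
    moreover have "(\<lambda>x. if fst x / 4 < snd x \<and> snd x < s then 1 else 0 :: ennreal) \<in> borel_measurable (U \<Otimes>\<^sub>M U)"
      by measurable
    ultimately show ?thesis by simp
  qed
  have J[measurable]: "J \<in> borel_measurable U"
  proof -
    have "(\<lambda>r. \<integral>\<^sup>+u. (case (r, u) of (r, u) \<Rightarrow> indicator {fst (r, u) / 4<..<s} (snd (r, u)) * (ennreal (1 / u) * eta u)) \<partial>U) \<in> borel_measurable U"
      by measurable
    then show ?thesis by (simp add: J_def[abs_def])
  qed
  have KJ: "(\<integral>\<^sup>+r. hardy_ker 1 s r * J r \<partial>U) \<le> ennreal 4 * hardy 1 eta s"
  proof -
    have "(\<integral>\<^sup>+r. hardy_ker 1 s r * J r \<partial>U) = (\<integral>\<^sup>+r. \<integral>\<^sup>+u. hardy_ker 1 s r * (indicator {fst (r, u) / 4<..<s} (snd (r, u)) * (ennreal (1 / u) * eta u)) \<partial>U \<partial>U)"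
      unfolding J_def by (intro nn_integral_cong) (simp add: nn_integral_cmult[symmetric])
    also have "\<dots> = (\<integral>\<^sup>+u. \<integral>\<^sup>+r. hardy_ker 1 s r * (indicator {fst (r, u) / 4<..<s} (snd (r, u)) * (ennreal (1 / u) * eta u)) \<partial>U \<partial>U)"
      by (rule UU.Fubini'[symmetric]) measurable
    also have "\<dots> \<le> (\<integral>\<^sup>+u. ennreal 4 * (hardy_ker 1 s u * eta u) \<partial>U)"
    proof (intro nn_integral_mono)
      fix u assume u: "u \<in> space U"
      then have u01: "0 < u" "u < 1" by (auto simp: space_U)
      show "(\<integral>\<^sup>+r. hardy_ker 1 s r * (indicator {fst (r, u) / 4<..<s} (snd (r, u)) * (ennreal (1 / u) * eta u)) \<partial>U) \<le> ennreal 4 * (hardy_ker 1 s u * eta u)"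
      proof (cases "u < s")
        case True
        have em: "emeasure U {r \<in> space U. r < 4 * u} \<le> ennreal (4 * u)"
        proof -
          have "emeasure U {r \<in> space U. r < 4 * u} = emeasure lebesgue {r \<in> space U. r < 4 * u}"
          proof (rule emeasure_restrict_space)
            show "{r \<in> space U. r < 4 * u} \<subseteq> {0<..<1}" by (auto simp: space_U)
          qed simp
          also have "\<dots> \<le> emeasure lebesgue {0<..<4 * u}"
            by (intro emeasure_mono) (auto simp: space_U)
          also have "\<dots> = ennreal (4 * u)" using u01 by simp
          finally show ?thesis .
        qed
        have "(\<integral>\<^sup>+r. hardy_ker 1 s r * (indicator {fst (r, u) / 4<..<s} (snd (r, u)) * (ennreal (1 / u) * eta u)) \<partial>U) \<le>
          (\<integral>\<^sup>+r. ennreal (1 / s) * (ennreal (1 / u) * eta u) * indicator {r \<in> space U. r < 4 * u} r \<partial>U)"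
          using s01 by (intro nn_integral_mono) (auto simp: indicator_def hardy_ker_def)
        also have "\<dots> = ennreal (1 / s) * (ennreal (1 / u) * eta u) * emeasure U {r \<in> space U. r < 4 * u}"
          by (rule nn_integral_cmult_indicator) measurable
        also have "\<dots> \<le> ennreal (1 / s) * (ennreal (1 / u) * eta u) * ennreal (4 * u)"
          by (rule mult_left_mono[OF em]) simp
        also have "\<dots> = ennreal 4 * (hardy_ker 1 s u * eta u)"
        proof -
          have "ennreal (1 / s) * ennreal (1 / u) * ennreal (4 * u) = ennreal (4 * (1 / s))"
            using u01 s01 by (simp add: ennreal_mult[symmetric])
          also have "\<dots> = ennreal 4 * hardy_ker 1 s u" using True u01 s01 by (subst ennreal_mult) (auto simp: hardy_ker_def)
          finally have "ennreal (1 / s) * ennreal (1 / u) * ennreal (4 * u) = ennreal 4 * hardy_ker 1 s u" .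
          then have "ennreal (1 / s) * ennreal (1 / u) * eta u * ennreal (4 * u) = ennreal 4 * (hardy_ker 1 s u * eta u)"
            by (rule ennreal_mult_rearrange)
          then show ?thesis by (simp only: mult.assoc)
        qed
        finally show ?thesis .
      next
        case False
        then have "hardy_ker 1 s r * (indicator {fst (r, u) / 4<..<s} (snd (r, u)) * (ennreal (1 / u) * eta u)) = 0" for r by auto
        then have "(\<integral>\<^sup>+r. hardy_ker 1 s r * (indicator {fst (r, u) / 4<..<s} (snd (r, u)) * (ennreal (1 / u) * eta u)) \<partial>U) = (\<integral>\<^sup>+r. 0 \<partial>U)"
          by (intro nn_integral_cong)
        then show ?thesis by simp
      qed
    qed
    also have "\<dots> = ennreal 4 * hardy 1 eta s"
      unfolding hardy_def by (rule nn_integral_cmult) measurable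
    finally show ?thesis .
  qed
  have "hardy 1 dyadic_maj s \<le> (\<integral>\<^sup>+r. hardy_ker 1 s r * (dyadic_maj s + ennreal dbl_const * J r) \<partial>U)"
    unfolding hardy_def
  proof (intro nn_integral_mono)
    fix r assume "r \<in> space U"
    then show "hardy_ker 1 s r * dyadic_maj r \<le> hardy_ker 1 s r * (dyadic_maj s + ennreal dbl_const * J r)"
      using dyadic_maj_local[of r s] s01 unfolding J_def by (cases "r < s") (auto simp: space_U hardy_ker_def intro: mult_left_mono)
  qed
  also have "\<dots> = (\<integral>\<^sup>+r. dyadic_maj s * (hardy_ker 1 s r * 1) + ennreal dbl_const * (hardy_ker 1 s r * J r) \<partial>U)"
    by (simp add: distrib_left mult_ac)
  also have "\<dots> = dyadic_maj s * hardy 1 (\<lambda>_. 1) s + ennreal dbl_const * (\<integral>\<^sup>+r. hardy_ker 1 s r * J r \<partial>U)"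
    unfolding hardy_def by (simp add: nn_integral_add nn_integral_cmult)
  also have "\<dots> \<le> dyadic_maj s * 1 + ennreal dbl_const * (ennreal 4 * hardy 1 eta s)"
    unfolding hardy1_one[OF s] by (intro add_mono mult_left_mono KJ) auto
  also have "\<dots> = dyadic_maj s + ennreal (4 * dbl_const) * hardy 1 eta s"
    using dbl_const_pos by (simp add: mult.assoc[symmetric] ennreal_mult[symmetric] mult.commute flip: ennreal_numeral)
  finally show ?thesis .
qed

text \<open>For positive \<open>t\<close> only finitely many exponents compete, and 1 is among them
  as \<open>t \<le> 1 / 2\<close>.\<close>

lemma dyadic_sup_attained:
  assumes t: "0 < t" "t \<le> 1 / 2"
  shows "\<exists>j\<ge>1. t \<le> (1 / 2) ^ j \<and> dyadic_sup t = eta ((1 / 2) ^ j)"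
proof -
  define I where "I = {i::nat. 1 \<le> i \<and> t \<le> (1 / 2) ^ i}"
  obtain n where n: "(1 / 2) ^ n < t" using real_arch_pow_inv[of t "1/2"] t by auto
  have "I \<subseteq> {..n}"
  proof
    fix i assume i: "i \<in> I"
    have "\<not> n < i"
    proof
      assume "n < i"
      then have "(1 / 2 :: real) ^ i \<le> (1 / 2) ^ n" by (intro power_decreasing) auto
      moreover have "t \<le> (1 / 2) ^ i" using i by (simp add: I_def)
      ultimately show False using n by linarith
    qed
    then show "i \<in> {..n}" by simp
  qed
  then have fin: "finite ((\<lambda>i. eta ((1 / 2) ^ i)) ` I)" by (auto intro: finite_subset)
  have "1 \<in> I" using t by (simp add: I_def)
  then have ne: "(\<lambda>i. eta ((1 / 2) ^ i)) ` I \<noteq> {}" by auto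
  have "dyadic_sup t = Sup ((\<lambda>i. eta ((1 / 2) ^ i)) ` I)" unfolding dyadic_sup_def I_def ..
  also have "\<dots> = Max ((\<lambda>i. eta ((1 / 2) ^ i)) ` I)" by (rule Max_Sup[symmetric, OF fin ne])
  also have "\<dots> \<in> (\<lambda>i. eta ((1 / 2) ^ i)) ` I" by (rule Max_in[OF fin ne])
  finally show ?thesis by (auto simp: I_def)
qed

lemma dyadic_sup_eq_0:
  assumes "1 / 2 < t"
  shows "dyadic_sup t = 0"
proof -
  have "{i::nat. 1 \<le> i \<and> t \<le> (1 / 2) ^ i} = {}"
  proof (rule ccontr)
    assume "{i::nat. 1 \<le> i \<and> t \<le> (1 / 2) ^ i} \<noteq> {}"
    then obtain i :: nat where i: "1 \<le> i" "t \<le> (1 / 2) ^ i" by auto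
    have "(1 / 2 :: real) ^ i \<le> (1 / 2) ^ 1" using i by (intro power_decreasing) auto
    then show False using i assms by simp
  qed
  then show ?thesis unfolding dyadic_sup_def by (simp only: image_empty Sup_empty bot_ennreal)
qed

section \<open>Averages over the level sets\<close>

lemma dyadic_sup_measurable [measurable]: "dyadic_sup \<in> borel_measurable U"
  by (rule dec01_measurable[OF dec01_dyadic_sup])

lemma level_of_sets [measurable]: "level_of s \<in> sets U"
  unfolding level_of_def by measurable

lemma level_of_eq: "dyadic_sup s = dyadic_sup t \<Longrightarrow> level_of s = level_of t"
  by (simp add: level_of_def)

text \<open>For \<open>s > 1 / 2\<close> the supremum is over the empty set and equals 0. Otherwise
  let \<open>T\<close> be the largest dyadic point at which it is attained. The level set contains
  the block from \<open>T / 2\<close> to \<open>T\<close>, hence has positive measure, and at a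
  nonzero level it lies between 0 and \<open>T\<close>. Its measure is therefore comparable to that
  of the block, to which \<open>eta_block\<close> applies.\<close>

lemma level_of_props:
  assumes s: "s \<in> space U"
  shows "emeasure U (level_of s) \<noteq> 0"
    and "dyadic_sup s * emeasure U (level_of s) \<le> ennreal (dbl_const) * (\<integral>\<^sup>+u. indicator (level_of s) u * eta u \<partial>U)"
proof -
  have s01: "0 < s" "s < 1" using s by (auto simp: space_U)
  have "emeasure U (level_of s) \<noteq> 0 \<and> dyadic_sup s * emeasure U (level_of s) \<le> ennreal (dbl_const) * (\<integral>\<^sup>+u. indicator (level_of s) u * eta u \<partial>U)"
  proof (cases "1 / 2 < s")
    case True
    then have "{1 / 2<..<1} \<subseteq> level_of s" unfolding level_of_def by (auto simp: dyadic_sup_eq_0 space_U)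
    then have "emeasure U {1 / 2<..<1} \<le> emeasure U (level_of s)" by (intro emeasure_mono) auto
    moreover have "emeasure U {1 / 2<..<1} = ennreal (1 / 2)" using emeasure_U_interval[of 1] by simp
    ultimately show ?thesis using True by (auto simp: dyadic_sup_eq_0)
  next
    case False
    define P where "P i \<longleftrightarrow> 1 \<le> i \<and> s \<le> (1 / 2) ^ i \<and> dyadic_sup s = eta ((1 / 2) ^ i)" for i :: nat
    define i where "i = (LEAST i. P i)"
    have "\<exists>i. P i" using dyadic_sup_attained[of s] s01 False by (auto simp: P_def)
    then have Pi: "P i" unfolding i_def by (rule LeastI_ex)
    have least: "\<not> P j" if "j < i" for j using that unfolding i_def by (rule not_less_Least)
    define T where "T = (1 / 2 :: real) ^ i"
    have T: "0 < T" "T \<le> 1 / 2" "s \<le> T" "dyadic_sup s = eta T"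
    proof -
      show "0 < T" "s \<le> T" "dyadic_sup s = eta T" using Pi by (auto simp: T_def P_def)
      have "(1 / 2 :: real) ^ i \<le> (1 / 2) ^ 1" using Pi by (intro power_decreasing) (auto simp: P_def)
      then show "T \<le> 1 / 2" by (simp add: T_def)
    qed
    have sub: "{T / 2<..<T} \<subseteq> level_of s"
    proof
      fix t assume t: "t \<in> {T / 2<..<T}"
      have "dyadic_sup t \<le> dyadic_sup s"
      proof -
        obtain j where j: "1 \<le> j" "t \<le> (1 / 2) ^ j" "dyadic_sup t = eta ((1 / 2) ^ j)"
          using dyadic_sup_attained[of t] t T by auto
        have "\<not> i < j"
        proof
          assume "i < j"
          then have "(1 / 2 :: real) ^ j \<le> (1 / 2) ^ Suc i" by (intro power_decreasing) auto
          then show False using j t by (auto simp: T_def)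
        qed
        then have "(1 / 2 :: real) ^ i \<le> (1 / 2) ^ j" by (intro power_decreasing) auto
        then have "s \<le> (1 / 2) ^ j" using T(3) unfolding T_def by linarith
        then show ?thesis unfolding j(3) by (rule dyadic_sup_upper[OF j(1)])
      qed
      moreover have "dyadic_sup s \<le> dyadic_sup t"
        unfolding T(4) T_def using t Pi by (intro dyadic_sup_upper) (auto simp: T_def P_def)
      ultimately show "t \<in> level_of s" using t T by (auto simp: level_of_def space_U)
    qed
    have TI: "emeasure U {T / 2<..<T} = ennreal (T / 2)" using T by (intro emeasure_U_interval) auto
    have "emeasure U {T / 2<..<T} \<le> emeasure U (level_of s)" using sub by (intro emeasure_mono) auto
    then have pos: "emeasure U (level_of s) \<noteq> 0" using T by (auto simp: TI)
    have "dyadic_sup s * emeasure U (level_of s) \<le> ennreal (dbl_const) * (\<integral>\<^sup>+u. indicator (level_of s) u * eta u \<partial>U)"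
    proof (cases "dyadic_sup s = 0")
      case True then show ?thesis by simp
    next
      case nz: False
      have "level_of s \<subseteq> {0<..T}"
      proof
        fix t assume "t \<in> level_of s"
        then have t: "0 < t" "t < 1" "dyadic_sup t = dyadic_sup s" by (auto simp: level_of_def space_U)
        show "t \<in> {0<..T}"
        proof (rule ccontr)
          assume "t \<notin> {0<..T}"
          then have tT: "T < t" using t by simp
          have "t \<le> 1 / 2" using dyadic_sup_eq_0[of t] nz t by (cases "1 / 2 < t") auto
          then obtain j where j: "1 \<le> j" "t \<le> (1 / 2) ^ j" "dyadic_sup t = eta ((1 / 2) ^ j)"
            using dyadic_sup_attained[of t] t by auto
          have "\<not> i \<le> j"
          proof
            assume "i \<le> j"
            then have "(1 / 2 :: real) ^ j \<le> (1 / 2) ^ i" by (intro power_decreasing) auto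
            then show False using j(2) tT unfolding T_def by linarith
          qed
          then have "\<not> P j" by (intro least) simp
          then show False using j t tT T by (auto simp: P_def)
        qed
      qed
      then have "emeasure U (level_of s) \<le> emeasure U {0<..T}"
        using T by (intro emeasure_mono) (auto simp: sets_restrict_space_iff space_U)
      also have "\<dots> = ennreal T" using T by (subst emeasure_restrict_space) auto
      finally have "dyadic_sup s * emeasure U (level_of s) \<le> eta T * ennreal T"
        unfolding T(4) by (rule mult_left_mono) simp
      also have "\<dots> = 2 * (eta T * ennreal (T / 2))"
      proof -
        have "ennreal T = 2 * ennreal (T / 2)" using T by (simp add: ennreal_mult[symmetric] flip: ennreal_numeral)
        then show ?thesis by (simp only: mult_ac)
      qed
      also have "\<dots> \<le> 2 * (ennreal (2 powr a) * (\<integral>\<^sup>+u. indicator {T / 2<..<T} u * eta u \<partial>U))"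
        using T by (intro mult_left_mono eta_block) auto
      also have "\<dots> = ennreal (dbl_const) * (\<integral>\<^sup>+u. indicator {T / 2<..<T} u * eta u \<partial>U)"
        unfolding dbl_const_def by (subst ennreal_mult) (auto simp: mult.assoc)
      also have "\<dots> \<le> ennreal (dbl_const) * (\<integral>\<^sup>+u. indicator (level_of s) u * eta u \<partial>U)"
        using sub by (intro mult_left_mono nn_integral_mono mult_right_mono) (auto simp: indicator_def)
      finally show ?thesis .
    qed
    then show ?thesis using pos by simp
  qed
  then show "emeasure U (level_of s) \<noteq> 0"
    "dyadic_sup s * emeasure U (level_of s) \<le> ennreal (dbl_const) * (\<integral>\<^sup>+u. indicator (level_of s) u * eta u \<partial>U)" by auto
qed

lemma level_of_measure_measurable [measurable]: "(\<lambda>s. emeasure U (level_of s)) \<in> borel_measurable U"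
proof -
  have "emeasure U (level_of s) = (\<integral>\<^sup>+t. (if dyadic_sup t = dyadic_sup s then 1 else 0) \<partial>U)" for s
  proof -
    have "emeasure U (level_of s) = (\<integral>\<^sup>+t. indicator (level_of s) t \<partial>U)" by simp
    also have "\<dots> = (\<integral>\<^sup>+t. (if dyadic_sup t = dyadic_sup s then 1 else 0) \<partial>U)"
      by (intro nn_integral_cong) (auto simp: level_of_def)
    finally show ?thesis .
  qed
  moreover have "(\<lambda>s. \<integral>\<^sup>+t. (if dyadic_sup t = dyadic_sup s then 1 else 0) \<partial>U) \<in> borel_measurable U" by measurable
  ultimately show ?thesis by simp
qed

lemma level_ker_measurable [measurable]: "(\<lambda>x. level_ker (fst x) (snd x)) \<in> borel_measurable (U \<Otimes>\<^sub>M U)"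
  unfolding level_ker_def by measurable

lemma level_ker_measurable1 [measurable]: "level_ker s \<in> borel_measurable U" "(\<lambda>s. level_ker s t) \<in> borel_measurable U"
  unfolding level_ker_def[abs_def] by measurable

lemma level_ker_sym: "level_ker s t = level_ker t s"
  unfolding level_ker_def using level_of_eq[of s t] by auto

lemma level_ker_integral_1:
  assumes "s \<in> space U"
  shows "(\<integral>\<^sup>+t. level_ker s t \<partial>U) = 1"
proof -
  have "(\<integral>\<^sup>+t. level_ker s t \<partial>U) = (\<integral>\<^sup>+t. inverse (emeasure U (level_of s)) * indicator (level_of s) t \<partial>U)"
    by (intro nn_integral_cong) (auto simp: level_ker_def level_of_def)
  also have "\<dots> = inverse (emeasure U (level_of s)) * emeasure U (level_of s)"
    by (rule nn_integral_cmult_indicator) measurable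
  also have "\<dots> = 1"
    using level_of_props(1)[OF assms] ennreal_divide_self[of "emeasure U (level_of s)"]
    by (simp add: divide_ennreal_def mult.commute U.emeasure_eq_measure)
  finally show ?thesis .
qed

lemma level_avg_nn_integral:
  assumes [measurable]: "f \<in> borel_measurable U" "g \<in> borel_measurable U"
  shows "(\<integral>\<^sup>+s. level_avg f s * g s \<partial>U) = (\<integral>\<^sup>+s. \<integral>\<^sup>+t. level_ker s t * (f t * g s) \<partial>U \<partial>U)"
    and "(\<integral>\<^sup>+s. level_avg f s * g s \<partial>U) = (\<integral>\<^sup>+t. \<integral>\<^sup>+s. level_ker s t * (f t * g s) \<partial>U \<partial>U)"
proof -
  show 1: "(\<integral>\<^sup>+s. level_avg f s * g s \<partial>U) = (\<integral>\<^sup>+s. \<integral>\<^sup>+t. level_ker s t * (f t * g s) \<partial>U \<partial>U)"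
    unfolding level_avg_def by (intro nn_integral_cong) (simp add: nn_integral_multc[symmetric] mult.assoc)
  have "(\<integral>\<^sup>+s. \<integral>\<^sup>+t. level_ker (fst (s, t)) (snd (s, t)) * (f t * g s) \<partial>U \<partial>U) = (\<integral>\<^sup>+t. \<integral>\<^sup>+s. level_ker (fst (s, t)) (snd (s, t)) * (f t * g s) \<partial>U \<partial>U)"
    by (rule UU.Fubini'[symmetric]) measurable
  then show "(\<integral>\<^sup>+s. level_avg f s * g s \<partial>U) = (\<integral>\<^sup>+t. \<integral>\<^sup>+s. level_ker s t * (f t * g s) \<partial>U \<partial>U)"
    unfolding 1 by simp
qed

text \<open>Chebyshev's inequality on each level set. The left side is written in two ways, with
  \<open>s\<close> and \<open>t\<close> exchanged, and their sum is compared with the sum of the two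
  diagonal terms, so that no subtraction occurs.\<close>

lemma level_avg_chebyshev:
  assumes f: "dec01 f" and g: "dec01 g"
  shows "(\<integral>\<^sup>+s. level_avg f s * g s \<partial>U) \<le> (\<integral>\<^sup>+s. f s * g s \<partial>U)"
proof -
  note [measurable] = dec01_measurable[OF f] dec01_measurable[OF g]
  let ?I = "\<integral>\<^sup>+s. level_avg f s * g s \<partial>U"
  have diag: "(\<integral>\<^sup>+s. \<integral>\<^sup>+t. level_ker s t * (f s * g s) \<partial>U \<partial>U) = (\<integral>\<^sup>+s. f s * g s \<partial>U)"
    by (intro nn_integral_cong) (simp add: nn_integral_multc level_ker_integral_1)
  have "(\<integral>\<^sup>+s. \<integral>\<^sup>+t. level_ker (fst (s, t)) (snd (s, t)) * (f t * g t) \<partial>U \<partial>U) = (\<integral>\<^sup>+t. \<integral>\<^sup>+s. level_ker (fst (s, t)) (snd (s, t)) * (f t * g t) \<partial>U \<partial>U)"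
    by (rule UU.Fubini'[symmetric]) measurable
  also have "\<dots> = (\<integral>\<^sup>+t. \<integral>\<^sup>+s. level_ker t s * (f t * g t) \<partial>U \<partial>U)"
    by (simp add: level_ker_sym)
  finally have diag': "(\<integral>\<^sup>+s. \<integral>\<^sup>+t. level_ker s t * (f t * g t) \<partial>U \<partial>U) = (\<integral>\<^sup>+s. f s * g s \<partial>U)"
    unfolding diag by simp
  have swap: "(\<integral>\<^sup>+s. \<integral>\<^sup>+t. level_ker s t * (f s * g t) \<partial>U \<partial>U) = ?I"
    unfolding level_avg_nn_integral(2)[OF dec01_measurable[OF f] dec01_measurable[OF g]] by (simp add: level_ker_sym)
  have "?I + ?I = (\<integral>\<^sup>+s. (\<integral>\<^sup>+t. level_ker s t * (f t * g s) \<partial>U) \<partial>U) + (\<integral>\<^sup>+s. (\<integral>\<^sup>+t. level_ker s t * (f s * g t) \<partial>U) \<partial>U)"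
    unfolding swap level_avg_nn_integral(1)[OF dec01_measurable[OF f] dec01_measurable[OF g], symmetric] ..
  also have "\<dots> = (\<integral>\<^sup>+s. (\<integral>\<^sup>+t. level_ker (fst (s, t)) (snd (s, t)) * (f t * g s) \<partial>U) + (\<integral>\<^sup>+t. level_ker (fst (s, t)) (snd (s, t)) * (f s * g t) \<partial>U) \<partial>U)"
    unfolding fst_conv snd_conv[symmetric] by (subst nn_integral_add) (auto simp: snd_conv)
  also have "\<dots> = (\<integral>\<^sup>+s. \<integral>\<^sup>+t. level_ker s t * (f t * g s + f s * g t) \<partial>U \<partial>U)"
    by (intro nn_integral_cong) (simp add: nn_integral_add[symmetric] distrib_left)
  also have "\<dots> \<le> (\<integral>\<^sup>+s. \<integral>\<^sup>+t. level_ker s t * (f t * g t + f s * g s) \<partial>U \<partial>U)"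
  proof (intro nn_integral_mono mult_left_mono)
    fix s t assume st: "s \<in> space U" "t \<in> space U"
    show "f t * g s + f s * g t \<le> f t * g t + f s * g s"
    proof (cases "s \<le> t")
      case True
      then have "f t \<le> f s" "g t \<le> g s" using st by (auto simp: space_U intro: dec01D[OF f] dec01D[OF g])
      then show ?thesis using chebyshev_ennreal[of "f t" "f s" "g t" "g s"] by (simp add: add.commute)
    next
      case False
      then have "f s \<le> f t" "g s \<le> g t" using st by (auto simp: space_U intro: dec01D[OF f] dec01D[OF g])
      then show ?thesis using chebyshev_ennreal[of "f s" "f t" "g s" "g t"] by (simp add: add.commute)
    qed
  qed simp
  also have "\<dots> = (\<integral>\<^sup>+s. (\<integral>\<^sup>+t. level_ker (fst (s, t)) (snd (s, t)) * (f t * g t) \<partial>U) + (\<integral>\<^sup>+t. level_ker (fst (s, t)) (snd (s, t)) * (f s * g s) \<partial>U) \<partial>U)"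
    by (intro nn_integral_cong) (simp add: nn_integral_add[symmetric] distrib_left)
  also have "\<dots> = (\<integral>\<^sup>+s. (\<integral>\<^sup>+t. level_ker (fst (s, t)) (snd (s, t)) * (f t * g t) \<partial>U) \<partial>U) + (\<integral>\<^sup>+s. (\<integral>\<^sup>+t. level_ker (fst (s, t)) (snd (s, t)) * (f s * g s) \<partial>U) \<partial>U)"
    by (intro nn_integral_add) measurable
  also have "\<dots> = (\<integral>\<^sup>+s. f s * g s \<partial>U) + (\<integral>\<^sup>+s. f s * g s \<partial>U)"
    using diag diag' by simp
  finally have "ennreal 2 * ?I \<le> ennreal 2 * (\<integral>\<^sup>+s. f s * g s \<partial>U)"
    by (simp add: mult_2)
  then have "ennreal (1 / 2) * (ennreal 2 * ?I) \<le> ennreal (1 / 2) * (ennreal 2 * (\<integral>\<^sup>+s. f s * g s \<partial>U))"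
    by (rule mult_left_mono) simp
  moreover have "ennreal (1 / 2) * (ennreal 2 * v) = v" for v
    by (subst mult.assoc[symmetric], subst ennreal_mult[symmetric]) auto
  ultimately show ?thesis by (simp only:)
qed

text \<open>A higher level lies entirely to the left of a lower one. If the levels at
  \<open>s\<close> and \<open>s'\<close> differ, every value of \<open>f\<close> averaged at
  \<open>s\<close> is thus at least every value averaged at \<open>s'\<close>.\<close>

lemma dec01_level_avg:
  assumes f: "dec01 f"
  shows "dec01 (level_avg f)"
  unfolding dec01_def
proof (intro allI impI)
  fix s s' :: real assume ss: "0 < s" "s \<le> s'" "s' < 1"
  then have U: "s \<in> space U" "s' \<in> space U" by (auto simp: space_U)
  note [measurable] = dec01_measurable[OF f]
  show "level_avg f s' \<le> level_avg f s"
  proof (cases "dyadic_sup s = dyadic_sup s'")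
    case True
    have "level_ker s t = level_ker s' t" for t unfolding level_ker_def level_of_eq[OF True] True ..
    then show ?thesis by (simp add: level_avg_def)
  next
    case False
    then have lt: "dyadic_sup s' < dyadic_sup s" using antimono_dyadic_sup[OF ss(2)] by (simp add: less_le)
    have ord: "t \<le> t'" if "dyadic_sup t = dyadic_sup s" "dyadic_sup t' = dyadic_sup s'" for t t'
      using that lt antimono_dyadic_sup[of t' t] by (cases "t \<le> t'") auto
    have "level_avg f s' = (\<integral>\<^sup>+t. level_ker s t \<partial>U) * level_avg f s'" by (simp add: level_ker_integral_1[OF U(1)])
    also have "\<dots> = (\<integral>\<^sup>+t. level_ker s t * level_avg f s' \<partial>U)" by (rule nn_integral_multc[symmetric]) measurable
    also have "\<dots> \<le> (\<integral>\<^sup>+t. level_ker s t * f t \<partial>U)"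
    proof (intro nn_integral_mono)
      fix t assume t: "t \<in> space U"
      show "level_ker s t * level_avg f s' \<le> level_ker s t * f t"
      proof (cases "dyadic_sup t = dyadic_sup s")
        case True
        have "level_avg f s' \<le> (\<integral>\<^sup>+t'. level_ker s' t' * f t \<partial>U)"
          unfolding level_avg_def
        proof (intro nn_integral_mono)
          fix t' assume t': "t' \<in> space U"
          show "level_ker s' t' * f t' \<le> level_ker s' t' * f t"
            using ord[OF True, of t'] t t' by (cases "dyadic_sup t' = dyadic_sup s'") (auto simp: level_ker_def space_U intro!: mult_left_mono dec01D[OF f])
        qed
        also have "\<dots> = f t" by (simp add: nn_integral_multc level_ker_integral_1[OF U(2)])
        finally show ?thesis by (rule mult_left_mono) simp
      qed (simp add: level_ker_def)
    qed
    finally show ?thesis by (simp add: level_avg_def)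
  qed
qed

text \<open>On a level set \<open>dyadic_sup\<close> is constant and, by
  \<open>level_of_props\<close>, at most \<open>dbl_const\<close> times the average of
  \<open>eta\<close>. Symmetry of the kernel then moves the average to \<open>f\<close>.\<close>

lemma dyadic_sup_le_level_avg:
  assumes f: "dec01 f"
  shows "(\<integral>\<^sup>+s. f s * dyadic_sup s \<partial>U) \<le> ennreal (dbl_const) * (\<integral>\<^sup>+s. level_avg f s * eta s \<partial>U)"
proof -
  note [measurable] = dec01_measurable[OF f]
  have "(\<integral>\<^sup>+t. f t * dyadic_sup t \<partial>U) \<le> (\<integral>\<^sup>+t. ennreal (dbl_const) * (\<integral>\<^sup>+s. level_ker (fst (s, t)) (snd (s, t)) * (f t * eta s) \<partial>U) \<partial>U)"
  proof (intro nn_integral_mono)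
    fix t assume t: "t \<in> space U"
    let ?L = "emeasure U (level_of t)"
    have inv: "?L * inverse ?L = 1"
      using level_of_props(1)[OF t] ennreal_divide_self[of ?L] by (simp add: divide_ennreal_def U.emeasure_eq_measure)
    have "dyadic_sup t = dyadic_sup t * ?L * inverse ?L" by (simp add: mult.assoc inv)
    also have "\<dots> \<le> ennreal (dbl_const) * (\<integral>\<^sup>+u. indicator (level_of t) u * eta u \<partial>U) * inverse ?L"
      by (intro mult_right_mono level_of_props(2)[OF t]) simp
    also have "\<dots> = ennreal (dbl_const) * (\<integral>\<^sup>+s. indicator (level_of t) s * eta s * inverse ?L \<partial>U)"
      by (subst nn_integral_multc) (auto simp: mult.assoc)
    also have "(\<integral>\<^sup>+s. indicator (level_of t) s * eta s * inverse ?L \<partial>U) = (\<integral>\<^sup>+s. level_ker s t * eta s \<partial>U)"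
      unfolding level_ker_sym[of _ t] by (intro nn_integral_cong) (auto simp: level_ker_def level_of_def indicator_def mult.commute)
    finally have "f t * dyadic_sup t \<le> f t * (ennreal (dbl_const) * (\<integral>\<^sup>+s. level_ker s t * eta s \<partial>U))"
      by (rule mult_left_mono) simp
    also have "\<dots> = ennreal (dbl_const) * (f t * (\<integral>\<^sup>+s. level_ker s t * eta s \<partial>U))" by (simp only: mult_ac)
    also have "f t * (\<integral>\<^sup>+s. level_ker s t * eta s \<partial>U) = (\<integral>\<^sup>+s. f t * (level_ker s t * eta s) \<partial>U)"
      by (rule nn_integral_cmult[symmetric]) measurable
    also have "\<dots> = (\<integral>\<^sup>+s. level_ker (fst (s, t)) (snd (s, t)) * (f t * eta s) \<partial>U)" by (simp add: mult_ac)
    finally show "f t * dyadic_sup t \<le> ennreal (dbl_const) * (\<integral>\<^sup>+s. level_ker (fst (s, t)) (snd (s, t)) * (f t * eta s) \<partial>U)" .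
  qed
  also have "\<dots> = ennreal (dbl_const) * (\<integral>\<^sup>+t. \<integral>\<^sup>+s. level_ker (fst (s, t)) (snd (s, t)) * (f t * eta s) \<partial>U \<partial>U)"
    by (rule nn_integral_cmult) measurable
  also have "\<dots> = ennreal (dbl_const) * (\<integral>\<^sup>+s. level_avg f s * eta s \<partial>U)"
    unfolding level_avg_nn_integral(2)[OF dec01_measurable[OF f] eta_measurable] by simp
  finally show ?thesis .
qed

text \<open>Substituting \<open>2 * s\<close> for \<open>s\<close> undoes the shift and gives the
  factor 2; then \<open>f (2 * s) \<le> f s\<close>.\<close>

lemma dyadic_maj_le_dyadic_sup:
  assumes f: "dec01 f"
  shows "(\<integral>\<^sup>+s. f s * dyadic_maj s \<partial>U) \<le> ennreal 2 * (\<integral>\<^sup>+s. f s * dyadic_sup s \<partial>U)"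
proof -
  note fb = dec01_borel[OF f] and eb = dec01_borel[OF dec01_dyadic_maj] and cb = dec01_borel[OF dec01_dyadic_sup]
  have "(\<integral>\<^sup>+s. f s * dyadic_maj s \<partial>U) = (\<integral>\<^sup>+s. (f s * indicator {0<..<1} s) * (dyadic_maj s * indicator {0<..<1} s) \<partial>lborel)"
    unfolding nn_integral_U by (intro nn_integral_cong) (auto simp: indicator_def)
  also have "\<dots> = ennreal \<bar>2\<bar> * (\<integral>\<^sup>+s. (f (0 + 2 * s) * indicator {0<..<1} (0 + 2 * s)) * (dyadic_maj (0 + 2 * s) * indicator {0<..<1} (0 + 2 * s)) \<partial>lborel)"
  proof -
    have "(\<lambda>s. (f s * indicator {0<..<1} s) * (dyadic_maj s * indicator {0<..<1} s)) \<in> borel_measurable borel"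
      using fb eb by (rule borel_measurable_times_ennreal)
    from nn_integral_real_affine[OF this, of 2 0] show ?thesis by simp
  qed
  also have "\<dots> \<le> ennreal \<bar>2\<bar> * (\<integral>\<^sup>+s. f s * dyadic_sup s * indicator {0<..<1} s \<partial>lborel)"
    by (intro mult_left_mono nn_integral_mono)
      (auto simp: indicator_def dyadic_maj_def intro!: mult_right_mono dec01D[OF f])
  finally show ?thesis unfolding nn_integral_U by simp
qed

text \<open>The witness is \<open>level_avg f\<close>. Its norm is at most that of \<open>f\<close>:
  by \<open>X'' = X\<close> it is tested against the associate unit ball, whose elements may be
  taken decreasing, and then \<open>level_avg_chebyshev\<close> removes the average.\<close>

lemma dyadic_maj_le_level_avg:
  assumes X: "ri_function_norm X" and f: "dec01 f" "X f \<le> 1"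
  shows "\<exists>fb. dec01 fb \<and> X fb \<le> 1 \<and> (\<integral>\<^sup>+s. f s * dyadic_maj s \<partial>U) \<le> ennreal (2 * dbl_const) * (\<integral>\<^sup>+s. fb s * eta s \<partial>U)"
proof (intro exI[of _ "level_avg f"] conjI)
  show d: "dec01 (level_avg f)" by (rule dec01_level_avg[OF f(1)])
  have "X (level_avg f) = associate_norm (associate_norm X) (level_avg f)"
    by (rule associate_associate_norm[OF X Mplus_dec01[OF d], symmetric])
  also have "\<dots> \<le> X f"
    unfolding associate_norm_le_iff[of "associate_norm X"]
  proof (intro ballI impI)
    fix g assume g: "g \<in> Mplus" "associate_norm X g \<le> 1"
    then have gm: "g \<in> borel_measurable U" by (simp add: Mplus_iff)
    have "(\<integral>\<^sup>+s. g s * level_avg f s \<partial>U) \<le> (\<integral>\<^sup>+s. rearr01 g s * level_avg f s \<partial>U)"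
      by (rule hardy_littlewood_dec01[OF gm d])
    also have "\<dots> \<le> (\<integral>\<^sup>+s. f s * rearr01 g s \<partial>U)"
      using level_avg_chebyshev[OF f(1) dec01_rearr01'[of g]] by (simp add: mult.commute)
    also have "\<dots> = (\<integral>\<^sup>+s. rearr01 g s * f s \<partial>U)" by (simp add: mult.commute)
    also have "\<dots> \<le> ennreal 1 * X f"
    proof (rule ri_hoelder[OF X Mplus_dec01[OF f(1)] Mplus_dec01[OF dec01_rearr01']])
      show "associate_norm X (rearr01 g) \<le> ennreal 1"
        using associate_norm_rearr01_le[OF X gm] g(2) by (auto intro: order_trans)
    qed simp
    finally show "(\<integral>\<^sup>+s. g s * level_avg f s \<partial>U) \<le> X f" by simp
  qed
  finally show "X (level_avg f) \<le> 1" using f(2) by simp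
  have "(\<integral>\<^sup>+s. f s * dyadic_maj s \<partial>U) \<le> ennreal 2 * (\<integral>\<^sup>+s. f s * dyadic_sup s \<partial>U)" by (rule dyadic_maj_le_dyadic_sup[OF f(1)])
  also have "\<dots> \<le> ennreal 2 * (ennreal (dbl_const) * (\<integral>\<^sup>+s. level_avg f s * eta s \<partial>U))"
    by (intro mult_left_mono dyadic_sup_le_level_avg f) simp
  also have "\<dots> = ennreal (2 * dbl_const) * (\<integral>\<^sup>+s. level_avg f s * eta s \<partial>U)"
    using dbl_const_pos by (subst ennreal_mult) (auto simp: mult.assoc)
  finally show "(\<integral>\<^sup>+s. f s * dyadic_maj s \<partial>U) \<le> ennreal (2 * dbl_const) * (\<integral>\<^sup>+s. level_avg f s * eta s \<partial>U)" .
qed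

end

end

section \<open>Iterating the construction\<close>

text \<open>Inserting the bound for \<open>m\<close> under \<open>hardy 1\<close> in
  \<open>eta_le_hardy1\<close> gives it for \<open>m + 1\<close>. The constant depends on
  \<open>a\<close> and \<open>m\<close> but not on \<open>\<psi>\<close>, as the norm estimates
  require.\<close>

lemma eta_le_hardy:
  assumes a: "0 \<le> a" and m: "1 \<le> m"
  shows "\<exists>D>0. \<forall>\<psi>. dec01 \<psi> \<longrightarrow> (\<forall>s\<in>space U. eta \<psi> a s \<le> ennreal D * hardy m (eta \<psi> a) s)"
  using m
proof (induction m rule: dec_induct)
  case base
  show ?case using eta_le_hardy1[OF _ a] dbl_const_pos by blast
next
  case (step m)
  then obtain D where D: "D > 0" "\<And>\<psi> s. dec01 \<psi> \<Longrightarrow> s \<in> space U \<Longrightarrow> eta \<psi> a s \<le> ennreal D * hardy m (eta \<psi> a) s" by blast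
  have dbl_const: "0 < dbl_const a" by (rule dbl_const_pos)
  have "eta \<psi> a s \<le> ennreal (dbl_const a * (D * (1 / m))) * hardy (Suc m) (eta \<psi> a) s" if \<psi>: "dec01 \<psi>" and s: "s \<in> space U" for \<psi> s
  proof -
    have [measurable]: "eta \<psi> a \<in> borel_measurable U" by (rule eta_measurable[OF \<psi> a])
    have "eta \<psi> a s \<le> ennreal (dbl_const a) * hardy 1 (eta \<psi> a) s" by (rule eta_le_hardy1[OF \<psi> a s])
    also have "\<dots> \<le> ennreal (dbl_const a) * hardy 1 (\<lambda>s. ennreal D * hardy m (eta \<psi> a) s) s"
      by (intro mult_left_mono hardy_mono D \<psi>) auto
    also have "\<dots> = ennreal (dbl_const a) * (ennreal D * (ennreal (1 / m) * hardy (Suc m) (eta \<psi> a) s))"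
      using step s by (subst hardy_cmult) (auto simp: hardy1_hardy[OF eta_measurable[OF \<psi> a] _ s, of m] simp del: One_nat_def)
    also have "\<dots> = ennreal (dbl_const a * (D * (1 / m))) * hardy (Suc m) (eta \<psi> a) s"
    proof -
      have "ennreal (dbl_const a * (D * (1 / m))) = ennreal (dbl_const a) * (ennreal D * ennreal (1 / m))"
        using D dbl_const by (intro ennreal_mult3') auto
      then show ?thesis by (simp add: mult.assoc)
    qed
    finally show ?thesis .
  qed
  then show ?case using D(1) dbl_const step by (intro exI[of _ "dbl_const a * (D * (1 / m))"]) auto
qed

text \<open>The term \<open>dyadic_maj\<close> on the right is not absorbed pointwise: it sees
  \<open>eta\<close> beyond \<open>s\<close>, where \<open>hardy m\<close> does not look. Its norm
  is controlled later through level averages. In the induction \<open>hardy 1\<close> reproduces it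
  by \<open>hardy1_dyadic_maj\<close>, and the resulting \<open>hardy 1\<close> of
  \<open>eta\<close> is dominated through \<open>eta_le_hardy\<close>.\<close>

lemma hardy_dyadic_maj:
  assumes a: "0 \<le> a" and m: "1 \<le> m"
  shows "\<exists>C>0. \<forall>\<psi>. dec01 \<psi> \<longrightarrow> (\<forall>s\<in>space U. hardy m (dyadic_maj \<psi> a) s \<le> ennreal C * (hardy m (eta \<psi> a) s + dyadic_maj \<psi> a s))"
  using m
proof (induction m rule: dec_induct)
  case base
  let ?M = "max 1 (4 * dbl_const a)"
  have "hardy 1 (dyadic_maj \<psi> a) s \<le> ennreal ?M * (hardy 1 (eta \<psi> a) s + dyadic_maj \<psi> a s)" if \<psi>: "dec01 \<psi>" and s: "s \<in> space U" for \<psi> s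
  proof -
    have "hardy 1 (dyadic_maj \<psi> a) s \<le> ennreal 1 * dyadic_maj \<psi> a s + ennreal (4 * dbl_const a) * hardy 1 (eta \<psi> a) s" using hardy1_dyadic_maj[OF \<psi> a s] by simp
    also have "\<dots> \<le> ennreal ?M * dyadic_maj \<psi> a s + ennreal ?M * hardy 1 (eta \<psi> a) s"
      by (intro add_mono mult_right_mono ennreal_leI) auto
    finally show ?thesis by (simp add: distrib_left add.commute)
  qed
  then show ?case by (intro exI[of _ ?M]) auto
next
  case (step m)
  then obtain C where C: "C > 0" "\<And>\<psi> s. dec01 \<psi> \<Longrightarrow> s \<in> space U \<Longrightarrow> hardy m (dyadic_maj \<psi> a) s \<le> ennreal C * (hardy m (eta \<psi> a) s + dyadic_maj \<psi> a s)" by blast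
  obtain D where D: "D > 0" "\<And>\<psi> s. dec01 \<psi> \<Longrightarrow> s \<in> space U \<Longrightarrow> eta \<psi> a s \<le> ennreal D * hardy m (eta \<psi> a) s"
    using eta_le_hardy[OF a] step by blast
  have dbl_const: "0 < dbl_const a" by (rule dbl_const_pos)
  define E where "E = 1 + 4 * dbl_const a * D"
  have E: "1 \<le> E" "0 \<le> E" using D dbl_const by (auto simp: E_def)
  have "hardy (Suc m) (dyadic_maj \<psi> a) s \<le> ennreal (m * (C * E)) * (hardy (Suc m) (eta \<psi> a) s + dyadic_maj \<psi> a s)" if \<psi>: "dec01 \<psi>" and s: "s \<in> space U" for \<psi> s
  proof -
    let ?eta = "eta \<psi> a" and ?dyadic_maj = "dyadic_maj \<psi> a"
    note [measurable] = dec01_measurable[OF dec01_dyadic_maj[OF \<psi> a]] eta_measurable[OF \<psi> a]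
    have A: "hardy 1 (hardy m ?eta) s \<le> hardy (Suc m) ?eta s"
    proof -
      have "hardy 1 (hardy m ?eta) s = ennreal (1 / m) * hardy (Suc m) ?eta s"
        using step s by (intro hardy1_hardy) auto
      also have "\<dots> \<le> 1 * hardy (Suc m) ?eta s"
        using step by (intro mult_right_mono) (auto simp: ennreal_le_1)
      finally show ?thesis by simp
    qed
    have B: "hardy 1 ?eta s \<le> ennreal D * hardy (Suc m) ?eta s"
    proof -
      have "hardy 1 ?eta s \<le> hardy 1 (\<lambda>s. ennreal D * hardy m ?eta s) s" by (intro hardy_mono D \<psi>)
      also have "\<dots> = ennreal D * hardy 1 (hardy m ?eta) s" by (rule hardy_cmult) measurable
      also have "\<dots> \<le> ennreal D * hardy (Suc m) ?eta s" by (rule mult_left_mono[OF A]) simp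
      finally show ?thesis .
    qed
    have "hardy (Suc m) ?dyadic_maj s = ennreal m * hardy 1 (hardy m ?dyadic_maj) s"
      using step s by (intro hardy_Suc) auto
    also have "\<dots> \<le> ennreal m * hardy 1 (\<lambda>s. ennreal C * (hardy m ?eta s + ?dyadic_maj s)) s"
      by (intro mult_left_mono hardy_mono C \<psi>) auto
    also have "hardy 1 (\<lambda>s. ennreal C * (hardy m ?eta s + ?dyadic_maj s)) s = ennreal C * hardy 1 (\<lambda>s. hardy m ?eta s + ?dyadic_maj s) s"
      by (rule hardy_cmult) measurable
    also have "hardy 1 (\<lambda>s. hardy m ?eta s + ?dyadic_maj s) s = hardy 1 (hardy m ?eta) s + hardy 1 ?dyadic_maj s"
      by (rule hardy_add) measurable
    also have "ennreal m * (ennreal C * (hardy 1 (hardy m ?eta) s + hardy 1 ?dyadic_maj s)) \<le>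
      ennreal m * (ennreal C * (ennreal E * (hardy (Suc m) ?eta s + ?dyadic_maj s)))"
    proof (intro mult_left_mono)
      have "hardy 1 (hardy m ?eta) s + hardy 1 ?dyadic_maj s \<le> hardy (Suc m) ?eta s + (?dyadic_maj s + ennreal (4 * dbl_const a) * (ennreal D * hardy (Suc m) ?eta s))"
        by (intro add_mono A order_trans[OF hardy1_dyadic_maj[OF \<psi> a s]] mult_left_mono B order_refl) simp
      also have "\<dots> = ennreal E * hardy (Suc m) ?eta s + ennreal 1 * ?dyadic_maj s"
      proof -
        have "ennreal E * hardy (Suc m) ?eta s = hardy (Suc m) ?eta s + ennreal (4 * dbl_const a) * (ennreal D * hardy (Suc m) ?eta s)"
          unfolding E_def using D dbl_const by (simp add: ennreal_mult' distrib_right mult.assoc ennreal_plus)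
        then show ?thesis by (simp add: ac_simps)
      qed
      also have "\<dots> \<le> ennreal E * hardy (Suc m) ?eta s + ennreal E * ?dyadic_maj s"
        using E by (intro add_left_mono mult_right_mono ennreal_leI) auto
      finally show "hardy 1 (hardy m ?eta) s + hardy 1 ?dyadic_maj s \<le> ennreal E * (hardy (Suc m) ?eta s + ?dyadic_maj s)"
        by (simp add: distrib_left)
    qed auto
    also have "\<dots> = ennreal (m * (C * E)) * (hardy (Suc m) ?eta s + ?dyadic_maj s)"
    proof -
      have "ennreal (m * (C * E)) = ennreal m * (ennreal C * ennreal E)" using C E by (intro ennreal_mult3') auto
      then show ?thesis by (simp add: mult.assoc)
    qed
    finally show ?thesis .
  qed
  then show ?case using C(1) E step by (intro exI[of _ "m * (C * E)"]) auto
qed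

lemma dec01_wt_mult: "0 \<le> b \<Longrightarrow> dec01 f \<Longrightarrow> dec01 (\<lambda>x. wt b x * f x)"
  by (intro dec01_mult dec01_wt)

lemma associate_norm_dyadic_maj_le:
  assumes X: "ri_function_norm X" and \<psi>: "dec01 \<psi>" and a: "0 \<le> a"
    and le: "\<And>f. dec01 f \<Longrightarrow> X f \<le> 1 \<Longrightarrow> (\<integral>\<^sup>+x. f x * eta \<psi> a x \<partial>U) \<le> c"
  shows "associate_norm X (dyadic_maj \<psi> a) \<le> ennreal (2 * dbl_const a) * c"
proof (rule associate_norm_dec01_le[OF X dec01_dyadic_maj[OF \<psi> a]])
  fix f assume f: "dec01 f" "X f \<le> 1"
  then obtain fb where fb: "dec01 fb" "X fb \<le> 1"
    "(\<integral>\<^sup>+s. f s * dyadic_maj \<psi> a s \<partial>U) \<le> ennreal (2 * dbl_const a) * (\<integral>\<^sup>+s. fb s * eta \<psi> a s \<partial>U)"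
    using dyadic_maj_le_level_avg[OF \<psi> a X] by blast
  note fb(3)
  also have "ennreal (2 * dbl_const a) * (\<integral>\<^sup>+s. fb s * eta \<psi> a s \<partial>U) \<le> ennreal (2 * dbl_const a) * c"
    by (intro mult_left_mono le fb) simp
  finally show "(\<integral>\<^sup>+s. f s * dyadic_maj \<psi> a s \<partial>U) \<le> ennreal (2 * dbl_const a) * c" .
qed

text \<open>The hypothesis speaks of decreasing test functions alone because
  \<open>associate_XG_norm_ge\<close> obtains the bound only for these. It passes from
  \<open>hardy m\<close> of \<open>eta\<close> to \<open>eta\<close> by \<open>eta_le_hardy\<close>,
  and from there to \<open>dyadic_maj\<close> by exchanging the test function for its level average,
  which is decreasing too.\<close>

lemma associate_norm_hardy_dyadic_maj_le:
  assumes X: "ri_function_norm X" and a: "0 \<le> a" and m: "1 \<le> m"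
  shows "\<exists>C>0. \<forall>\<psi> c. dec01 \<psi> \<longrightarrow> (\<forall>f. dec01 f \<longrightarrow> X f \<le> 1 \<longrightarrow> (\<integral>\<^sup>+x. f x * hardy m (eta \<psi> a) x \<partial>U) \<le> c) \<longrightarrow>
    associate_norm X (hardy m (dyadic_maj \<psi> a)) \<le> ennreal C * c"
proof -
  obtain D where D: "D > 0" "\<And>\<psi> s. dec01 \<psi> \<Longrightarrow> s \<in> space U \<Longrightarrow> eta \<psi> a s \<le> ennreal D * hardy m (eta \<psi> a) s"
    using eta_le_hardy[OF a m] by blast
  obtain C where C: "C > 0" "\<And>\<psi> s. dec01 \<psi> \<Longrightarrow> s \<in> space U \<Longrightarrow> hardy m (dyadic_maj \<psi> a) s \<le> ennreal C * (hardy m (eta \<psi> a) s + dyadic_maj \<psi> a s)"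
    using hardy_dyadic_maj[OF a m] by blast
  have dbl_const: "0 < dbl_const a" by (rule dbl_const_pos)
  define E where "E = 1 + 2 * dbl_const a * D"
  have E: "0 < E" using D dbl_const by (simp add: E_def add_pos_pos)
  have "associate_norm X (hardy m (dyadic_maj \<psi> a)) \<le> ennreal (C * E) * c"
    if \<psi>: "dec01 \<psi>" and c: "\<And>f. dec01 f \<Longrightarrow> X f \<le> 1 \<Longrightarrow> (\<integral>\<^sup>+x. f x * hardy m (eta \<psi> a) x \<partial>U) \<le> c" for \<psi> c
  proof (rule associate_norm_dec01_le[OF X dec01_hardy[OF dec01_dyadic_maj[OF \<psi> a]]])
    note [measurable] = dec01_measurable[OF dec01_dyadic_maj[OF \<psi> a]] eta_measurable[OF \<psi> a]
    have "(\<integral>\<^sup>+x. f x * eta \<psi> a x \<partial>U) \<le> ennreal D * c" if f: "dec01 f" "X f \<le> 1" for f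
    proof -
      note [measurable] = dec01_measurable[OF f(1)]
      have "(\<integral>\<^sup>+x. f x * eta \<psi> a x \<partial>U) \<le> (\<integral>\<^sup>+x. ennreal D * (f x * hardy m (eta \<psi> a) x) \<partial>U)"
        unfolding mult.left_commute[of "ennreal D"] by (intro nn_integral_mono mult_left_mono D \<psi>) auto
      also have "\<dots> = ennreal D * (\<integral>\<^sup>+x. f x * hardy m (eta \<psi> a) x \<partial>U)" by (rule nn_integral_cmult) measurable
      also have "\<dots> \<le> ennreal D * c" by (intro mult_left_mono c f) simp
      finally show ?thesis .
    qed
    then have eh: "associate_norm X (dyadic_maj \<psi> a) \<le> ennreal (2 * dbl_const a) * (ennreal D * c)"
      by (rule associate_norm_dyadic_maj_le[OF X \<psi> a])
    fix f assume f: "dec01 f" "X f \<le> 1"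
    note [measurable] = dec01_measurable[OF f(1)]
    have "(\<integral>\<^sup>+x. f x * hardy m (dyadic_maj \<psi> a) x \<partial>U) \<le> (\<integral>\<^sup>+x. ennreal C * (f x * hardy m (eta \<psi> a) x + f x * dyadic_maj \<psi> a x) \<partial>U)"
      unfolding distrib_left[symmetric] mult.left_commute[of "ennreal C"] by (intro nn_integral_mono mult_left_mono C \<psi>) auto
    also have "\<dots> = ennreal C * ((\<integral>\<^sup>+x. f x * hardy m (eta \<psi> a) x \<partial>U) + (\<integral>\<^sup>+x. f x * dyadic_maj \<psi> a x \<partial>U))"
      by (simp add: nn_integral_cmult nn_integral_add)
    also have "\<dots> \<le> ennreal C * (c + ennreal (2 * dbl_const a) * (ennreal D * c))"
      by (intro mult_left_mono add_mono c f order_trans[OF associate_norm_upper eh] Mplus_dec01) auto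
    also have "\<dots> = ennreal (C * E) * c"
    proof -
      have "c + ennreal (2 * dbl_const a) * (ennreal D * c) = ennreal E * c"
        unfolding E_def using D dbl_const by (simp add: ennreal_mult' distrib_right mult.assoc ennreal_plus)
      then show ?thesis using C E by (simp add: ennreal_mult mult.assoc)
    qed
    finally show "(\<integral>\<^sup>+x. f x * hardy m (dyadic_maj \<psi> a) x \<partial>U) \<le> ennreal (C * E) * c" .
  qed
  then show ?thesis using C(1) E by (intro exI[of _ "C * E"]) auto
qed

lemma wt_mult_dec01_le:
  assumes f: "dec01 f" and \<psi>: "dec01 \<psi>" and a: "0 \<le> a"
  shows "(\<integral>\<^sup>+x. f x * eta \<psi> a x \<partial>U) \<le> ennreal (2 powr a) * (\<integral>\<^sup>+x. dyadic_maj \<psi> a x * f x \<partial>U)"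
proof -
  note [measurable] = dec01_measurable[OF dec01_dyadic_maj[OF \<psi> a]] dec01_measurable[OF f]
  have "(\<integral>\<^sup>+x. f x * eta \<psi> a x \<partial>U) \<le> (\<integral>\<^sup>+x. ennreal (2 powr a) * (dyadic_maj \<psi> a x * f x) \<partial>U)"
  proof (intro nn_integral_mono)
    fix x assume "x \<in> space U"
    then have "eta \<psi> a x * f x \<le> ennreal (2 powr a) * dyadic_maj \<psi> a x * f x"
      by (intro mult_right_mono eta_le_dyadic_maj[OF \<psi> a]) auto
    then show "f x * eta \<psi> a x \<le> ennreal (2 powr a) * (dyadic_maj \<psi> a x * f x)" by (simp add: mult_ac)
  qed
  also have "\<dots> = ennreal (2 powr a) * (\<integral>\<^sup>+x. dyadic_maj \<psi> a x * f x \<partial>U)" by (rule nn_integral_cmult) measurable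
  finally show ?thesis .
qed

text \<open>With \<open>\<psi>\<close> the function whose associate norm is sought,
  \<open>hardy_wt_hardy_wt_le\<close> bounds \<open>hardy k\<close> of \<open>eta\<close>. Duality
  for the tilde norm asks for a decreasing function, so \<open>eta\<close> is exchanged for
  \<open>dyadic_maj\<close>, which dominates it and satisfies the same bound up to a
  constant.\<close>

lemma associate_XG_norm_le:
  assumes X: "ri_function_norm X" and k: "1 \<le> k" and h: "1 \<le> h"
  shows "\<exists>C>0. \<forall>G. dec01 G \<longrightarrow> associate_norm X (hardy (k + h) G) \<le> 1 \<longrightarrow>
    associate_norm (XG_norm k X) (hardy h (\<lambda>x. wt (k / 2) x * G x)) \<le> ennreal C"
proof -
  define a where "a = real k / 2"
  have a: "0 \<le> a" by (simp add: a_def)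
  note adm = admissible_ri[OF X]
  obtain C where C: "C > 0" "\<And>\<psi> c. dec01 \<psi> \<Longrightarrow> (\<And>f. dec01 f \<Longrightarrow> X f \<le> 1 \<Longrightarrow> (\<integral>\<^sup>+x. f x * hardy k (eta \<psi> a) x \<partial>U) \<le> c) \<Longrightarrow>
    associate_norm X (hardy k (dyadic_maj \<psi> a)) \<le> ennreal C * c"
    using associate_norm_hardy_dyadic_maj_le[OF X a k] by blast
  have "associate_norm (XG_norm k X) (hardy h (\<lambda>x. wt (k / 2) x * G x)) \<le> ennreal (2 powr a * (C * 2))"
    if G: "dec01 G" "associate_norm X (hardy (k + h) G) \<le> 1" for G
    unfolding associate_norm_le_iff
  proof (intro ballI impI)
    define \<psi> where "\<psi> = hardy h (\<lambda>x. wt (k / 2) x * G x)"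
    have \<psi>: "dec01 \<psi>" unfolding \<psi>_def by (intro dec01_hardy dec01_wt_mult G) simp
    note [measurable] = dec01_measurable[OF G(1)]
    have eta: "eta \<psi> a = (\<lambda>t. wt (- (k / 2)) t * hardy h (\<lambda>r. wt (k / 2) r * G r) t)"
      by (rule ext) (simp add: eta_def a_def flip: \<psi>_def)
    have Ceta: "associate_norm X (hardy k (dyadic_maj \<psi> a)) \<le> ennreal (C * 2)"
    proof -
      have "associate_norm X (hardy k (dyadic_maj \<psi> a)) \<le> ennreal C * ennreal 2"
      proof (rule C(2)[OF \<psi>])
        fix f assume f: "dec01 f" "X f \<le> 1"
        note [measurable] = dec01_measurable[OF f(1)]
        have "(\<integral>\<^sup>+x. f x * hardy k (eta \<psi> a) x \<partial>U) \<le> (\<integral>\<^sup>+x. ennreal 2 * (f x * hardy (k + h) G x) \<partial>U)"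
          unfolding eta mult.left_commute[of "ennreal 2"] by (intro nn_integral_mono mult_left_mono hardy_wt_hardy_wt_le k h) auto
        also have "\<dots> = ennreal 2 * (\<integral>\<^sup>+x. f x * hardy (k + h) G x \<partial>U)" by (rule nn_integral_cmult) measurable
        also have "\<dots> \<le> ennreal 2 * 1"
          by (intro mult_left_mono order_trans[OF associate_norm_upper G(2)] Mplus_dec01 f) auto
        finally show "(\<integral>\<^sup>+x. f x * hardy k (eta \<psi> a) x \<partial>U) \<le> ennreal 2" by simp
      qed
      then show ?thesis using C(1) by (subst ennreal_mult) auto
    qed
    fix f assume f: "f \<in> Mplus" "XG_norm k X f \<le> 1"
    then have fm: "f \<in> borel_measurable U" by (simp add: Mplus_iff)
    let ?F = "\<lambda>x. wt (k / 2) x * rearr01 f x"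
    have F: "dec01 ?F" by (intro dec01_wt_mult dec01_rearr01') simp
    have "(\<integral>\<^sup>+x. f x * \<psi> x \<partial>U) \<le> (\<integral>\<^sup>+x. rearr01 f x * \<psi> x \<partial>U)"
      by (rule hardy_littlewood_dec01[OF fm \<psi>])
    also have "\<dots> = (\<integral>\<^sup>+x. ?F x * eta \<psi> a x \<partial>U)"
    proof (intro nn_integral_cong)
      fix x assume x: "x \<in> space U"
      have "?F x * eta \<psi> a x = wt a x * (wt (- a) x * (rearr01 f x * \<psi> x))"
        unfolding eta_def by (simp add: a_def mult_ac)
      then show "rearr01 f x * \<psi> x = ?F x * eta \<psi> a x" by (simp only: wt_minus_mult(2)[OF x])
    qed
    also have "\<dots> \<le> ennreal (2 powr a) * (\<integral>\<^sup>+x. dyadic_maj \<psi> a x * ?F x \<partial>U)"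
      by (rule wt_mult_dec01_le[OF F \<psi> a])
    also have "\<dots> \<le> ennreal (2 powr a) * (ennreal (C * 2) * tilde_norm k X ?F)"
      using C(1) by (intro mult_left_mono tilde_norm_hoelder[OF adm k Mplus_dec01[OF F] dec01_dyadic_maj[OF \<psi> a] Ceta]) auto
    also have "\<dots> \<le> ennreal (2 powr a) * (ennreal (C * 2) * 1)"
      using f(2) unfolding XG_norm_eq by (intro mult_left_mono) auto
    also have "\<dots> = ennreal (2 powr a * (C * 2))"
      using C(1) by (subst ennreal_mult) auto
    finally show "(\<integral>\<^sup>+x. f x * hardy h (\<lambda>x. wt (k / 2) x * G x) x \<partial>U) \<le> ennreal (2 powr a * (C * 2))"
      by (simp add: \<psi>_def)
  qed
  then show ?thesis using C(1) by (intro exI[of _ "2 powr a * (C * 2)"]) auto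
qed

text \<open>A decreasing \<open>f\<close> in the unit ball of \<open>X\<close> is transported to
  \<open>F\<close>, the adjoint \<open>hardy_adj k f\<close> times the inverse weight.
  \<open>F\<close> lies in the unit ball of \<open>XG_norm k X\<close>, so the hypothesis on
  \<open>hardy h g\<close> can be tested with it.\<close>

lemma associate_XG_norm_ge:
  assumes X: "ri_function_norm X" and k: "1 \<le> k" and h: "1 \<le> h"
  shows "\<exists>C>0. \<forall>g. dec01 g \<longrightarrow> associate_norm (XG_norm k X) (hardy h g) \<le> 1 \<longrightarrow>
    associate_norm X (hardy (k + h) (dyadic_maj g (k / 2))) \<le> ennreal C"
proof -
  define a where "a = real k / 2"
  have a: "0 \<le> a" by (simp add: a_def)
  note adm = admissible_ri[OF X]
  have kh: "1 \<le> k + h" using k by simp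
  obtain C where C: "C > 0" "\<And>\<psi> c. dec01 \<psi> \<Longrightarrow> (\<And>f. dec01 f \<Longrightarrow> X f \<le> 1 \<Longrightarrow> (\<integral>\<^sup>+x. f x * hardy (k + h) (eta \<psi> a) x \<partial>U) \<le> c) \<Longrightarrow>
    associate_norm X (hardy (k + h) (dyadic_maj \<psi> a)) \<le> ennreal C * c"
    using associate_norm_hardy_dyadic_maj_le[OF X a kh] by blast
  obtain d where d: "d > 0" "\<And>g s. g \<in> borel_measurable U \<Longrightarrow> s \<in> space U \<Longrightarrow> hardy k (hardy h g) s = ennreal d * hardy (k + h) g s"
    using hardy_comp[OF k h] by blast
  have "associate_norm X (hardy (k + h) (dyadic_maj g (k / 2))) \<le> ennreal (C * (1 / d))"
    if g: "dec01 g" "associate_norm (XG_norm k X) (hardy h g) \<le> 1" for g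
  proof -
    note [measurable] = dec01_measurable[OF g(1)] eta_measurable[OF g(1) a]
    \<comment> \<open>The weight with negative exponent increases and \<open>hardy h\<close>
      integrates over \<open>r < t\<close>, so it can be pulled out at its value at
      \<open>t\<close>.\<close>
    have comm: "hardy h (eta g a) t \<le> wt (- a) t * hardy h g t" if t: "t \<in> space U" for t
    proof -
      have "hardy h (eta g a) t \<le> (\<integral>\<^sup>+r. wt (- a) t * (hardy_ker h t r * g r) \<partial>U)"
        unfolding hardy_def
      proof (intro nn_integral_mono)
        fix r assume r: "r \<in> space U"
        show "hardy_ker h t r * eta g a r \<le> wt (- a) t * (hardy_ker h t r * g r)"
        proof (cases "r < t")
          case True
          have "hardy_ker h t r * g r * wt (- a) r \<le> hardy_ker h t r * g r * wt (- a) t"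
            using True r t a by (intro mult_left_mono wt_minus_mono) (auto simp: space_U)
          then show ?thesis by (simp add: eta_def mult_ac)
        qed (simp add: hardy_ker_def)
      qed
      also have "\<dots> = wt (- a) t * hardy h g t" unfolding hardy_def by (rule nn_integral_cmult) measurable
      finally show ?thesis .
    qed
    have "associate_norm X (hardy (k + h) (dyadic_maj g a)) \<le> ennreal C * ennreal (1 / d)"
    proof (rule C(2)[OF g(1)])
      fix f assume f: "dec01 f" "X f \<le> 1"
      note [measurable] = dec01_measurable[OF f(1)]
      define F where "F r = wt (- (k / 2)) r * hardy_adj k f r" for r
      have F: "dec01 F" unfolding F_def by (rule dec01_wt_hardy_adj[OF f(1) k])
      have ZF: "XG_norm k X F \<le> 1"
      proof -
        have "XG_norm k X F = tilde_norm k X (\<lambda>s. wt (k / 2) s * F s)"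
          by (rule XG_norm_dec01[OF adm k F])
        also have "\<dots> = tilde_norm k X (hardy_adj k f)"
        proof (rule ri_cong_AE[OF ri_tilde_norm[OF adm k]])
          show "AE x in U. wt (k / 2) x * F x = hardy_adj k f x"
            by (rule AE_I2) (simp add: F_def wt_minus_mult(2))
        qed (auto intro!: Mplus_dec01 dec01_wt_mult F dec01_hardy_adj)
        also have "\<dots> \<le> 1" by (rule tilde_norm_hardy_adj_le[OF adm k Mplus_dec01[OF f(1)] f(2)])
        finally show ?thesis .
      qed
      have "(\<integral>\<^sup>+x. f x * hardy (k + h) (eta g a) x \<partial>U) = (\<integral>\<^sup>+x. ennreal (1 / d) * (f x * hardy k (hardy h (eta g a)) x) \<partial>U)"
      proof (intro nn_integral_cong)
        fix x assume x: "x \<in> space U"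
        have "ennreal (1 / d) * hardy k (hardy h (eta g a)) x = hardy (k + h) (eta g a) x"
          unfolding d(2)[OF eta_measurable[OF g(1) a] x] using ennreal_inverse_cancel[of "1 / d"] d(1) by simp
        then show "f x * hardy (k + h) (eta g a) x = ennreal (1 / d) * (f x * hardy k (hardy h (eta g a)) x)"
          by (metis mult.left_commute)
      qed
      also have "\<dots> = ennreal (1 / d) * (\<integral>\<^sup>+x. f x * hardy k (hardy h (eta g a)) x \<partial>U)"
        by (rule nn_integral_cmult) measurable
      also have "\<dots> \<le> ennreal (1 / d) * (\<integral>\<^sup>+x. f x * hardy k (\<lambda>t. wt (- a) t * hardy h g t) x \<partial>U)"
        by (intro mult_left_mono nn_integral_mono hardy_mono comm) auto
      also have "(\<integral>\<^sup>+x. f x * hardy k (\<lambda>t. wt (- a) t * hardy h g t) x \<partial>U) = (\<integral>\<^sup>+x. hardy_adj k f x * (wt (- a) x * hardy h g x) \<partial>U)"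
        by (rule hardy_hardy_adj_adjoint) measurable
      also have "\<dots> = (\<integral>\<^sup>+x. F x * hardy h g x \<partial>U)"
        by (simp add: F_def a_def mult_ac)
      also have "ennreal (1 / d) * (\<integral>\<^sup>+x. F x * hardy h g x \<partial>U) \<le> ennreal (1 / d) * 1"
      proof (rule mult_left_mono)
        have "(\<integral>\<^sup>+x. F x * hardy h g x \<partial>U) \<le> associate_norm (XG_norm k X) (hardy h g)"
          using Mplus_dec01[OF F] ZF by (rule associate_norm_upper)
        then show "(\<integral>\<^sup>+x. F x * hardy h g x \<partial>U) \<le> 1" using g(2) by simp
      qed simp
      finally show "(\<integral>\<^sup>+x. f x * hardy (k + h) (eta g a) x \<partial>U) \<le> ennreal (1 / d)" by simp
    qed
    then show ?thesis unfolding a_def using C(1) d(1) by (subst ennreal_mult) auto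
  qed
  then show ?thesis using C(1) d(1) by (intro exI[of _ "C * (1 / d)"]) auto
qed

text \<open>The weight of order \<open>k + h\<close> splits into those of orders \<open>k\<close>
  and \<open>h\<close>. The first is given to \<open>G\<close>, and the product, still decreasing,
  is the test function for the outer construction.\<close>

lemma XG_norm_add_le:
  assumes X: "ri_function_norm X" and k: "1 \<le> k" and h: "1 \<le> h"
  shows "\<exists>C>0. \<forall>f. XG_norm (k + h) X f \<le> ennreal C * XG_norm h (XG_norm k X) f"
proof -
  note adm = admissible_ri[OF X] and admZ = admissible_XG_norm[OF admissible_ri[OF X] k]
  obtain C where C: "C > 0" "\<And>G. dec01 G \<Longrightarrow> associate_norm X (hardy (k + h) G) \<le> 1 \<Longrightarrow>
    associate_norm (XG_norm k X) (hardy h (\<lambda>x. wt (k / 2) x * G x)) \<le> ennreal C"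
    using associate_XG_norm_le[OF X k h] by blast
  have kh: "1 \<le> k + h" using k by simp
  have "XG_norm (k + h) X f \<le> ennreal C * XG_norm h (XG_norm k X) f" for f
    unfolding XG_norm_eq[of "k + h"]
  proof (rule tilde_norm_dec01_le[OF adm kh])
    show "dec01 (\<lambda>s. wt ((k + h) / 2) s * rearr01 f s)" by (intro dec01_wt_mult dec01_rearr01') simp
    fix G assume G: "dec01 G" "associate_norm X (hardy (k + h) G) \<le> 1"
    have d: "dec01 (\<lambda>x. wt (k / 2) x * G x)" by (intro dec01_wt_mult G) simp
    have dh: "dec01 (\<lambda>x. wt (h / 2) x * rearr01 f x)" by (intro dec01_wt_mult dec01_rearr01') simp
    have "(\<integral>\<^sup>+x. G x * (wt ((k + h) / 2) x * rearr01 f x) \<partial>U) =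
      (\<integral>\<^sup>+x. (wt (k / 2) x * G x) * (wt (h / 2) x * rearr01 f x) \<partial>U)"
    proof (intro nn_integral_cong)
      fix x assume x: "x \<in> space U"
      have "wt ((k + h) / 2) x = wt (k / 2) x * wt (h / 2) x" using x by (simp add: wt_mult add_divide_distrib)
      then show "G x * (wt ((k + h) / 2) x * rearr01 f x) = (wt (k / 2) x * G x) * (wt (h / 2) x * rearr01 f x)"
        by (simp add: mult_ac)
    qed
    also have "\<dots> \<le> ennreal C * tilde_norm h (XG_norm k X) (\<lambda>x. wt (h / 2) x * rearr01 f x)"
      by (rule tilde_norm_hoelder[OF admZ h Mplus_dec01[OF dh] d C(2)[OF G] C(1)])
    finally show "(\<integral>\<^sup>+x. G x * (wt ((k + h) / 2) x * rearr01 f x) \<partial>U) \<le> ennreal C * XG_norm h (XG_norm k X) f"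
      unfolding XG_norm_eq[of h] .
  qed
  then show ?thesis using C(1) by blast
qed

text \<open>Here \<open>g\<close> has to receive the inverse weight of order \<open>k\<close>, which
  destroys monotonicity; \<open>dyadic_maj g (k / 2)\<close> takes the place of the product.\<close>

lemma XG_norm_add_ge:
  assumes X: "ri_function_norm X" and k: "1 \<le> k" and h: "1 \<le> h"
  shows "\<exists>C>0. \<forall>f. XG_norm h (XG_norm k X) f \<le> ennreal C * XG_norm (k + h) X f"
proof -
  define a where "a = real k / 2"
  have a: "0 \<le> a" by (simp add: a_def)
  note adm = admissible_ri[OF X] and admZ = admissible_XG_norm[OF admissible_ri[OF X] k]
  obtain C where C: "C > 0" "\<And>g. dec01 g \<Longrightarrow> associate_norm (XG_norm k X) (hardy h g) \<le> 1 \<Longrightarrow>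
    associate_norm X (hardy (k + h) (dyadic_maj g (k / 2))) \<le> ennreal C"
    using associate_XG_norm_ge[OF X k h] by blast
  have kh: "1 \<le> k + h" using k by simp
  have "XG_norm h (XG_norm k X) f \<le> ennreal (2 powr a * C) * XG_norm (k + h) X f" for f
    unfolding XG_norm_eq[of h]
  proof (rule tilde_norm_dec01_le[OF admZ h])
    show "dec01 (\<lambda>s. wt (h / 2) s * rearr01 f s)" by (intro dec01_wt_mult dec01_rearr01') simp
    fix g assume g: "dec01 g" "associate_norm (XG_norm k X) (hardy h g) \<le> 1"
    let ?F = "\<lambda>x. wt ((k + h) / 2) x * rearr01 f x"
    have F: "dec01 ?F" by (intro dec01_wt_mult dec01_rearr01') simp
    have "(\<integral>\<^sup>+x. g x * (wt (h / 2) x * rearr01 f x) \<partial>U) = (\<integral>\<^sup>+x. ?F x * eta g a x \<partial>U)"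
    proof (intro nn_integral_cong)
      fix x assume x: "x \<in> space U"
      have "wt ((k + h) / 2) x = wt a x * wt (h / 2) x" using x by (simp add: a_def wt_mult add_divide_distrib)
      then have "?F x * eta g a x = wt a x * (wt (- a) x * (g x * (wt (h / 2) x * rearr01 f x)))"
        by (simp add: eta_def mult_ac)
      then show "g x * (wt (h / 2) x * rearr01 f x) = ?F x * eta g a x" by (simp only: wt_minus_mult(2)[OF x])
    qed
    also have "\<dots> \<le> ennreal (2 powr a) * (\<integral>\<^sup>+x. dyadic_maj g a x * ?F x \<partial>U)"
      by (rule wt_mult_dec01_le[OF F g(1) a])
    also have "\<dots> \<le> ennreal (2 powr a) * (ennreal C * tilde_norm (k + h) X ?F)"
      using C(2)[OF g] C(1) by (intro mult_left_mono tilde_norm_hoelder[OF adm kh Mplus_dec01[OF F] dec01_dyadic_maj[OF g(1) a]]) (auto simp: a_def)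
    also have "\<dots> = ennreal (2 powr a * C) * tilde_norm (k + h) X ?F"
      using C(1) by (subst ennreal_mult) (auto simp: mult.assoc)
    finally show "(\<integral>\<^sup>+x. g x * (wt (h / 2) x * rearr01 f x) \<partial>U) \<le> ennreal (2 powr a * C) * XG_norm (k + h) X f"
      unfolding XG_norm_eq[of "k + h"] .
  qed
  then show ?thesis using C(1) by (intro exI[of _ "2 powr a * C"]) auto
qed

theorem theorem7p9:
  fixes X :: "(real \<Rightarrow> ennreal) \<Rightarrow> ennreal" and k h :: nat
  assumes "ri_function_norm X" and "1 \<le> k" and "1 \<le> h"
  shows "(gauss_space (XG_norm h (XG_norm k X)) :: (real ^ 'n::finite \<Rightarrow> ereal) set)
           = gauss_space (XG_norm (k + h) X) \<and>
         (\<exists>c C :: real. 0 < c \<and> 0 < C \<and>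
           (\<forall>u \<in> (gauss_space (XG_norm (k + h) X) :: (real ^ 'n \<Rightarrow> ereal) set).
              ennreal c * gauss_norm (XG_norm (k + h) X) u
                \<le> gauss_norm (XG_norm h (XG_norm k X)) u \<and>
              gauss_norm (XG_norm h (XG_norm k X)) u
                \<le> ennreal C * gauss_norm (XG_norm (k + h) X) u))"
proof -
  obtain C1 where C1: "C1 > 0" "\<And>f. XG_norm (k + h) X f \<le> ennreal C1 * XG_norm h (XG_norm k X) f"
    using XG_norm_add_le[OF assms] by blast
  obtain C2 where C2: "C2 > 0" "\<And>f. XG_norm h (XG_norm k X) f \<le> ennreal C2 * XG_norm (k + h) X f"
    using XG_norm_add_ge[OF assms] by blast
  have le: "ennreal (1 / C1) * XG_norm (k + h) X f \<le> XG_norm h (XG_norm k X) f" for f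
  proof -
    have "ennreal (1 / C1) * XG_norm (k + h) X f \<le> ennreal (1 / C1) * (ennreal C1 * XG_norm h (XG_norm k X) f)"
      by (intro mult_left_mono C1) simp
    then show ?thesis using ennreal_inverse_cancel[of "1 / C1"] C1(1) by simp
  qed
  \<comment> \<open>The two estimates hold for every function on the unit interval, with infinite
    values allowed, so finiteness is equivalent. The Gauss measure enters only through the
    rearrangement to which they are applied.\<close>
  have iff: "XG_norm h (XG_norm k X) f < \<infinity> \<longleftrightarrow> XG_norm (k + h) X f < \<infinity>" for f
  proof
    assume "XG_norm h (XG_norm k X) f < \<infinity>"
    then have "ennreal C1 * XG_norm h (XG_norm k X) f < \<infinity>" by (simp add: ennreal_mult_less_top)
    then show "XG_norm (k + h) X f < \<infinity>" using C1(2) by (rule le_less_trans[rotated])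
  next
    assume "XG_norm (k + h) X f < \<infinity>"
    then have "ennreal C2 * XG_norm (k + h) X f < \<infinity>" by (simp add: ennreal_mult_less_top)
    then show "XG_norm h (XG_norm k X) f < \<infinity>" using C2(2) by (rule le_less_trans[rotated])
  qed
  show ?thesis
  proof (rule conjI)
    show "(gauss_space (XG_norm h (XG_norm k X)) :: (real ^ 'n \<Rightarrow> ereal) set) = gauss_space (XG_norm (k + h) X)"
      unfolding gauss_space_def gauss_norm_def by (simp only: iff)
    show "\<exists>c C :: real. 0 < c \<and> 0 < C \<and>
           (\<forall>u \<in> (gauss_space (XG_norm (k + h) X) :: (real ^ 'n \<Rightarrow> ereal) set).
              ennreal c * gauss_norm (XG_norm (k + h) X) u
                \<le> gauss_norm (XG_norm h (XG_norm k X)) u \<and>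
              gauss_norm (XG_norm h (XG_norm k X)) u
                \<le> ennreal C * gauss_norm (XG_norm (k + h) X) u)"
    proof (intro exI conjI ballI)
      show "0 < 1 / C1" "0 < C2" using C1(1) C2(1) by auto
    qed (simp_all only: gauss_norm_def le C2(2))
  qed
qed

end
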